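(* Let $s\geq 3$ and let $\mathbf{u}_0\in H^s(\Omega)^3$, where $\Omega=\mathbb{R}^3/\mathbb{Z}^3$, with $\nabla\cdot\mathbf{u}_0=0$ and $\int_\Omega\mathbf{u}_0\,d\mathbf{x}=0$. For each $\alpha>0$, let $\mathbf{u}^\alpha$ be the unique global solution of the 3D Euler-Voigt equations with regularization parameter $\alpha$ and initial data $\mathbf{u}_0$. Suppose that, for some $T>0$, $$\limsup_{\alpha\to 0^+}\Big(\alpha\sup_{t\in[0,T]}\|\nabla\mathbf{u}^\alpha(t)\|_{L^2(\Omega)}\Big)>0.$$ Then the 3D incompressible Euler equations on $\Omega$ with initial data $\mathbf{u}_0$ must develop a singularity within the interval $[0,T]$.
   Context: Work on the periodic domain $\Omega=[0,1]^3=\mathbb{R}^3/\mathbb{Z}^3$ (periodic boundary conditions); $L^2=L^2(\Omega)$ and $H^s=H^s(\Omega)$ are the usual Lebesgue and Sobolev spaces of periodic functions. The initial data are assumed to have zero spatial mean, $\int_\Omega\mathbf{u}_0(\mathbf{x})\,d\mathbf{x}=0$, and solutions then have zero spatial mean for all times. Euler-Voigt equations: for $\alpha>0$, the unknowns are the velocity $\mathbf{u}=\mathbf{u}^\alpha(\mathbf{x},t)\in\mathbb{R}^3$ and the pressure $p(\mathbf{x},t)\in\mathbb{R}$, satisfying $$-\alpha^2\partial_t\nabla^2\mathbf{u}+\partial_t\mathbf{u}+(\mathbf{u}\cdot\nabla)\mathbf{u}+\nabla p=0,\qquad \nabla\cdot\mathbf{u}=0,\qquad \mathbf{u}(\mathbf{x},0)=\mathbf{u}_0(\mathbf{x}),$$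 where $\nabla^2$ is the Laplacian. It is known (Cao, Lunasin, Titi) that for each $\alpha>0$ these equations have a unique solution $\mathbf{u}^\alpha$ for all times, in the class $C^1(\mathbb{R};V)$, where $V$ is the space of divergence-free, mean-zero vector fields in $H^1(\Omega)^3$ (the momentum equation being understood in $H^{-1}$). Euler equations: the 3D incompressible Euler equations are the system obtained by formally setting $\alpha=0$ in the Euler-Voigt equations $-\alpha^2\partial_t\nabla^2\mathbf{u}+\partial_t\mathbf{u}+(\mathbf{u}\cdot\nabla)\mathbf{u}+\nabla p=0$, $\nabla\cdot\mathbf{u}=0$, $\mathbf{u}(\cdot,0)=\mathbf{u}_0$, i.e. $\partial_t\mathbf{u}+(\mathbf{u}\cdot\nabla)\mathbf{u}+\nabla p=0$, $\nabla\cdot\mathbf{u}=0$, $\mathbf{u}(\cdot,0)=\mathbf{u}_0$. It is classical that for divergence-free $\mathbf{u}_0\in H^3$ there is a unique strong solution $\mathbf{u}\in C([0,T_{\max});H^3)$ on a maximal time interval $[0,T_{\max})$, with $0<T_{\max}\le\infty$. "The Euler equations develop a singularity within the interval $[0,T]$" means that this strong solution does not remain smooth on all of $[0,T]$, i.e. $T_{\max}\le T$. *)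

theory Defs
  imports "HOL-Analysis.Analysis"
begin

text \<open>
  Functions on the torus are represented by 1-periodic functions on \<open>real^3\<close>; integrals are taken
  over the unit cube.  Elements of \<open>L\<^sup>2\<close> and \<open>H\<^sup>s\<close> are representatives: everything below is
  invariant under (periodic) modification on null sets.
\<close>

type_synonym scalar_field = "real^3 \<Rightarrow> real"
type_synonym vector_field = "real^3 \<Rightarrow> real^3"

abbreviation Omega :: "(real^3) measure" where
  "Omega \<equiv> lebesgue_on (cbox 0 1)"

definition periodic :: "(real^3 \<Rightarrow> 'b) \<Rightarrow> bool" where
  "periodic f \<longleftrightarrow> (\<forall>x j. f (x + axis j 1) = f x)"

abbreviation component :: "vector_field \<Rightarrow> 3 \<Rightarrow> scalar_field" where
  "component u i \<equiv> (\<lambda>x. u x $ i)"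

definition L2 :: "scalar_field set" where
  "L2 = {f. periodic f \<and> f \<in> borel_measurable Omega \<and> integrable Omega (\<lambda>x. (f x)\<^sup>2)}"

definition L2v :: "vector_field set" where
  "L2v = {u. \<forall>i. component u i \<in> L2}"

definition L2v_norm :: "vector_field \<Rightarrow> real" where
  "L2v_norm u = sqrt (LINT x|Omega. (norm (u x))\<^sup>2)"

definition fourier_coeff :: "scalar_field \<Rightarrow> int^3 \<Rightarrow> complex" where
  "fourier_coeff f k =
     (LINT x|Omega. complex_of_real (f x) * cis (- (2 * pi * (\<Sum>j\<in>UNIV. real_of_int (k $ j) * x $ j))))"

text \<open>The weight is normalised so that \<open>H\<^sup>0 = L\<^sup>2\<close> and
  \<open>\<parallel>f\<parallel>\<^sup>2 = \<parallel>f\<parallel>\<^sup>2 + \<parallel>\<nabla>f\<parallel>\<^sup>2\<close> for the \<open>H\<^sup>1\<close> norm on the left and \<open>L\<^sup>2\<close> norms on the right.\<close>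

definition sobolev_weight :: "real \<Rightarrow> int^3 \<Rightarrow> real" where
  "sobolev_weight s k = (1 + 4 * pi\<^sup>2 * (\<Sum>j\<in>UNIV. (real_of_int (k $ j))\<^sup>2)) powr s"

text \<open>Only used for \<open>s \<ge> 0\<close>.\<close>

definition H :: "real \<Rightarrow> scalar_field set" where
  "H s = {f \<in> L2. (\<lambda>k. sobolev_weight s k * (cmod (fourier_coeff f k))\<^sup>2) summable_on UNIV}"

definition Hv :: "real \<Rightarrow> vector_field set" where
  "Hv s = {u. \<forall>i. component u i \<in> H s}"

definition Hv_norm :: "real \<Rightarrow> vector_field \<Rightarrow> real" where
  "Hv_norm s u =
     sqrt (\<Sum>i\<in>UNIV. \<Sum>\<^sub>\<infinity>k. sobolev_weight s k * (cmod (fourier_coeff (component u i) k))\<^sup>2)"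

definition partial_deriv :: "3 \<Rightarrow> scalar_field \<Rightarrow> scalar_field" where
  "partial_deriv j f x = frechet_derivative f (at x) (axis j 1)"

primrec Ck :: "nat \<Rightarrow> scalar_field \<Rightarrow> bool" where
  "Ck 0 f \<longleftrightarrow> continuous_on UNIV f"
| "Ck (Suc n) f \<longleftrightarrow> (\<forall>x. f differentiable (at x)) \<and> (\<forall>j. Ck n (partial_deriv j f))"

definition test_function :: "scalar_field \<Rightarrow> bool" where
  "test_function \<phi> \<longleftrightarrow> periodic \<phi> \<and> (\<forall>n. Ck n \<phi>)"

definition is_weak_deriv :: "3 \<Rightarrow> scalar_field \<Rightarrow> scalar_field \<Rightarrow> bool" where
  "is_weak_deriv j f g \<longleftrightarrow> g \<in> L2 \<and>
     (\<forall>\<phi>. test_function \<phi> \<longrightarrow>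
        (LINT x|Omega. f x * partial_deriv j \<phi> x) = - (LINT x|Omega. g x * \<phi> x))"

text \<open>For \<open>f \<in> H 1\<close> the weak derivative exists and is unique almost everywhere; the choice of
  representative is immaterial below.\<close>

definition wd :: "3 \<Rightarrow> scalar_field \<Rightarrow> scalar_field" where
  "wd j f = (SOME g. is_weak_deriv j f g)"

definition grad :: "scalar_field \<Rightarrow> vector_field" where
  "grad p x = (\<chi> j. wd j p x)"

definition divergence :: "vector_field \<Rightarrow> scalar_field" where
  "divergence u x = (\<Sum>j\<in>UNIV. wd j (component u j) x)"

definition divergence_free :: "vector_field \<Rightarrow> bool" where
  "divergence_free u \<longleftrightarrow> (AE x in Omega. divergence u x = 0)"

definition mean_zero :: "vector_field \<Rightarrow> bool" where
  "mean_zero u \<longleftrightarrow> (LINT x|Omega. u x) = 0"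

text \<open>\<open>(v \<cdot> \<nabla>) u\<close>\<close>

definition advect :: "vector_field \<Rightarrow> vector_field \<Rightarrow> vector_field" where
  "advect v u x = (\<chi> i. \<Sum>j\<in>UNIV. v x $ j * wd j (component u i) x)"

definition inner_L2 :: "vector_field \<Rightarrow> vector_field \<Rightarrow> real" where
  "inner_L2 u v = (LINT x|Omega. u x \<bullet> v x)"

definition inner_grad :: "vector_field \<Rightarrow> vector_field \<Rightarrow> real" where
  "inner_grad u v =
     (LINT x|Omega. (\<Sum>i\<in>UNIV. \<Sum>j\<in>UNIV. wd j (component u i) x * wd j (component v i) x))"

definition grad_norm :: "vector_field \<Rightarrow> real" where
  "grad_norm u = sqrt (LINT x|Omega. (\<Sum>i\<in>UNIV. \<Sum>j\<in>UNIV. (wd j (component u i) x)\<^sup>2))"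

text \<open>Continuity and differentiability on the time set \<open>I\<close> of a curve of vector fields with respect
  to the norm \<open>N\<close>.\<close>

definition cont_curve :: "(vector_field \<Rightarrow> real) \<Rightarrow> real set \<Rightarrow> (real \<Rightarrow> vector_field) \<Rightarrow> bool" where
  "cont_curve N I u \<longleftrightarrow> (\<forall>t\<in>I. ((\<lambda>r. N (\<lambda>x. u r x - u t x)) \<longlongrightarrow> 0) (at t within I))"

definition deriv_curve ::
  "(vector_field \<Rightarrow> real) \<Rightarrow> real set \<Rightarrow> (real \<Rightarrow> vector_field) \<Rightarrow> (real \<Rightarrow> vector_field) \<Rightarrow> bool" where
  "deriv_curve N I u u' \<longleftrightarrow>
     (\<forall>t\<in>I. ((\<lambda>r. N (\<lambda>x. (1 / (r - t)) *\<^sub>R (u r x - u t x) - u' t x)) \<longlongrightarrow> 0) (at t within I))"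

definition V :: "vector_field set" where
  "V = {u \<in> Hv 1. divergence_free u \<and> mean_zero u}"

text \<open>The momentum equation is an identity in \<open>H\<^sup>-\<^sup>1\<close>, the dual of \<open>H\<^sup>1\<close>: it is paired with every
  \<open>\<phi> \<in> H\<^sup>1\<close>, the Laplacian and the pressure gradient acting by integration by parts.  All integrands
  are integrable because \<open>H\<^sup>1\<close> embeds into \<open>L\<^sup>6\<close> in dimension three.\<close>

definition euler_voigt_solution :: "real \<Rightarrow> vector_field \<Rightarrow> (real \<Rightarrow> vector_field) \<Rightarrow> bool" where
  "euler_voigt_solution \<alpha> u0 u \<longleftrightarrow>
     (\<forall>t. u t \<in> V) \<and>
     (AE x in Omega. u 0 x = u0 x) \<and>
     (\<exists>u' p.
        (\<forall>t. u' t \<in> V) \<and> deriv_curve (Hv_norm 1) UNIV u u' \<and> cont_curve (Hv_norm 1) UNIV u' \<and>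
        (\<forall>t. p t \<in> L2) \<and>
        (\<forall>t. \<forall>\<phi>\<in>Hv 1.
           \<alpha>\<^sup>2 * inner_grad (u' t) \<phi> + inner_L2 (u' t) \<phi> + inner_L2 (advect (u t) (u t)) \<phi>
             - (LINT x|Omega. p t x * divergence \<phi> x) = 0))"

text \<open>Strong solutions in \<open>C([0,S); H\<^sup>3)\<close>; the equation holds almost everywhere in space for every
  time, the time derivative being a limit of difference quotients in \<open>L\<^sup>2\<close> (one-sided at time 0).\<close>

definition euler_strong_solution :: "vector_field \<Rightarrow> real \<Rightarrow> (real \<Rightarrow> vector_field) \<Rightarrow> bool" where
  "euler_strong_solution u0 S u \<longleftrightarrow>
     (\<forall>t\<in>{0..<S}. u t \<in> Hv 3 \<and> divergence_free (u t)) \<and>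
     cont_curve (Hv_norm 3) {0..<S} u \<and>
     (AE x in Omega. u 0 x = u0 x) \<and>
     (\<exists>u' p.
        (\<forall>t\<in>{0..<S}. u' t \<in> L2v \<and> p t \<in> H 1) \<and>
        deriv_curve L2v_norm {0..<S} u u' \<and>
        (\<forall>t\<in>{0..<S}. AE x in Omega. u' t x + advect (u t) (u t) x + grad (p t) x = 0))"

text \<open>By uniqueness of strong solutions, the supremum of the existence times is the length of the
  maximal interval of existence.\<close>

definition euler_T_max :: "vector_field \<Rightarrow> ereal" where
  "euler_T_max u0 = (SUP S \<in> {S. S > 0 \<and> (\<exists>u. euler_strong_solution u0 S u)}. ereal S)"

definition euler_singularity_within :: "vector_field \<Rightarrow> real \<Rightarrow> bool" where
  "euler_singularity_within u0 T \<longleftrightarrow> euler_T_max u0 \<le> ereal T"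

end

theory Submission
  imports Defs
begin

text \<open>
  If the Euler solution \<open>v\<close> stays in \<open>H\<^sup>3\<close> beyond time \<open>T\<close>, then \<open>w = u\<^sup>\<alpha> - v\<close> satisfies, with
  \<open>E = \<parallel>w\<parallel>\<^sup>2 + \<alpha>\<^sup>2 \<parallel>\<nabla>w\<parallel>\<^sup>2\<close>, the inequality \<open>E' \<le> C E + \<alpha>\<^sup>2 M\<^sup>2\<close>: the term \<open>((w \<cdot> \<nabla>) v, w)\<close> is bounded by
  \<open>\<parallel>\<nabla>v\<parallel>\<^sub>\<infinity> \<parallel>w\<parallel>\<^sup>2\<close>, and the contribution \<open>\<alpha>\<^sup>2 (\<nabla>\<partial>\<^sub>tv, \<nabla>w)\<close> of the missing regularization by
  \<open>\<alpha>\<^sup>2 M \<parallel>\<nabla>w\<parallel>\<close>, where \<open>M\<close> is a Lipschitz constant of \<open>v\<close> in \<open>H\<^sup>1\<close>.  As \<open>E\<close> vanishes initially, Gronwall gives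
  \<open>\<parallel>\<nabla>w\<parallel> = O(1)\<close> uniformly in \<open>\<alpha>\<close>, so that \<open>\<alpha> sup \<parallel>\<nabla>u\<^sup>\<alpha>\<parallel>\<close> tends to zero.  All function spaces are handled
  through Fourier coefficients; the Sobolev embeddings reduce to a weighted Cauchy-Schwarz
  inequality for convolutions and the convergence of \<open>\<Sum>\<^sub>k (1 + \<bar>k\<bar>\<^sup>2)\<^sup>-\<^sup>2\<close> in dimension three.
\<close>

section \<open>Fourier modes on the torus\<close>

text \<open>The obstacle is the regularity of the Euler solution in time: its time derivative is a
  limit of difference quotients in \<open>L2\<close> only, so the gradient of that derivative cannot
  be paired with anything and \<open>E\<close> is not known to be differentiable. Two devices
  replace it. A Lipschitz bound for the gradient of \<open>v r - v t\<close> comes from testing the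
  Euler equation with the Laplacian of this increment, which is again solenoidal; integrating by
  parts leaves the \<open>H 1\<close> norm of the nonlinearity, controlled by the \<open>H 3\<close>
  norm of \<open>v\<close>. And \<open>E\<close> is estimated through right difference quotients, in
  which an increment of \<open>v\<close> splits into an \<open>L2\<close> part that has a derivative
  and a gradient part of size \<open>M\<close> times the time step. Testing with solenoidal fields
  alone removes both pressures and takes the place of a projection. The source of the resulting
  inequality carries the factor \<open>\<alpha>^2\<close> with the same \<open>M\<close> for every
  \<open>\<alpha>\<close>; the gradient of the difference carries the same factor inside
  \<open>E\<close>, and the two cancel. Since \<open>wd\<close> is an arbitrary choice of
  representative, weak derivatives are identified through their Fourier coefficients.\<close>

definition ek :: "int^3 \<Rightarrow> real^3 \<Rightarrow> complex" where
  "ek k x = cis (2 * pi * (\<Sum>j\<in>UNIV. real_of_int (k $ j) * x $ j))"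

lemma ek_zero [simp]: "ek 0 x = 1"
  by (simp add: ek_def)

lemma ek_add: "ek (k + l) x = ek k x * ek l x"
  by (simp add: ek_def cis_mult ring_distribs sum.distrib)

lemma ek_uminus: "ek (- k) x = cnj (ek k x)"
  by (simp add: ek_def cis_cnj sum_negf)

lemma ek_diff: "ek (k - l) x = ek k x * cnj (ek l x)"
  using ek_add[of k "- l" x] by (simp add: ek_uminus)

lemma norm_ek [simp]: "cmod (ek k x) = 1"
  by (simp add: ek_def)

lemma continuous_on_ek [continuous_intros]: "continuous_on S (ek k)"
  unfolding ek_def by (intro continuous_intros)

lemma ek_add_axis: "ek k (x + axis j t) = cis (2 * pi * real_of_int (k $ j) * t) * ek k x"
proof -
  have "(\<Sum>i\<in>UNIV. real_of_int (k $ i) * axis j t $ i) = real_of_int (k $ j) * t"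
    by (simp add: axis_def if_distrib cong: if_cong)
  then have "(\<Sum>i\<in>UNIV. real_of_int (k $ i) * (x + axis j t) $ i)
    = (\<Sum>i\<in>UNIV. real_of_int (k $ i) * x $ i) + real_of_int (k $ j) * t"
    by (simp add: ring_distribs sum.distrib)
  then show ?thesis
    by (simp add: ek_def cis_mult ring_distribs algebra_simps)
qed

lemma periodic_ek: "periodic (ek k)"
proof -
  have "cis (2 * pi * real_of_int n) = 1" for n
    by (metis cis_multiple_2pi Ints_of_int mult.commute)
  then show ?thesis
    unfolding periodic_def by (simp add: ek_add_axis)
qed

lemma fourier_coeff_ek:
  "fourier_coeff f k = (LINT x|Omega. complex_of_real (f x) * cnj (ek k x))"
  unfolding fourier_coeff_def ek_def by (simp add: cis_cnj)

section \<open>Integration over the unit cube and orthonormality of the modes\<close>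

lemma integrable_Omega_continuous:
  fixes f :: "real^3 \<Rightarrow> 'b::euclidean_space"
  shows "continuous_on UNIV f \<Longrightarrow> integrable Omega f"
  by (rule continuous_imp_integrable) (rule continuous_on_subset, auto)

lemma emeasure_Omega: "emeasure Omega (space Omega) = 1"
proof -
  have "emeasure lborel (cbox 0 1 :: (real^3) set) = ennreal (measure lborel (cbox 0 1 :: (real^3) set))"
    using emeasure_lborel_cbox_finite[of "0::real^3" 1] by (intro emeasure_eq_ennreal_measure) simp
  then show ?thesis
    by (simp add: emeasure_restrict_space space_restrict_space content_cbox_if_cart interval_ne_empty_cart)
qed

lemma finite_measure_Omega: "finite_measure Omega"
  by (rule finite_measureI) (simp only: emeasure_Omega, simp)

text \<open>Passage to the gauge integral, where boxes can be cut along a hyperplane and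
  translated.\<close>

lemma integral_Omega:
  fixes f :: "real^3 \<Rightarrow> 'b::euclidean_space"
  shows "integrable Omega f \<Longrightarrow> (LINT x|Omega. f x) = integral (cbox 0 1) f"
  by (rule lebesgue_integral_eq_integral) auto

text \<open>The cube lengthened by \<open>t\<close> along one axis is cut twice: at height
  \<open>t\<close> it is a slab plus the translated cube, at height 1 it is the original cube plus a
  slab. The two slabs differ by a period, so the two cubes have the same integral.\<close>

lemma integral_Omega_shift_unit:
  fixes f :: "real^3 \<Rightarrow> 'b::euclidean_space"
  assumes cont: "continuous_on UNIV f" and per: "periodic f" and t: "0 \<le> t" "t \<le> 1"
  shows "(LINT x|Omega. f (x + axis j t)) = (LINT x|Omega. f x)"
proof -
  have int: "f integrable_on cbox a b" for a b
    by (rule integrable_continuous) (rule continuous_on_subset[OF cont], auto)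
  have contt: "continuous_on UNIV (\<lambda>x. f (x + axis j t))"
    by (rule continuous_on_compose2[OF cont]) (auto intro: continuous_intros)
  define Q where "Q = cbox 0 (1 + axis j t :: real^3)"
  define P where "P = cbox 0 (\<chi> i. if i = j then t else 1)"
  have ax: "axis j (1::real) \<in> Basis"
    by simp
  have in_ax: "x \<bullet> axis j 1 = x $ j" for x :: "real^3"
    by (simp add: inner_axis)
  have box: "x \<in> cbox a b \<longleftrightarrow> a $ j \<le> x $ j \<and> x $ j \<le> b $ j \<and> (\<forall>i. i \<noteq> j \<longrightarrow> a $ i \<le> x $ i \<and> x $ i \<le> b $ i)"
    for x a b :: "real^3"
    by (metis mem_box_cart(2))
  have ax0: "axis j s $ i = 0" if "i \<noteq> j" for i s
    using that by (simp add: axis_def)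
  have 1: "Q \<inter> {x. x \<bullet> axis j 1 \<le> t} = P"
    using t by (auto simp: set_eq_iff Q_def P_def in_ax box ax0)
  have 2: "Q \<inter> {x. x \<bullet> axis j 1 \<ge> t} = cbox (axis j t) (1 + axis j t)"
    using t by (auto simp: set_eq_iff Q_def in_ax box ax0)
  have 3: "Q \<inter> {x. x \<bullet> axis j 1 \<le> 1} = cbox 0 1"
    using t by (auto simp: set_eq_iff Q_def in_ax box ax0)
  have 4: "Q \<inter> {x. x \<bullet> axis j 1 \<ge> 1} = cbox (axis j 1) (1 + axis j t)"
    using t by (auto simp: set_eq_iff Q_def in_ax box ax0)
  have shift: "integral (cbox (a - c) (b - c)) (\<lambda>x. f (x + c)) = integral (cbox a b) f" for a b c
    by (rule integral_shift_cbox)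
  have "integral (cbox (axis j 1) (1 + axis j t)) f = integral P f"
  proof -
    have "(1 + axis j t - axis j 1 :: real^3) = (\<chi> i. if i = j then t else 1)"
      by (auto simp: vec_eq_iff axis_def)
    then show ?thesis
      using shift[of "axis j 1" "axis j 1" "1 + axis j t"] per
      by (simp add: P_def periodic_def)
  qed
  moreover have "integral Q f = integral P f + integral (cbox (axis j t) (1 + axis j t)) f"
    using integral_split[OF int ax, of 0 "1 + axis j t" t] 1 2 by (simp add: Q_def)
  moreover have "integral Q f = integral (cbox 0 1) f + integral (cbox (axis j 1) (1 + axis j t)) f"
    using integral_split[OF int ax, of 0 "1 + axis j t" 1] 3 4 by (simp add: Q_def)
  moreover have "integral (cbox (axis j t) (1 + axis j t)) f = integral (cbox 0 1) (\<lambda>x. f (x + axis j t))"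
    using shift[of "axis j t" "axis j t" "1 + axis j t"] by simp
  ultimately have "integral (cbox 0 1) (\<lambda>x. f (x + axis j t)) = integral (cbox 0 1) f"
    by simp
  then show ?thesis
    by (simp add: integral_Omega integrable_Omega_continuous cont contt)
qed

text \<open>A translation by half a wavelength changes the sign of a nonconstant mode but not its
  integral.\<close>

lemma integral_ek: "(LINT x|Omega. ek k x) = (if k = 0 then 1 else 0)"
proof (cases "k = 0")
  case True
  have "measure Omega (space Omega) = 1"
    using emeasure_Omega by (simp only: measure_def) simp
  then show ?thesis
    using True by simp
next
  case False
  then obtain j where j: "k $ j \<noteq> 0"
    by (auto simp: vec_eq_iff)
  \<comment> \<open>Half a wavelength in direction \<open>j\<close>. Since \<open>k $ j\<close> is a
    nonzero integer, this is at most 1, as the translation lemma requires.\<close>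
  define t where "t = 1 / (2 * \<bar>real_of_int (k $ j)\<bar>)"
  have k1: "\<bar>real_of_int (k $ j)\<bar> \<ge> 1"
    using j by linarith
  have t: "0 \<le> t" "t \<le> 1"
    using k1 by (auto simp: t_def field_simps)
  have arg: "2 * pi * real_of_int (k $ j) * t = (if k $ j > 0 then pi else - pi)"
    using j by (auto simp: t_def field_simps)
  have "cis (2 * pi * real_of_int (k $ j) * t) = -1"
    unfolding arg by (auto simp: cis.ctr complex_eq_iff)
  then have "(LINT x|Omega. - ek k x) = (LINT x|Omega. ek k x)"
    using integral_Omega_shift_unit[OF continuous_on_ek periodic_ek t, of k j]
    by (simp add: ek_add_axis)
  then show ?thesis
    using False by simp
qed

lemma integral_ek_cnj: "(LINT x|Omega. ek k x * cnj (ek l x)) = (if k = l then 1 else 0)"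
  using integral_ek[of "k - l"] by (simp add: ek_diff)

section \<open>Uniqueness of Fourier coefficients\<close>

text \<open>Sums of monomials alone generate the class, so a statement linear in the function, such
  as orthogonality to \<open>h\<close>, only has to be checked on modes. Closure under products is
  derived from \<open>ek_add\<close>.\<close>

inductive trig_poly :: "(real^3 \<Rightarrow> complex) \<Rightarrow> bool" where
  monomial: "trig_poly (\<lambda>x. c * ek k x)"
| add: "trig_poly f \<Longrightarrow> trig_poly g \<Longrightarrow> trig_poly (\<lambda>x. f x + g x)"

lemma trig_poly_const: "trig_poly (\<lambda>x. c)"
  using trig_poly.monomial[of c 0] by simp

lemma trig_poly_mult: "trig_poly f \<Longrightarrow> trig_poly g \<Longrightarrow> trig_poly (\<lambda>x. f x * g x)"
proof (induction f rule: trig_poly.induct)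
  case (monomial c k)
  then show ?case
  proof (induction g rule: trig_poly.induct)
    case (monomial c' k')
    show ?case
      using trig_poly.monomial[of "c * c'" "k + k'"] by (simp add: ek_add mult_ac)
  next
    case (add f g)
    then show ?case
      using trig_poly.add[of "\<lambda>x. c * ek k x * f x" "\<lambda>x. c * ek k x * g x"] by (simp add: ring_distribs)
  qed
next
  case (add f f')
  then show ?case
    using trig_poly.add[of "\<lambda>x. f x * g x" "\<lambda>x. f' x * g x"] by (simp add: ring_distribs)
qed

lemma trig_poly_sum:
  "finite F \<Longrightarrow> (\<And>i. i \<in> F \<Longrightarrow> trig_poly (f i)) \<Longrightarrow> trig_poly (\<lambda>x. \<Sum>i\<in>F. f i x)"
  by (induction F rule: finite_induct) (auto intro: trig_poly_const trig_poly.add)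

text \<open>The torus as a compact subset of a Euclidean space. Polynomials of the ambient space
  restrict to trigonometric polynomials, which makes the polynomial form of Stone-Weierstrass
  applicable.\<close>

definition torus_embed :: "real^3 \<Rightarrow> complex^3" where
  "torus_embed x = (\<chi> j. cis (2 * pi * x $ j))"

lemma cis_eq_ek: "cis (2 * pi * x $ j) = ek (axis j 1) x"
proof -
  have "(\<Sum>i\<in>UNIV. real_of_int (axis j 1 $ i) * x $ i) = x $ j"
    by (simp add: axis_def if_distrib if_distribR cong: if_cong)
  then show ?thesis
    by (simp add: ek_def)
qed

text \<open>A real-linear functional sees real and imaginary parts separately, that is, cosines and
  sines of each coordinate; both are combinations of a mode and its conjugate.\<close>

lemma trig_poly_linear:
  assumes L: "bounded_linear (L :: complex^3 \<Rightarrow> real)"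
  shows "trig_poly (\<lambda>x. complex_of_real (L (torus_embed x)))"
proof -
  interpret bounded_linear L by fact
  let ?a = "\<lambda>j. complex_of_real (L (axis j 1))" and ?b = "\<lambda>j. complex_of_real (L (axis j \<i>))"
  let ?e = "\<lambda>j. ek (axis j 1)" and ?e' = "\<lambda>j. ek (- axis j 1)"
  have eq: "complex_of_real (L (torus_embed x)) =
    (\<Sum>j\<in>UNIV. ((?a j - \<i> * ?b j) / 2 * ?e j x + (?a j + \<i> * ?b j) / 2 * ?e' j x))" for x
  proof -
    have "torus_embed x = (\<Sum>j\<in>UNIV. cos (2 * pi * x $ j) *\<^sub>R axis j 1 + sin (2 * pi * x $ j) *\<^sub>R axis j \<i>)"
      by (simp add: vec_eq_iff torus_embed_def axis_def if_distrib if_distribR complex_eq_iff cong: if_cong)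
    then have "L (torus_embed x) = (\<Sum>j\<in>UNIV. cos (2 * pi * x $ j) * L (axis j 1) + sin (2 * pi * x $ j) * L (axis j \<i>))"
      by (simp add: sum add scaleR)
    moreover have "complex_of_real (cos (2 * pi * x $ j) * L (axis j 1) + sin (2 * pi * x $ j) * L (axis j \<i>))
      = (?a j - \<i> * ?b j) / 2 * ?e j x + (?a j + \<i> * ?b j) / 2 * ?e' j x" for j
      by (simp add: ek_uminus cis_eq_ek[symmetric] complex_eq_iff field_simps)
    ultimately show ?thesis
      by simp
  qed
  show ?thesis
    unfolding eq by (intro trig_poly_sum trig_poly.add trig_poly.monomial) auto
qed

lemma trig_poly_polynomial:
  "real_polynomial_function p \<Longrightarrow> trig_poly (\<lambda>x. complex_of_real (p (torus_embed x)))"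
proof (induction p rule: real_polynomial_function.induct)
  case (linear f)
  then show ?case by (rule trig_poly_linear)
next
  case (const c)
  then show ?case by (rule trig_poly_const)
next
  case (add f g)
  then show ?case using trig_poly.add by fastforce
next
  case (mult f g)
  then show ?case using trig_poly_mult by fastforce
qed

section \<open>Functions orthogonal to all modes integrate to zero over open sets\<close>

lemma measurable_Omega_continuous:
  fixes f :: "real^3 \<Rightarrow> 'b::euclidean_space"
  shows "continuous_on UNIV f \<Longrightarrow> f \<in> borel_measurable Omega"
  using integrable_Omega_continuous by (rule borel_measurable_integrable)

lemma measurable_Omega_indicator:
  assumes "A \<in> sets lebesgue"
  shows "(\<lambda>x. complex_of_real (indicator A x)) \<in> borel_measurable Omega"
proof -
  have "indicat_real A \<in> borel_measurable Omega"
    by (intro measurable_restrict_space1 borel_measurable_indicator assms)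
  then show ?thesis
    by measurable
qed

lemma integrable_mult_bounded:
  fixes h g :: "'a \<Rightarrow> 'b::{real_normed_algebra,second_countable_topology,banach}"
  assumes "integrable M h" "g \<in> borel_measurable M" "\<And>x. norm (g x) \<le> B"
  shows "integrable M (\<lambda>x. h x * g x)"
proof (rule Bochner_Integration.integrable_bound[of M "\<lambda>x. B * norm (h x)"])
  show "AE x in M. norm (h x * g x) \<le> norm (B * norm (h x))"
  proof (rule AE_I2)
    fix x
    have "norm (h x * g x) \<le> norm (h x) * norm (g x)"
      by (rule norm_mult_ineq)
    also have "\<dots> \<le> norm (h x) * B"
      by (intro mult_left_mono assms) auto
    finally show "norm (h x * g x) \<le> norm (B * norm (h x))"
      by (simp add: mult.commute)
  qed
qed (use assms in auto)

lemma trig_poly_continuous: "trig_poly f \<Longrightarrow> continuous_on UNIV f"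
  by (induction rule: trig_poly.induct) (intro continuous_intros; assumption?)+

lemma trig_poly_bounded: "trig_poly f \<Longrightarrow> \<exists>B. \<forall>x. cmod (f x) \<le> B"
proof (induction rule: trig_poly.induct)
  case (monomial c k)
  then show ?case by (auto simp: norm_mult)
next
  case (add f g)
  then obtain B B' where "\<forall>x. cmod (f x) \<le> B" "\<forall>x. cmod (g x) \<le> B'"
    by blast
  then have "\<forall>x. cmod (f x + g x) \<le> B + B'"
    by (meson norm_triangle_mono)
  then show ?case by blast
qed

lemma integrable_mult_trig_poly:
  "integrable Omega h \<Longrightarrow> trig_poly f \<Longrightarrow> integrable Omega (\<lambda>x. h x * f x)"
  using trig_poly_bounded[of f]
  by (metis integrable_mult_bounded measurable_Omega_continuous trig_poly_continuous)

lemma integral_mult_trig_poly: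
  assumes h: "integrable Omega h" and z: "\<And>k. (LINT x|Omega. h x * cnj (ek k x)) = 0"
  shows "trig_poly f \<Longrightarrow> (LINT x|Omega. h x * f x) = 0"
proof (induction rule: trig_poly.induct)
  case (monomial c k)
  have "(LINT x|Omega. c * (h x * cnj (ek (- k) x))) = 0"
    using z[of "- k"] by simp
  then show ?case
    by (simp add: ek_uminus mult_ac)
next
  case (add f g)
  then show ?case
    using h by (simp add: ring_distribs integrable_mult_trig_poly)
qed

lemma continuous_torus_embed: "continuous_on S torus_embed"
  unfolding torus_embed_def by (intro continuous_intros)

text \<open>Opposite faces of the cube have the same image, so one of the two points has to be
  interior: the coordinates then differ by integers strictly between -1 and 1.\<close>

lemma torus_embed_eq:
  assumes "torus_embed x = torus_embed y" "x \<in> box 0 1" "y \<in> cbox 0 1"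
  shows "x = y"
proof -
  have "x $ j = y $ j" for j
  proof -
    have "cis (2 * pi * x $ j) = cis (2 * pi * y $ j)"
      using assms(1) by (simp add: torus_embed_def vec_eq_iff)
    then have "sin (2 * pi * x $ j) = sin (2 * pi * y $ j) \<and> cos (2 * pi * x $ j) = cos (2 * pi * y $ j)"
      by (simp add: complex_eq_iff)
    then obtain n where "2 * pi * x $ j = 2 * pi * y $ j + 2 * pi * real_of_int n"
      by (auto simp: sin_cos_eq_iff)
    then have "2 * pi * (x $ j) = 2 * pi * (y $ j + real_of_int n)"
      by (simp add: ring_distribs)
    then have n: "x $ j = y $ j + real_of_int n"
      by simp
    moreover have "0 < x $ j" "x $ j < 1" "0 \<le> y $ j" "y $ j \<le> 1"
      using assms(2,3) by (auto simp: mem_box_cart)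
    ultimately have "real_of_int n > -1" "real_of_int n < 1"
      by linarith+
    then have "n = 0"
      by linarith
    then show ?thesis
      using n by simp
  qed
  then show ?thesis
    by (simp add: vec_eq_iff)
qed

text \<open>The indicator of an open set inside the cube is the pointwise limit of continuous functions of
  \<open>torus_embed\<close>, to which Stone-Weierstrass applies.\<close>

lemma integral_open_eq_0:
  assumes h: "integrable Omega h" and z: "\<And>k. (LINT x|Omega. h x * cnj (ek k x)) = 0"
    and U: "open U" "U \<subseteq> box 0 1"
  shows "(LINT x|Omega. h x * complex_of_real (indicator U x)) = 0"
proof -
  \<comment> \<open>Working with the image of the complement makes the distance to \<open>C\<close>
    a continuous function on the torus that vanishes exactly off \<open>U\<close>.\<close>
  define C where "C = torus_embed ` (cbox 0 1 - U)"
  have C: "compact C" "closed C" "C \<noteq> {}"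
  proof -
    show "compact C"
      unfolding C_def using U
      by (intro compact_continuous_image continuous_torus_embed compact_diff) auto
    then show "closed C"
      by (rule compact_imp_closed)
    have "0 \<in> cbox 0 (1::real^3)" "0 \<notin> box 0 (1::real^3)"
      by (auto simp: mem_box_cart)
    then show "C \<noteq> {}"
      using U by (auto simp: C_def)
  qed
  have inC: "torus_embed x \<in> C \<longleftrightarrow> x \<notin> U" if "x \<in> cbox 0 1" for x
    using that U torus_embed_eq[of x] by (auto simp: C_def)
  define S where "S = torus_embed ` cbox 0 1"
  have S: "compact S"
    unfolding S_def by (intro compact_continuous_image continuous_torus_embed) auto
  \<comment> \<open>Truncated multiples of the distance: values in [0,1], equal to 0 on
    \<open>C\<close>, and eventually equal to 1 at each point outside \<open>C\<close>.\<close>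
  define f where "f n z = min 1 (real n * infdist z C)" for n z
  have contf: "continuous_on A (f n)" for A n
    unfolding f_def by (intro continuous_intros)
  have f01: "0 \<le> f n z" "f n z \<le> 1" for n z
    by (auto simp: f_def infdist_nonneg)
  have lim: "(\<lambda>n. f n (torus_embed x)) \<longlonglongrightarrow> indicator U x" if "x \<in> cbox 0 1" for x
  proof (cases "x \<in> U")
    case True
    then have "torus_embed x \<notin> C"
      using inC that by simp
    then have pos: "infdist (torus_embed x) C > 0"
      using C infdist_pos_not_in_closed by blast
    obtain N where N: "1 / infdist (torus_embed x) C \<le> real N"
      using real_arch_simple by blast
    have "f n (torus_embed x) = 1" if "n \<ge> N" for n
    proof -
      have "1 \<le> real N * infdist (torus_embed x) C"
        using N pos by (simp add: field_simps)
      also have "\<dots> \<le> real n * infdist (torus_embed x) C"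
        using that pos by (intro mult_right_mono) auto
      finally show ?thesis by (simp add: f_def)
    qed
    then show ?thesis
      using True by (intro tendsto_eventually) (auto simp: eventually_sequentially)
  next
    case False
    then have "infdist (torus_embed x) C = 0"
      using inC[OF that] by (simp add: infdist_zero)
    then show ?thesis
      using False by (simp add: f_def)
  qed
  have zero: "(LINT x|Omega. h x * complex_of_real (f n (torus_embed x))) = 0" for n
  proof -
    let ?g = "\<lambda>x. complex_of_real (f n (torus_embed x))"
    have cg: "continuous_on UNIV ?g"
      by (intro continuous_intros continuous_on_compose2[OF contf[of UNIV]] continuous_torus_embed) auto
    have ig: "integrable Omega (\<lambda>x. h x * ?g x)"
      by (rule integrable_mult_bounded[OF h measurable_Omega_continuous[OF cg], where B = 1])
        (use f01 in auto)
    \<comment> \<open>A polynomial uniformly \<open>e\<close>-close to \<open>f n\<close> integrates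
      to zero against \<open>h\<close>, so the integral of \<open>h * ?g\<close> is bounded by
      \<open>e\<close> times the norm of \<open>h\<close>.\<close>
    have "cmod (LINT x|Omega. h x * ?g x) \<le> e * (LINT x|Omega. cmod (h x))" if e: "e > 0" for e
    proof -
      obtain p where p: "real_polynomial_function p" "\<And>z. z \<in> S \<Longrightarrow> \<bar>f n z - p z\<bar> < e"
        using Stone_Weierstrass_real_polynomial_function[OF S contf e] by metis
      let ?p = "\<lambda>x. complex_of_real (p (torus_embed x))"
      have tp: "trig_poly ?p"
        by (rule trig_poly_polynomial) fact
      have "(LINT x|Omega. h x * ?g x) = (LINT x|Omega. h x * ?g x) - (LINT x|Omega. h x * ?p x)"
        using integral_mult_trig_poly[OF h z tp] by simp
      also have "\<dots> = (LINT x|Omega. h x * ?g x - h x * ?p x)"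
        by (rule Bochner_Integration.integral_diff[symmetric]) (intro ig integrable_mult_trig_poly h tp)+
      finally have "cmod (LINT x|Omega. h x * ?g x) = cmod (LINT x|Omega. h x * ?g x - h x * ?p x)"
        by simp
      also have "\<dots> \<le> (LINT x|Omega. cmod (h x * ?g x - h x * ?p x))"
        by (rule integral_norm_bound)
      also have "\<dots> \<le> (LINT x|Omega. e * cmod (h x))"
      proof (rule integral_mono)
        show "integrable Omega (\<lambda>x. cmod (h x * ?g x - h x * ?p x))"
          by (intro Bochner_Integration.integrable_norm Bochner_Integration.integrable_diff ig integrable_mult_trig_poly h tp)
        show "integrable Omega (\<lambda>x. e * cmod (h x))"
          using h by simp
        fix x assume "x \<in> space Omega"
        then have "torus_embed x \<in> S"
          by (simp add: S_def space_restrict_space)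
        then have "\<bar>f n (torus_embed x) - p (torus_embed x)\<bar> \<le> e"
          using p(2) by fastforce
        then have "cmod (h x) * \<bar>f n (torus_embed x) - p (torus_embed x)\<bar> \<le> cmod (h x) * e"
          by (intro mult_left_mono) auto
        then show "cmod (h x * ?g x - h x * ?p x) \<le> e * cmod (h x)"
          by (simp add: right_diff_distrib[symmetric] norm_mult mult.commute of_real_diff[symmetric] del: of_real_diff)
      qed
      finally show ?thesis by simp
    qed
    note bound = this
    have "cmod (LINT x|Omega. h x * ?g x) \<le> 0 + e" if e: "e > 0" for e
    proof -
      let ?I = "LINT x|Omega. cmod (h x)"
      have I: "?I \<ge> 0" by simp
      \<comment> \<open>Rescaling of the tolerance by the norm of \<open>h\<close>; the added 1
        covers the case \<open>?I = 0\<close>.\<close>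
      have "e / (?I + 1) > 0"
        using e I by (simp add: add_nonneg_pos)
      from bound[OF this] have "cmod (LINT x|Omega. h x * ?g x) \<le> e / (?I + 1) * ?I" .
      also have "\<dots> = e * (?I / (?I + 1))"
        by simp
      also have "\<dots> \<le> e * 1"
        using e I by (intro mult_left_mono) (auto simp: divide_le_eq_1 add_nonneg_pos)
      finally show ?thesis by simp
    qed
    then have "cmod (LINT x|Omega. h x * ?g x) \<le> 0"
      by (rule field_le_epsilon)
    then show ?thesis by simp
  qed
  have "(\<lambda>n. LINT x|Omega. h x * complex_of_real (f n (torus_embed x))) \<longlonglongrightarrow>
    (LINT x|Omega. h x * complex_of_real (indicator U x))"
  proof (rule integral_dominated_convergence[where w = "\<lambda>x. cmod (h x)"])
    show "AE x in Omega. (\<lambda>n. h x * complex_of_real (f n (torus_embed x))) \<longlonglongrightarrow> h x * complex_of_real (indicator U x)"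
      by (rule AE_I2) (auto intro!: tendsto_intros lim simp: space_restrict_space)
    show "AE x in Omega. cmod (h x * complex_of_real (f n (torus_embed x))) \<le> cmod (h x)" for n
      by (rule AE_I2) (use f01 in \<open>auto simp: norm_mult intro!: mult_left_le\<close>)
    show "integrable Omega (\<lambda>x. cmod (h x))"
      using h by simp
    have "h \<in> borel_measurable Omega"
      using h by auto
    moreover have "(\<lambda>x. complex_of_real (f n (torus_embed x))) \<in> borel_measurable Omega" for n
      by (intro measurable_Omega_continuous continuous_intros continuous_on_compose2[OF contf[of UNIV]] continuous_torus_embed) auto
    ultimately show "(\<lambda>x. h x * complex_of_real (f n (torus_embed x))) \<in> borel_measurable Omega" for n
      by measurable
    have "(\<lambda>x. complex_of_real (indicator U x)) \<in> borel_measurable Omega"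
      using U(1) by (intro measurable_Omega_indicator) auto
    with \<open>h \<in> borel_measurable Omega\<close> show "(\<lambda>x. h x * complex_of_real (indicator U x)) \<in> borel_measurable Omega"
      by measurable
  qed
  then show ?thesis
    unfolding zero by (simp add: LIMSEQ_const_iff)
qed

section \<open>From open sets in the cube to all measurable sets\<close>

lemma AE_Omega_box: "AE x in Omega. x \<in> box 0 1"
proof -
  have "negligible (cbox 0 1 - box 0 (1::real^3))"
    by (rule negligible_frontier_interval)
  then have "AE x in lebesgue. x \<notin> cbox 0 1 - box 0 (1::real^3)"
    by (intro AE_not_in) (simp add: negligible_iff_null_sets)
  then show ?thesis
    by (subst AE_restrict_space_iff) (auto elim!: eventually_mono)
qed

lemma integrable_mult_indicator_lebesgue:
  fixes h :: "real^3 \<Rightarrow> real"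
  assumes "integrable Omega h" "A \<in> sets lebesgue"
  shows "integrable Omega (\<lambda>x. indicator A x * h x)"
proof -
  have "A \<inter> cbox 0 1 \<in> sets Omega"
    using assms by (auto simp: sets_restrict_space)
  from integrable_mult_indicator[OF this assms(1)]
  have "integrable Omega (\<lambda>x. indicator (A \<inter> cbox 0 1) x * h x)" by simp
  moreover have "integrable Omega (\<lambda>x. indicator (A \<inter> cbox 0 1) x * h x)
    \<longleftrightarrow> integrable Omega (\<lambda>x. indicator A x * h x)"
    by (intro Bochner_Integration.integrable_cong) (auto simp: space_restrict_space indicator_def)
  ultimately show ?thesis by simp
qed

text \<open>The boundary of the cube is null, so every open set reduces to an open set inside the
  cube. Open sets are stable under intersection and generate the Borel sets, which gives all Borel
  sets by induction on disjoint unions and complements; finally a function is determined by its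
  integrals over measurable sets.\<close>

lemma AE_zero_of_open:
  fixes h :: "real^3 \<Rightarrow> real"
  assumes h: "integrable Omega h"
    and z: "\<And>U. open U \<Longrightarrow> U \<subseteq> box 0 1 \<Longrightarrow> (LINT x|Omega. indicator U x * h x) = 0"
  shows "AE x in Omega. h x = 0"
proof -
  note int = integrable_mult_indicator_lebesgue[OF h]
  have bl: "A \<in> sets lebesgue" if "A \<in> sets borel" for A :: "(real^3) set"
    using that by simp
  have opn: "(LINT x|Omega. indicator U x * h x) = 0" if U: "open U" for U
  proof -
    have "(LINT x|Omega. indicator U x * h x) = (LINT x|Omega. indicator (U \<inter> box 0 1) x * h x)"
    proof (rule integral_cong_AE)
      show "AE x in Omega. indicator U x * h x = indicator (U \<inter> box 0 1) x * h x"
        using AE_Omega_box by eventually_elim (simp add: indicator_def)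
    qed (use U in \<open>auto intro!: borel_measurable_integrable int lborelD\<close>)
    also have "\<dots> = 0"
      using U by (intro z) auto
    finally show ?thesis .
  qed
  have borel: "(LINT x|Omega. indicator A x * h x) = 0" if A: "A \<in> sets borel" for A
  proof -
    have st: "sigma_sets UNIV {S. open S} = sets (borel :: (real^3) measure)"
      by (simp add: borel_def sets_measure_of)
    have "Int_stable {S::(real^3) set. open S}"
      by (auto simp: Int_stable_def)
    moreover have "{S::(real^3) set. open S} \<subseteq> Pow UNIV"
      by auto
    moreover have "A \<in> sigma_sets UNIV {S. open S}"
      using A st by simp
    ultimately show ?thesis
    proof (induction rule: sigma_sets_induct_disjoint)
      case (basic A)
      then show ?case by (simp add: opn)
    next
      case empty
      then show ?case by simp
    next
      case (compl A)
      then have A: "A \<in> sets borel" using st by simp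
      have "(LINT x|Omega. indicator (UNIV - A) x * h x) = (LINT x|Omega. indicator UNIV x * h x - indicator A x * h x)"
        by (intro Bochner_Integration.integral_cong) (auto simp: indicator_def)
      also have "\<dots> = (LINT x|Omega. indicator UNIV x * h x) - (LINT x|Omega. indicator A x * h x)"
        by (intro Bochner_Integration.integral_diff int bl A) auto
      also have "\<dots> = 0"
        using compl opn[of UNIV] by simp
      finally show ?case .
    next
      case (union A)
      then have A: "A i \<in> sets borel" for i using st by auto
      have "(\<lambda>n. LINT x|Omega. (\<Sum>i<n. indicator (A i) x * h x)) \<longlonglongrightarrow> (LINT x|Omega. indicator (\<Union>i. A i) x * h x)"
      proof (rule integral_dominated_convergence[where w = "\<lambda>x. \<bar>h x\<bar>"])
        have sums: "(\<lambda>i. indicat_real (A i) x * h x) sums (indicat_real (\<Union>i. A i) x * h x)" for x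
          by (intro sums_mult2 indicator_sums) (use union in \<open>auto simp: disjoint_family_on_def\<close>)
        show "AE x in Omega. (\<lambda>n. \<Sum>i<n. indicator (A i) x * h x) \<longlonglongrightarrow> indicator (\<Union>i. A i) x * h x"
          using sums by (intro AE_I2) (simp add: sums_def)
        have le1: "(\<Sum>i<n. indicat_real (A i) x) \<le> 1" for n x
        proof -
          have "(\<Sum>i<n. indicat_real (A i) x) = indicator (\<Union>i<n. A i) x"
            by (rule indicator_UN_disjoint[symmetric]) (use union(1) in \<open>auto simp: disjoint_family_on_def\<close>)
          then show ?thesis by (simp add: indicator_def)
        qed
        show "AE x in Omega. norm (\<Sum>i<n. indicator (A i) x * h x) \<le> \<bar>h x\<bar>" for n
        proof (rule AE_I2)
          fix x
          have "norm (\<Sum>i<n. indicator (A i) x * h x) = (\<Sum>i<n. indicat_real (A i) x) * \<bar>h x\<bar>"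
            by (simp add: sum_distrib_right[symmetric] abs_mult sum_nonneg abs_of_nonneg)
          also have "\<dots> \<le> 1 * \<bar>h x\<bar>"
            by (intro mult_right_mono le1) auto
          finally show "norm (\<Sum>i<n. indicator (A i) x * h x) \<le> \<bar>h x\<bar>" by simp
        qed
        show "integrable Omega (\<lambda>x. \<bar>h x\<bar>)" using h by simp
        show "(\<lambda>x. indicator (\<Union>i. A i) x * h x) \<in> borel_measurable Omega"
          by (intro borel_measurable_integrable int bl sets.countable_UN) (use A in auto)
        show "(\<lambda>x. \<Sum>i<n. indicator (A i) x * h x) \<in> borel_measurable Omega" for n
          by (intro borel_measurable_integrable Bochner_Integration.integrable_sum int bl A)
      qed
      moreover have "(LINT x|Omega. (\<Sum>i<n. indicator (A i) x * h x)) = 0" for n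
      proof -
        have "(LINT x|Omega. (\<Sum>i<n. indicator (A i) x * h x)) = (\<Sum>i<n. LINT x|Omega. indicator (A i) x * h x)"
          by (intro Bochner_Integration.integral_sum int bl A)
        then show ?thesis using union by simp
      qed
      ultimately show ?case by (simp add: LIMSEQ_const_iff)
    qed
  qed
  have "(\<integral>x \<in> A. h x \<partial>Omega) = (\<integral>x \<in> A. 0 \<partial>Omega)" if "A \<in> sets Omega" for A
  proof -
    have "A \<in> sets lebesgue"
      using that by (auto simp: sets_restrict_space)
    \<comment> \<open>\<open>Omega\<close> carries the completed measure: a measurable set is an
      F-sigma set, hence Borel, up to a null set.\<close>
    then obtain C N where CN: "fsigma C" "N \<in> null_sets lebesgue" "C \<union> N = A" "disjnt C N"
      by (rule lebesgue_set_almost_fsigma)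
    have "AE x in Omega. x \<notin> N"
      using AE_not_in[OF CN(2)] by (subst AE_restrict_space_iff) (auto elim!: eventually_mono)
    then have ae: "AE x in Omega. indicator A x * h x = indicator C x * h x"
      by eventually_elim (use CN(3) in \<open>auto simp: indicator_def\<close>)
    have C: "C \<in> sets borel"
      using CN(1) by (cases rule: fsigma.cases) auto
    have "(LINT x|Omega. indicator A x * h x) = (LINT x|Omega. indicator C x * h x)"
      by (intro integral_cong_AE ae borel_measurable_integrable int bl C \<open>A \<in> sets lebesgue\<close>)
    then show ?thesis
      using borel[OF C] by (simp add: set_lebesgue_integral_def)
  qed
  then show ?thesis
    by (intro density_unique_real h) auto
qed

text \<open>Integrability alone is assumed because the result is later applied to a product of two
  square integrable functions before that product is known to be square integrable.\<close>

theorem fourier_uniqueness: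
  fixes h :: "real^3 \<Rightarrow> complex"
  assumes h: "integrable Omega h" and z: "\<And>k. (LINT x|Omega. h x * cnj (ek k x)) = 0"
  shows "AE x in Omega. h x = 0"
proof -
  have ind: "integrable Omega (\<lambda>x. h x * complex_of_real (indicator U x))"
    "(LINT x|Omega. h x * complex_of_real (indicator U x)) = 0"
    if U: "open U" "U \<subseteq> box 0 1" for U
  proof -
    have "(\<lambda>x. complex_of_real (indicator U x)) \<in> borel_measurable Omega"
      using U(1) by (intro measurable_Omega_indicator) auto
    then show "integrable Omega (\<lambda>x. h x * complex_of_real (indicator U x))"
      by (rule integrable_mult_bounded[OF h, where B = 1]) (simp add: indicator_def)
  qed (rule integral_open_eq_0[OF h z U])
  have "AE x in Omega. Re (h x) = 0"
  proof (rule AE_zero_of_open)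
    fix U :: "(real^3) set" assume U: "open U" "U \<subseteq> box 0 1"
    have "(LINT x|Omega. indicator U x * Re (h x)) = (LINT x|Omega. Re (h x * complex_of_real (indicator U x)))"
      by (simp add: mult.commute)
    also have "\<dots> = Re (LINT x|Omega. h x * complex_of_real (indicator U x))"
      by (rule integral_Re) (rule ind[OF U])
    finally show "(LINT x|Omega. indicator U x * Re (h x)) = 0"
      using ind[OF U] by simp
  qed (use h in auto)
  moreover have "AE x in Omega. Im (h x) = 0"
  proof (rule AE_zero_of_open)
    fix U :: "(real^3) set" assume U: "open U" "U \<subseteq> box 0 1"
    have "(LINT x|Omega. indicator U x * Im (h x)) = (LINT x|Omega. Im (h x * complex_of_real (indicator U x)))"
      by (simp add: mult.commute)
    also have "\<dots> = Im (LINT x|Omega. h x * complex_of_real (indicator U x))"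
      by (rule integral_Im) (rule ind[OF U])
    finally show "(LINT x|Omega. indicator U x * Im (h x)) = 0"
      using ind[OF U] by simp
  qed (use h in auto)
  ultimately show ?thesis
    by eventually_elim (simp add: complex_eq_iff)
qed

section \<open>The theorems of Riesz-Fischer and Parseval\<close>

text \<open>The complex counterpart of \<open>L2\<close> without periodicity, to which integrals
  over the cube are blind; \<open>L2_iff\<close> adds it back.\<close>

definition L2c :: "(real^3 \<Rightarrow> complex) set" where
  "L2c = {f. f \<in> borel_measurable Omega \<and> integrable Omega (\<lambda>x. (cmod (f x))\<^sup>2)}"

definition fc :: "(real^3 \<Rightarrow> complex) \<Rightarrow> int^3 \<Rightarrow> complex" where
  "fc f k = (LINT x|Omega. f x * cnj (ek k x))"

lemma measurable_ek [measurable]: "ek k \<in> borel_measurable Omega"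
  by (intro measurable_Omega_continuous continuous_on_ek)

lemma L2cD: "f \<in> L2c \<Longrightarrow> f \<in> borel_measurable Omega" "f \<in> L2c \<Longrightarrow> integrable Omega (\<lambda>x. (cmod (f x))\<^sup>2)"
  by (auto simp: L2c_def)

lemma integrable_mult_L2c:
  assumes "f \<in> L2c" "g \<in> L2c"
  shows "integrable Omega (\<lambda>x. f x * g x)"
proof (rule Bochner_Integration.integrable_bound[where f = "\<lambda>x. (cmod (f x))\<^sup>2 + (cmod (g x))\<^sup>2"])
  show "integrable Omega (\<lambda>x. (cmod (f x))\<^sup>2 + (cmod (g x))\<^sup>2)"
    using assms by (intro Bochner_Integration.integrable_add L2cD)
  show "(\<lambda>x. f x * g x) \<in> borel_measurable Omega"
    using assms by (intro borel_measurable_times L2cD)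
  have "cmod (f x * g x) \<le> (cmod (f x))\<^sup>2 + (cmod (g x))\<^sup>2" for x
    using sum_squares_bound[of "cmod (f x)" "cmod (g x)"] mult_nonneg_nonneg[OF norm_ge_zero[of "f x"] norm_ge_zero[of "g x"]]
    unfolding norm_mult by linarith
  then show "AE x in Omega. cmod (f x * g x) \<le> norm ((cmod (f x))\<^sup>2 + (cmod (g x))\<^sup>2)"
    by (intro AE_I2) simp
qed

lemma L2c_add: assumes "f \<in> L2c" "g \<in> L2c" shows "(\<lambda>x. f x + g x) \<in> L2c"
proof -
  have "integrable Omega (\<lambda>x. (cmod (f x + g x))\<^sup>2)"
  proof (rule Bochner_Integration.integrable_bound)
    show "integrable Omega (\<lambda>x. 2 * (cmod (f x))\<^sup>2 + 2 * (cmod (g x))\<^sup>2)"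
      using assms by (intro Bochner_Integration.integrable_add integrable_mult_right L2cD)
    show "(\<lambda>x. (cmod (f x + g x))\<^sup>2) \<in> borel_measurable Omega"
      using L2cD(1)[OF assms(1)] L2cD(1)[OF assms(2)] by measurable
    have "(cmod (f x + g x))\<^sup>2 \<le> 2 * (cmod (f x))\<^sup>2 + 2 * (cmod (g x))\<^sup>2" for x
    proof -
      have "(cmod (f x + g x))\<^sup>2 \<le> (cmod (f x) + cmod (g x))\<^sup>2"
        by (intro power_mono norm_triangle_ineq) auto
      also have "\<dots> \<le> 2 * (cmod (f x))\<^sup>2 + 2 * (cmod (g x))\<^sup>2"
        using sum_squares_bound[of "cmod (f x)" "cmod (g x)"] by (simp add: power2_sum)
      finally show ?thesis .
    qed
    then show "AE x in Omega. norm ((cmod (f x + g x))\<^sup>2) \<le> norm (2 * (cmod (f x))\<^sup>2 + 2 * (cmod (g x))\<^sup>2)"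
      by (intro AE_I2) simp
  qed
  then show ?thesis
    using assms by (auto simp: L2c_def)
qed

lemma L2c_cmult: "f \<in> L2c \<Longrightarrow> (\<lambda>x. c * f x) \<in> L2c"
  by (auto simp: L2c_def norm_mult power_mult_distrib)

lemma L2c_diff: "f \<in> L2c \<Longrightarrow> g \<in> L2c \<Longrightarrow> (\<lambda>x. f x - g x) \<in> L2c"
  using L2c_add[of f "\<lambda>x. (-1) * g x"] L2c_cmult[of g "-1"] by simp

lemma L2c_cnj: "f \<in> L2c \<Longrightarrow> (\<lambda>x. cnj (f x)) \<in> L2c"
proof -
  assume "f \<in> L2c"
  moreover from this have "(\<lambda>x. cnj (f x)) \<in> borel_measurable Omega"
    by (intro borel_measurable_continuous_on[OF _ L2cD(1)] continuous_intros)
  ultimately show ?thesis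
    by (simp add: L2c_def)
qed

lemma L2c_ek: "ek k \<in> L2c"
  using finite_measure.integrable_const[OF finite_measure_Omega, of "1::real"]
  by (simp add: L2c_def measurable_ek)

lemma L2c_mult_ek: "f \<in> L2c \<Longrightarrow> (\<lambda>x. f x * ek k x) \<in> L2c"
  using borel_measurable_times[OF _ measurable_ek[of k], of f] by (simp add: L2c_def norm_mult)

lemma L2c_zero: "(\<lambda>x. 0) \<in> L2c"
  by (simp add: L2c_def)

lemma L2c_sum: "finite F \<Longrightarrow> (\<And>i. i \<in> F \<Longrightarrow> f i \<in> L2c) \<Longrightarrow> (\<lambda>x. \<Sum>i\<in>F. f i x) \<in> L2c"
  by (induction F rule: finite_induct) (auto intro: L2c_add L2c_zero)

lemma L2c_trig_sum: "finite F \<Longrightarrow> (\<lambda>x. \<Sum>k\<in>F. a k * ek k x) \<in> L2c"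
  by (intro L2c_sum L2c_cmult L2c_ek)

lemma L2c_integrable: "f \<in> L2c \<Longrightarrow> integrable Omega f"
  using integrable_mult_L2c[OF _ L2c_ek[of 0], of f] by simp

lemma integrable_fc: "f \<in> L2c \<Longrightarrow> integrable Omega (\<lambda>x. f x * cnj (ek k x))"
  by (intro integrable_mult_L2c L2c_cnj L2c_ek)

lemma fc_add: "f \<in> L2c \<Longrightarrow> g \<in> L2c \<Longrightarrow> fc (\<lambda>x. f x + g x) k = fc f k + fc g k"
  by (simp add: fc_def ring_distribs integrable_fc)

lemma fc_diff: "f \<in> L2c \<Longrightarrow> g \<in> L2c \<Longrightarrow> fc (\<lambda>x. f x - g x) k = fc f k - fc g k"
  by (simp add: fc_def ring_distribs integrable_fc)

lemma fc_cmult: "fc (\<lambda>x. c * f x) k = c * fc f k"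
  by (simp add: fc_def mult.assoc)

lemma integral_trig_sum_cnj:
  assumes f: "f \<in> L2c" and F: "finite F"
  shows "(LINT x|Omega. f x * cnj (\<Sum>k\<in>F. a k * ek k x)) = (\<Sum>k\<in>F. fc f k * cnj (a k))"
proof -
  have "(LINT x|Omega. f x * cnj (\<Sum>k\<in>F. a k * ek k x)) = (LINT x|Omega. (\<Sum>k\<in>F. cnj (a k) * (f x * cnj (ek k x))))"
    by (simp add: cnj_sum sum_distrib_left mult_ac)
  also have "\<dots> = (\<Sum>k\<in>F. LINT x|Omega. cnj (a k) * (f x * cnj (ek k x)))"
    by (intro Bochner_Integration.integral_sum integrable_mult_right integrable_fc f)
  finally show ?thesis
    by (simp add: fc_def mult.commute)
qed

lemma fc_trig_sum:
  assumes "finite F"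
  shows "fc (\<lambda>x. \<Sum>k\<in>F. a k * ek k x) l = (if l \<in> F then a l else 0)"
proof -
  have "fc (\<lambda>x. \<Sum>k\<in>F. a k * ek k x) l = (LINT x|Omega. (\<Sum>k\<in>F. a k * (ek k x * cnj (ek l x))))"
    by (simp add: fc_def sum_distrib_right mult.assoc)
  also have "\<dots> = (\<Sum>k\<in>F. LINT x|Omega. a k * (ek k x * cnj (ek l x)))"
    by (intro Bochner_Integration.integral_sum integrable_mult_right integrable_fc L2c_ek)
  also have "\<dots> = (\<Sum>k\<in>F. if k = l then a l else 0)"
    by (intro sum.cong) (auto simp: integral_ek_cnj)
  finally show ?thesis
    using assms by simp
qed

lemma integral_norm_trig_sum:
  assumes F: "finite F"
  shows "(LINT x|Omega. (cmod (\<Sum>k\<in>F. a k * ek k x))\<^sup>2) = (\<Sum>k\<in>F. (cmod (a k))\<^sup>2)"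
proof -
  have "complex_of_real (LINT x|Omega. (cmod (\<Sum>k\<in>F. a k * ek k x))\<^sup>2)
      = (LINT x|Omega. (\<Sum>k\<in>F. a k * ek k x) * cnj (\<Sum>k\<in>F. a k * ek k x))"
    by (subst integral_complex_of_real[symmetric]) (simp only: complex_norm_square)
  also have "\<dots> = (\<Sum>k\<in>F. a k * cnj (a k))"
    by (subst integral_trig_sum_cnj) (auto simp: F L2c_trig_sum fc_trig_sum intro!: sum.cong)
  also have "\<dots> = complex_of_real (\<Sum>k\<in>F. (cmod (a k))\<^sup>2)"
    by (simp only: of_real_sum complex_norm_square)
  finally show ?thesis
    by (simp only: of_real_eq_iff)
qed

lemma bessel_identity:
  assumes f: "f \<in> L2c" and F: "finite F"
  shows "(LINT x|Omega. (cmod (f x - (\<Sum>k\<in>F. fc f k * ek k x)))\<^sup>2)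
    = (LINT x|Omega. (cmod (f x))\<^sup>2) - (\<Sum>k\<in>F. (cmod (fc f k))\<^sup>2)"
proof -
  define S where "S x = (\<Sum>k\<in>F. fc f k * ek k x)" for x
  have S: "S \<in> L2c"
    unfolding S_def by (rule L2c_trig_sum) fact
  have pt: "(cmod (f x - S x))\<^sup>2 = (cmod (f x))\<^sup>2 - 2 * Re (f x * cnj (S x)) + (cmod (S x))\<^sup>2" for x
    by (simp add: cmod_power2 power2_diff algebra_simps)
  have "(LINT x|Omega. (cmod (f x - S x))\<^sup>2)
    = (LINT x|Omega. (cmod (f x))\<^sup>2) - 2 * (LINT x|Omega. Re (f x * cnj (S x))) + (LINT x|Omega. (cmod (S x))\<^sup>2)"
    unfolding pt using integrable_Re[OF integrable_mult_L2c[OF f L2c_cnj[OF S]]] L2cD(2)[OF f] L2cD(2)[OF S]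
    by (simp del: times_complex.sel complex_cnj_mult)
  also have "(LINT x|Omega. Re (f x * cnj (S x))) = Re (LINT x|Omega. f x * cnj (S x))"
    by (intro integral_Re integrable_mult_L2c f L2c_cnj S)
  also have "(LINT x|Omega. f x * cnj (S x)) = complex_of_real (\<Sum>k\<in>F. (cmod (fc f k))\<^sup>2)"
    unfolding S_def integral_trig_sum_cnj[OF f F] by (simp only: of_real_sum complex_norm_square)
  also have "(LINT x|Omega. (cmod (S x))\<^sup>2) = (\<Sum>k\<in>F. (cmod (fc f k))\<^sup>2)"
    unfolding S_def by (rule integral_norm_trig_sum) fact
  finally show ?thesis
    by (simp add: S_def)
qed

lemma bessel_inequality:
  assumes f: "f \<in> L2c" and F: "finite F"
  shows "(\<Sum>k\<in>F. (cmod (fc f k))\<^sup>2) \<le> (LINT x|Omega. (cmod (f x))\<^sup>2)"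
proof -
  have "0 \<le> (LINT x|Omega. (cmod (f x - (\<Sum>k\<in>F. fc f k * ek k x)))\<^sup>2)"
    by simp
  then show ?thesis
    unfolding bessel_identity[OF assms] by simp
qed

lemma measure_Omega: "measure Omega (space Omega) = 1"
  using emeasure_Omega by (simp only: measure_def) simp

text \<open>Young's inequality with parameter \<open>c\<close>, integrated over a cube of measure
  one.\<close>

lemma L1_le_of_L2:
  assumes f: "f \<in> L2c" and c: "c > 0" and le: "(LINT x|Omega. (cmod (f x))\<^sup>2) \<le> c\<^sup>2"
  shows "(LINT x|Omega. cmod (f x)) \<le> c"
proof -
  have one: "integrable Omega (\<lambda>x. c / 2)" "(LINT x|Omega. c / 2) = c / 2"
    using finite_measure.integrable_const[OF finite_measure_Omega] measure_Omega by auto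
  have "(LINT x|Omega. cmod (f x)) \<le> (LINT x|Omega. c / 2 + (cmod (f x))\<^sup>2 / (2 * c))"
  proof (rule integral_mono)
    show "integrable Omega (\<lambda>x. cmod (f x))"
      using L2c_integrable[OF f] by simp
    show "integrable Omega (\<lambda>x. c / 2 + (cmod (f x))\<^sup>2 / (2 * c))"
      using one L2cD(2)[OF f] by simp
    fix x
    have "cmod (f x) * c * 2 \<le> (cmod (f x))\<^sup>2 + c\<^sup>2"
      using sum_squares_bound[of "cmod (f x)" c] by (simp add: mult_ac)
    then show "cmod (f x) \<le> c / 2 + (cmod (f x))\<^sup>2 / (2 * c)"
      using c by (simp add: field_simps power2_eq_square)
  qed
  also have "\<dots> = c / 2 + (LINT x|Omega. (cmod (f x))\<^sup>2) / (2 * c)"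
    using one L2cD(2)[OF f] by simp
  also have "\<dots> \<le> c / 2 + c\<^sup>2 / (2 * c)"
    using c le by (intro add_left_mono divide_right_mono) auto
  also have "\<dots> = c"
    using c by (simp add: power2_eq_square)
  finally show ?thesis .
qed

lemma nonneg_summable_tail:
  fixes f :: "'a \<Rightarrow> real"
  assumes f: "f summable_on UNIV" "\<And>x. f x \<ge> 0" and e: "e > 0"
  obtains F where "finite F" "\<And>G. F \<subseteq> G \<Longrightarrow> finite G \<Longrightarrow> infsum f UNIV - e \<le> sum f G"
proof -
  obtain F where F: "finite F" "dist (sum f F) (infsum f UNIV) \<le> e"
    using infsum_finite_approximation[OF f(1) e] by auto
  have "infsum f UNIV - e \<le> sum f G" if "F \<subseteq> G" "finite G" for G
    using F(2) sum_mono2[OF that(2,1), of f, OF f(2)] unfolding dist_real_def by linarith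
  then show ?thesis
    using that F by blast
qed

text \<open>The limit function is defined everywhere by \<open>lim\<close> of the partial sums, which makes it periodic
  whatever \<open>lim\<close> returns on a divergent sequence.\<close>

theorem riesz_fischer:
  assumes a: "(\<lambda>k. (cmod (a k))\<^sup>2) summable_on UNIV"
  shows "\<exists>f F. periodic f \<and> f \<in> L2c \<and> (\<forall>k. fc f k = a k) \<and> (\<forall>n. finite (F n)) \<and>
    (AE x in Omega. (\<lambda>n::nat. \<Sum>k\<in>F n. a k * ek k x) \<longlonglongrightarrow> f x) \<and>
    (LINT x|Omega. (cmod (f x))\<^sup>2) = (\<Sum>\<^sub>\<infinity>k. (cmod (a k))\<^sup>2)"
proof -
  define A where "A k = (cmod (a k))\<^sup>2" for k
  \<comment> \<open>Geometric tolerances, so that the increments of the selected partial sums have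
    summable norms.\<close>
  define c where "c n = (1/2::real) ^ n" for n
  have c: "c n > 0" for n by (simp add: c_def)
  have A: "A summable_on UNIV" "A k \<ge> 0" for k
    using a unfolding A_def by auto
  have "\<exists>F. finite F \<and> (\<forall>G. F \<subseteq> G \<longrightarrow> finite G \<longrightarrow> infsum A UNIV - (c n)\<^sup>2 \<le> sum A G)" for n
    using nonneg_summable_tail[of A "(c n)\<^sup>2"] A c by (metis zero_less_power)
  then obtain F0 where F0: "\<And>n. finite (F0 n)"
    "\<And>n G. F0 n \<subseteq> G \<Longrightarrow> finite G \<Longrightarrow> infsum A UNIV - (c n)\<^sup>2 \<le> sum A G"
    by metis
  \<comment> \<open>Unions make the index sets increasing, so that a difference of partial sums runs
    over \<open>F m - F n\<close>, disjoint from \<open>F n\<close>.\<close>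
  define F where "F n = (\<Union>m\<le>n. F0 m)" for n
  have F: "finite (F n)" for n
    unfolding F_def using F0(1) by simp
  have F_mono: "F m \<subseteq> F n" if "m \<le> n" for m n
    using that by (fastforce simp: F_def)
  have F_low: "infsum A UNIV - (c n)\<^sup>2 \<le> sum A (F n)" for n
    by (rule F0(2)[OF _ F]) (auto simp: F_def)
  have F_up: "sum A G \<le> infsum A UNIV" if "finite G" for G
    by (rule finite_sum_le_infsum) (use A that in auto)
  have tail: "sum A G \<le> (c n)\<^sup>2" if "finite G" "G \<inter> F n = {}" for G n
  proof -
    have "sum A (F n) + sum A G = sum A (F n \<union> G)"
      using that F by (intro sum.union_disjoint[symmetric]) auto
    then show ?thesis
      using F_low[of n] F_up[of "F n \<union> G"] that F by simp
  qed
  define S where "S n x = (\<Sum>k\<in>F n. a k * ek k x)" for n x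
  have S: "S n \<in> L2c" for n
    unfolding S_def by (intro L2c_trig_sum F)
  have S_diff: "S m x - S n x = (\<Sum>k\<in>F m - F n. a k * ek k x)" if "n \<le> m" for n m x
    unfolding S_def using F F_mono[OF that] by (simp add: sum_diff)
  have L2_diff: "(LINT x|Omega. (cmod (S m x - S n x))\<^sup>2) \<le> (c n)\<^sup>2" if "n \<le> m" for m n
  proof -
    have "(LINT x|Omega. (cmod (S m x - S n x))\<^sup>2) = sum A (F m - F n)"
      unfolding S_diff[OF that] A_def using F by (intro integral_norm_trig_sum) auto
    also have "\<dots> \<le> (c n)\<^sup>2"
      using F by (intro tail) auto
    finally show ?thesis .
  qed
  define g where "g n x = S (Suc n) x - S n x" for n x
  have g: "g n \<in> L2c" for n
    unfolding g_def by (intro L2c_diff S)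
  have g1: "(LINT x|Omega. cmod (g n x)) \<le> c n" for n
    using L2_diff[of n "Suc n"] by (intro L1_le_of_L2 g c) (simp add: g_def)
  \<comment> \<open>Summability of the integrals of the increments makes the telescoping series
    converge absolutely at almost every point.\<close>
  have "AE x in Omega. (\<Sum>n. ennreal (cmod (g n x))) \<noteq> \<infinity>"
  proof (rule nn_integral_PInf_AE)
    show "(\<lambda>x. \<Sum>n. ennreal (cmod (g n x))) \<in> borel_measurable Omega"
      using L2cD(1)[OF g] by (intro borel_measurable_suminf_order) auto
    have "(\<integral>\<^sup>+x. (\<Sum>n. ennreal (cmod (g n x))) \<partial>Omega) = (\<Sum>n. \<integral>\<^sup>+x. ennreal (cmod (g n x)) \<partial>Omega)"
      using L2cD(1)[OF g] by (intro nn_integral_suminf) auto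
    also have "\<dots> \<le> (\<Sum>n. ennreal (c n))"
    proof (intro suminf_le)
      show "(\<integral>\<^sup>+x. ennreal (cmod (g n x)) \<partial>Omega) \<le> ennreal (c n)" for n
        using g1[of n] L2c_integrable[OF g, of n] by (subst nn_integral_eq_integral) (auto intro: ennreal_leI)
    qed auto
    also have "\<dots> = ennreal (\<Sum>n. c n)"
      using c by (intro suminf_ennreal2) (auto simp: c_def less_imp_le)
    also have "\<dots> < \<infinity>"
      by simp
    finally show "(\<integral>\<^sup>+x. (\<Sum>n. ennreal (cmod (g n x))) \<partial>Omega) \<noteq> \<infinity>"
      by simp
  qed
  then have conv: "AE x in Omega. convergent (\<lambda>n. S n x)"
  proof eventually_elim
    case (elim x)
    then have "summable (\<lambda>n. cmod (g n x))"
      by (intro summable_suminf_not_top) auto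
    then have "summable (\<lambda>n. g n x)"
      by (rule summable_norm_cancel)
    then have "convergent (\<lambda>n. \<Sum>i<n. g i x)"
      by (simp add: summable_iff_convergent)
    then have "convergent (\<lambda>n. (\<Sum>i<n. g i x) + S 0 x)"
      by (intro convergent_add convergent_const)
    moreover have "(\<Sum>i<n. g i x) + S 0 x = S n x" for n
      unfolding g_def by (subst sum_lessThan_telescope) simp
    ultimately show ?case by simp
  qed
  define f where "f x = lim (\<lambda>n. S n x)" for x
  have lim: "AE x in Omega. (\<lambda>n. S n x) \<longlonglongrightarrow> f x"
    using conv by eventually_elim (simp add: f_def convergent_LIMSEQ_iff)
  have fm: "f \<in> borel_measurable Omega"
    unfolding f_def using L2cD(1)[OF S] by (intro borel_measurable_lim_metric)
  have per: "periodic f"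
    using periodic_ek by (simp add: periodic_def f_def S_def)
  \<comment> \<open>Fatou's lemma as the upper index tends to infinity: the bound on
    \<open>S m - S n\<close> passes to \<open>f - S n\<close>. The extended integral is used because
    \<open>f\<close> is not yet known to be square integrable.\<close>
  have nn: "(\<integral>\<^sup>+x. ennreal ((cmod (f x - S n x))\<^sup>2) \<partial>Omega) \<le> ennreal ((c n)\<^sup>2)" for n
  proof -
    have "(\<integral>\<^sup>+x. ennreal ((cmod (f x - S n x))\<^sup>2) \<partial>Omega)
      = (\<integral>\<^sup>+x. liminf (\<lambda>m. ennreal ((cmod (S m x - S n x))\<^sup>2)) \<partial>Omega)"
    proof (rule nn_integral_cong_AE)
      show "AE x in Omega. ennreal ((cmod (f x - S n x))\<^sup>2) = liminf (\<lambda>m. ennreal ((cmod (S m x - S n x))\<^sup>2))"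
        using lim
      proof eventually_elim
        case (elim x)
        then have "(\<lambda>m. ennreal ((cmod (S m x - S n x))\<^sup>2)) \<longlonglongrightarrow> ennreal ((cmod (f x - S n x))\<^sup>2)"
          by (intro tendsto_ennrealI tendsto_intros)
        then show ?case
          by (intro lim_imp_Liminf[symmetric]) auto
      qed
    qed
    also have "\<dots> \<le> liminf (\<lambda>m. \<integral>\<^sup>+x. ennreal ((cmod (S m x - S n x))\<^sup>2) \<partial>Omega)"
      using L2cD(1)[OF S] by (intro nn_integral_liminf) auto
    also have "\<dots> \<le> liminf (\<lambda>m. ennreal ((c n)\<^sup>2))"
    proof (rule Liminf_mono, rule eventually_sequentiallyI[of n])
      fix m assume "n \<le> m"
      then show "(\<integral>\<^sup>+x. ennreal ((cmod (S m x - S n x))\<^sup>2) \<partial>Omega) \<le> ennreal ((c n)\<^sup>2)"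
        using L2_diff[of n m] L2cD(2)[OF L2c_diff[OF S S]]
        by (subst nn_integral_eq_integral) (auto intro: ennreal_leI)
    qed
    finally show ?thesis
      by (simp add: Liminf_const)
  qed
  have fS: "(\<lambda>x. f x - S n x) \<in> L2c" for n
  proof -
    have "integrable Omega (\<lambda>x. (cmod (f x - S n x))\<^sup>2)"
    proof (rule integrableI_nonneg)
      show "(\<integral>\<^sup>+x. ennreal ((cmod (f x - S n x))\<^sup>2) \<partial>Omega) < \<infinity>"
        using nn[of n] by (simp add: less_top[symmetric] top_unique) (metis ennreal_less_top le_less_trans less_irrefl)
    qed (use fm L2cD(1)[OF S] in auto)
    then show ?thesis
      using fm L2cD(1)[OF S] by (simp add: L2c_def)
  qed
  have f: "f \<in> L2c"
    using L2c_add[OF fS S, of 0 0] by simp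
  have fS_le: "(LINT x|Omega. (cmod (f x - S n x))\<^sup>2) \<le> (c n)\<^sup>2" for n
  proof -
    have "ennreal (LINT x|Omega. (cmod (f x - S n x))\<^sup>2) \<le> ennreal ((c n)\<^sup>2)"
      using nn[of n] L2cD(2)[OF fS, of n] by (subst (asm) nn_integral_eq_integral) auto
    then show ?thesis
      by (simp add: ennreal_le_iff)
  qed
  have c0: "c \<longlonglongrightarrow> 0"
    unfolding c_def by (rule LIMSEQ_power_zero) auto
  have fc: "fc f k = a k" for k
  proof -
    \<comment> \<open>Bessel's inequality at the single frequency \<open>k\<close> bounds the
      distance to the coefficient of \<open>S n\<close>; the tail bound for \<open>{k}\<close>
      handles the case that \<open>k\<close> is not yet in \<open>F n\<close>.\<close>
    have "cmod (fc f k - a k) \<le> 2 * c n" for n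
    proof -
      have "(cmod (fc f k - fc (S n) k))\<^sup>2 \<le> (c n)\<^sup>2"
        using bessel_inequality[OF fS, of "{k}" n] fS_le[of n] by (simp add: fc_diff f S)
      then have 1: "cmod (fc f k - fc (S n) k) \<le> c n"
        using c[of n] by (simp add: power2_le_iff_abs_le)
      have "(cmod (fc (S n) k - a k))\<^sup>2 \<le> (c n)\<^sup>2"
        using tail[of "{k}" n] c[of n] unfolding S_def by (auto simp: fc_trig_sum F A_def)
      then have 2: "cmod (fc (S n) k - a k) \<le> c n"
        using c[of n] by (simp add: power2_le_iff_abs_le)
      show ?thesis
        using norm_triangle_le[of "fc f k - fc (S n) k" "fc (S n) k - a k" "2 * c n"] 1 2 by simp
    qed
    moreover have "(\<lambda>n. 2 * c n) \<longlonglongrightarrow> 2 * 0"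
      by (intro tendsto_intros c0)
    ultimately have "cmod (fc f k - a k) \<le> 2 * 0"
      by (intro LIMSEQ_le_const) blast+
    then show ?thesis by simp
  qed
  have parseval: "(LINT x|Omega. (cmod (f x))\<^sup>2) = infsum A UNIV"
  proof -
    have "\<bar>(LINT x|Omega. (cmod (f x))\<^sup>2) - infsum A UNIV\<bar> \<le> (c n)\<^sup>2" for n
    proof -
      have "(LINT x|Omega. (cmod (f x - S n x))\<^sup>2) = (LINT x|Omega. (cmod (f x))\<^sup>2) - sum A (F n)"
        using bessel_identity[OF f F, of n] by (simp add: fc S_def A_def)
      moreover have "(LINT x|Omega. (cmod (f x - S n x))\<^sup>2) \<ge> 0"
        by simp
      ultimately show ?thesis
        using fS_le[of n] F_low[of n] F_up[OF F, of n] by linarith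
    qed
    moreover have "(\<lambda>n. (c n)\<^sup>2) \<longlonglongrightarrow> 0\<^sup>2"
      by (intro tendsto_intros c0)
    ultimately have "\<bar>(LINT x|Omega. (cmod (f x))\<^sup>2) - infsum A UNIV\<bar> \<le> 0\<^sup>2"
      by (intro LIMSEQ_le_const) blast+
    then show ?thesis by simp
  qed
  show ?thesis
    by (rule exI[of _ f], rule exI[of _ F])
      (use per f fc F lim parseval in \<open>auto simp: S_def A_def[abs_def]\<close>)
qed

text \<open>Bessel's inequality makes the coefficients square summable; the function which
  Riesz-Fischer rebuilds from them has the right norm and, by uniqueness, equals \<open>f\<close>
  almost everywhere.\<close>

theorem parseval_norm:
  assumes f: "f \<in> L2c"
  shows "((\<lambda>k. (cmod (fc f k))\<^sup>2) has_sum (LINT x|Omega. (cmod (f x))\<^sup>2)) UNIV"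
proof -
  have s: "(\<lambda>k. (cmod (fc f k))\<^sup>2) summable_on UNIV"
    using bessel_inequality[OF f] by (intro nonneg_bdd_above_summable_on bdd_aboveI2) auto
  then obtain g F where g: "g \<in> L2c" "\<And>k. fc g k = fc f k"
    "(LINT x|Omega. (cmod (g x))\<^sup>2) = (\<Sum>\<^sub>\<infinity>k. (cmod (fc f k))\<^sup>2)"
    using riesz_fischer[of "fc f", OF s] by (elim exE conjE) (rule that, auto)
  have "AE x in Omega. f x - g x = 0"
  proof (rule fourier_uniqueness)
    show "integrable Omega (\<lambda>x. f x - g x)"
      by (intro L2c_integrable L2c_diff f g)
    show "(LINT x|Omega. (f x - g x) * cnj (ek k x)) = 0" for k
      using fc_diff[OF f g(1), of k] g(2) by (simp add: fc_def)
  qed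
  then have "(LINT x|Omega. (cmod (f x))\<^sup>2) = (LINT x|Omega. (cmod (g x))\<^sup>2)"
    by (intro integral_cong_AE) (use L2cD[OF f] L2cD[OF g(1)] in \<open>auto elim!: eventually_mono\<close>)
  then show ?thesis
    using s g(3) by simp
qed

text \<open>Polarization of \<open>parseval_norm\<close> with the four unit factors 1, -1,
  \<open>\<i>\<close> and \<open>- \<i>\<close>, applied to the coefficients and to the functions
  alike.\<close>

theorem parseval:
  assumes f: "f \<in> L2c" and g: "g \<in> L2c"
  shows "((\<lambda>k. fc f k * cnj (fc g k)) has_sum (LINT x|Omega. f x * cnj (g x))) UNIV"
proof -
  have polar: "z * cnj w = (1/4) * complex_of_real ((cmod (z + w))\<^sup>2) - (1/4) * complex_of_real ((cmod (z + (-1) * w))\<^sup>2)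
     + (\<i>/4) * complex_of_real ((cmod (z + \<i> * w))\<^sup>2) - (\<i>/4) * complex_of_real ((cmod (z + (-\<i>) * w))\<^sup>2)" for z w
    unfolding complex_norm_square by (simp add: field_simps)
  have N: "(\<lambda>x. f x + c * g x) \<in> L2c" for c
    by (intro L2c_add f L2c_cmult g)
  define I where "I c = (LINT x|Omega. (cmod (f x + c * g x))\<^sup>2)" for c
  have P: "((\<lambda>k. complex_of_real ((cmod (fc f k + c * fc g k))\<^sup>2)) has_sum complex_of_real (I c)) UNIV" for c
    using parseval_norm[OF N, of c] by (intro has_sum_of_real) (simp add: fc_add fc_cmult f L2c_cmult g I_def)
  have sum: "((\<lambda>k. fc f k * cnj (fc g k)) has_sum
    ((1/4) * complex_of_real (I 1) + - ((1/4) * complex_of_real (I (-1)))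
      + (\<i>/4) * complex_of_real (I \<i>) + - ((\<i>/4) * complex_of_real (I (-\<i>))))) UNIV"
    unfolding polar[of "fc f _"] diff_conv_add_uminus
    using P[of 1] by (intro has_sum_add has_sum_cmult_right has_sum_uminusI P) simp
  have "(LINT x|Omega. f x * cnj (g x)) =
     (1/4) * complex_of_real (I 1) - (1/4) * complex_of_real (I (-1))
      + (\<i>/4) * complex_of_real (I \<i>) - (\<i>/4) * complex_of_real (I (-\<i>))"
  proof -
    have i: "integrable Omega (\<lambda>x. complex_of_real ((cmod (f x + c * g x))\<^sup>2))" for c
      by (intro integrable_of_real L2cD N)
    have I: "(LINT x|Omega. complex_of_real ((cmod (f x + c * g x))\<^sup>2)) = complex_of_real (I c)" for c
      unfolding I_def by (rule integral_complex_of_real)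
    note i1 = i[of 1, unfolded mult_1] and I1 = I[of 1, unfolded mult_1]
    show ?thesis
      unfolding polar[of "f _"]
      by (subst Bochner_Integration.integral_diff Bochner_Integration.integral_add,
          (intro Bochner_Integration.integrable_diff Bochner_Integration.integrable_add integrable_mult_right i i1)+)+
        (simp only: integral_mult_right_zero I I1)
  qed
  with sum show ?thesis by simp
qed

section \<open>Real-valued square integrable functions\<close>

abbreviation cx :: "scalar_field \<Rightarrow> real^3 \<Rightarrow> complex" where
  "cx f \<equiv> (\<lambda>x. complex_of_real (f x))"

lemma fourier_coeff_fc: "fourier_coeff f = fc (cx f)"
  by (rule ext) (simp add: fourier_coeff_ek fc_def)

lemma measurable_cx: "cx f \<in> borel_measurable M \<longleftrightarrow> f \<in> borel_measurable M"
proof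
  assume "cx f \<in> borel_measurable M"
  then have "(\<lambda>x. Re (cx f x)) \<in> borel_measurable M"
    by measurable
  then show "f \<in> borel_measurable M" by simp
qed measurable

lemma L2_iff: "f \<in> L2 \<longleftrightarrow> periodic f \<and> cx f \<in> L2c"
  by (simp add: L2_def L2c_def measurable_cx)

lemma L2_periodic: "f \<in> L2 \<Longrightarrow> periodic f" and L2_cx: "f \<in> L2 \<Longrightarrow> cx f \<in> L2c"
  by (auto simp: L2_iff)

lemma L2_measurable: "f \<in> L2 \<Longrightarrow> f \<in> borel_measurable Omega"
  and L2_square_integrable: "f \<in> L2 \<Longrightarrow> integrable Omega (\<lambda>x. (f x)\<^sup>2)"
  by (auto simp: L2_def)

lemma L2_add: "f \<in> L2 \<Longrightarrow> g \<in> L2 \<Longrightarrow> (\<lambda>x. f x + g x) \<in> L2"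
  using L2c_add[of "cx f" "cx g"] by (simp add: L2_iff periodic_def)

lemma L2_diff: "f \<in> L2 \<Longrightarrow> g \<in> L2 \<Longrightarrow> (\<lambda>x. f x - g x) \<in> L2"
  using L2c_diff[of "cx f" "cx g"] by (simp add: L2_iff periodic_def)

lemma L2_cmult: "f \<in> L2 \<Longrightarrow> (\<lambda>x. c * f x) \<in> L2"
  using L2c_cmult[of "cx f" "complex_of_real c"] by (simp add: L2_iff periodic_def)

lemma L2_zero: "(\<lambda>x. 0) \<in> L2"
  by (simp add: L2_def periodic_def)

lemma L2_sum: "finite F \<Longrightarrow> (\<And>i. i \<in> F \<Longrightarrow> f i \<in> L2) \<Longrightarrow> (\<lambda>x. \<Sum>i\<in>F. f i x) \<in> L2"
  by (induction F rule: finite_induct) (auto intro: L2_add L2_zero)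

lemma L2_integrable_mult: assumes "f \<in> L2" "g \<in> L2" shows "integrable Omega (\<lambda>x. f x * g x)"
proof -
  have "integrable Omega (\<lambda>x. cx f x * cx g x)"
    using assms by (intro integrable_mult_L2c L2_cx)
  then have "integrable Omega (\<lambda>x. Re (cx f x * cx g x))"
    by (rule integrable_Re)
  then show ?thesis by simp
qed

lemma L2_integrable: "f \<in> L2 \<Longrightarrow> integrable Omega f"
  using integrable_Re[OF L2c_integrable[OF L2_cx]] by simp

lemma L2_continuous:
  assumes "periodic f" "continuous_on UNIV f"
  shows "f \<in> L2"
  using assms by (auto simp: L2_def intro!: measurable_Omega_continuous integrable_Omega_continuous continuous_intros)

lemma fourier_coeff_add: "f \<in> L2 \<Longrightarrow> g \<in> L2 \<Longrightarrow> fourier_coeff (\<lambda>x. f x + g x) k = fourier_coeff f k + fourier_coeff g k"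
  using fc_add[OF L2_cx L2_cx, of f g k] by (simp add: fourier_coeff_fc)

lemma fourier_coeff_diff: "f \<in> L2 \<Longrightarrow> g \<in> L2 \<Longrightarrow> fourier_coeff (\<lambda>x. f x - g x) k = fourier_coeff f k - fourier_coeff g k"
  using fc_diff[OF L2_cx L2_cx, of f g k] by (simp add: fourier_coeff_fc)

lemma fourier_coeff_cmult: "fourier_coeff (\<lambda>x. c * f x) k = complex_of_real c * fourier_coeff f k"
  by (simp add: fourier_coeff_fc fc_cmult)

lemma fourier_coeff_zero: "fourier_coeff (\<lambda>x. 0) k = 0"
  by (simp add: fourier_coeff_def)

lemma fourier_coeff_sum:
  "finite F \<Longrightarrow> (\<And>i. i \<in> F \<Longrightarrow> f i \<in> L2) \<Longrightarrow> fourier_coeff (\<lambda>x. \<Sum>i\<in>F. f i x) k = (\<Sum>i\<in>F. fourier_coeff (f i) k)"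
  by (induction F rule: finite_induct) (auto simp: fourier_coeff_zero fourier_coeff_add L2_sum)

lemma fourier_coeff_cong_AE:
  assumes "AE x in Omega. f x = g x" "f \<in> borel_measurable Omega" "g \<in> borel_measurable Omega"
  shows "fourier_coeff f k = fourier_coeff g k"
proof -
  have [measurable]: "f \<in> borel_measurable Omega" "g \<in> borel_measurable Omega" by fact+
  have [measurable]: "(\<lambda>x. cnj (ek k x)) \<in> borel_measurable Omega"
    by (intro borel_measurable_integrable L2c_integrable L2c_cnj L2c_ek)
  show ?thesis
    unfolding fourier_coeff_ek
    by (intro integral_cong_AE) (use assms(1) in \<open>auto elim!: eventually_mono\<close>)
qed

lemma fourier_coeff_uminus: "fourier_coeff f (- k) = cnj (fourier_coeff f k)"
proof -
  have "fourier_coeff f (- k) = (LINT x|Omega. cnj (complex_of_real (f x) * cnj (ek k x)))"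
    by (simp add: fourier_coeff_ek ek_uminus)
  then show ?thesis
    by (simp only: Bochner_Integration.integral_cnj fourier_coeff_ek)
qed

lemma parseval_real:
  assumes f: "f \<in> L2" and g: "g \<in> L2"
  shows "((\<lambda>k. Re (fourier_coeff f k * cnj (fourier_coeff g k))) has_sum (LINT x|Omega. f x * g x)) UNIV"
proof -
  have "((\<lambda>k. Re (fc (cx f) k * cnj (fc (cx g) k))) has_sum Re (LINT x|Omega. cx f x * cnj (cx g x))) UNIV"
    by (intro has_sum_Re parseval L2_cx f g)
  moreover have "(LINT x|Omega. cx f x * cnj (cx g x)) = complex_of_real (LINT x|Omega. f x * g x)"
    by (subst integral_complex_of_real[symmetric]) simp
  ultimately show ?thesis
    by (simp add: fourier_coeff_fc)
qed

lemma fourier_coeff_summable: "f \<in> L2 \<Longrightarrow> (\<lambda>k. (cmod (fourier_coeff f k))\<^sup>2) summable_on UNIV"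
  using parseval_norm[OF L2_cx] by (auto simp: fourier_coeff_fc summable_on_def)

lemma fourier_coeff_inject:
  assumes "integrable Omega f" "integrable Omega g" "\<And>k. fourier_coeff f k = fourier_coeff g k"
  shows "AE x in Omega. f x = g x"
proof -
  have *: "integrable Omega (\<lambda>x. cx h x * cnj (ek k x))" if "integrable Omega h" for h k
    by (rule integrable_mult_bounded[where B = 1])
      (use that borel_measurable_integrable[OF L2c_integrable[OF L2c_cnj[OF L2c_ek]]] in auto)
  have "AE x in Omega. cx f x - cx g x = 0"
  proof (rule fourier_uniqueness)
    show "integrable Omega (\<lambda>x. cx f x - cx g x)"
      using assms by auto
    show "(LINT x|Omega. (cx f x - cx g x) * cnj (ek k x)) = 0" for k
      using assms(3)[of k] *[OF assms(1)] *[OF assms(2)] by (simp add: fourier_coeff_ek ring_distribs)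
  qed
  then show ?thesis
    by (rule eventually_mono) auto
qed

lemma L2_fourier_inject:
  assumes "f \<in> L2" "g \<in> L2" "\<And>k. fourier_coeff f k = fourier_coeff g k"
  shows "AE x in Omega. f x = g x"
  using assms by (intro fourier_coeff_inject L2_integrable)

text \<open>Hermitian symmetry gives the limit function and its conjugate the same coefficients,
  hence also the real part. The pointwise limit is kept in the conclusion for the bound on the
  supremum below.\<close>

lemma riesz_fischer_real:
  assumes a: "(\<lambda>k. (cmod (a k))\<^sup>2) summable_on UNIV" and herm: "\<And>k. a (- k) = cnj (a k)"
  shows "\<exists>f F. f \<in> L2 \<and> (\<forall>k. fourier_coeff f k = a k) \<and> (\<forall>n. finite (F n)) \<and>
    (AE x in Omega. (\<lambda>n::nat. Re (\<Sum>k\<in>F n. a k * ek k x)) \<longlonglongrightarrow> f x)"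
proof -
  obtain f F where f: "periodic f" "f \<in> L2c" "\<And>k. fc f k = a k" "\<And>n. finite (F n)"
    "AE x in Omega. (\<lambda>n::nat. \<Sum>k\<in>F n. a k * ek k x) \<longlonglongrightarrow> f x"
    using riesz_fischer[of a, OF a] by (elim exE conjE) (rule that, auto)
  have cf: "cx (\<lambda>x. Re (f x)) = (\<lambda>x. (1/2) * (f x + cnj (f x)))"
    by (auto simp: complex_eq_iff)
  have *: "fc (\<lambda>x. cnj (f x)) k = a k" for k
  proof -
    have "fc (\<lambda>x. cnj (f x)) k = (LINT x|Omega. cnj (f x * cnj (ek (- k) x)))"
      by (simp add: fc_def ek_uminus)
    also have "\<dots> = cnj (fc f (- k))"
      by (simp only: Bochner_Integration.integral_cnj fc_def)
    finally show ?thesis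
      by (simp add: f herm)
  qed
  have "(\<lambda>x. Re (f x)) \<in> L2"
    unfolding L2_iff cf
    using f(1) L2c_cmult[OF L2c_add[OF f(2) L2c_cnj[OF f(2)]], of "1/2"] by (simp add: periodic_def)
  moreover have "fourier_coeff (\<lambda>x. Re (f x)) k = a k" for k
    unfolding fourier_coeff_fc cf by (subst fc_cmult) (simp add: fc_add f L2c_cnj *)
  moreover have "AE x in Omega. (\<lambda>n::nat. Re (\<Sum>k\<in>F n. a k * ek k x)) \<longlonglongrightarrow> Re (f x)"
    using f(5) by eventually_elim (rule tendsto_Re)
  ultimately show ?thesis
    using f(4) by (intro exI[of _ "\<lambda>x. Re (f x)"] exI[of _ F]) blast
qed

text \<open>Each partial sum obeys the bound at every point; the pointwise limit of a suitable
  sequence of them inherits it and agrees with \<open>f\<close> almost everywhere.\<close>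

lemma AE_bound_fourier:
  assumes f: "f \<in> L2" and s: "(\<lambda>k. cmod (fourier_coeff f k)) summable_on UNIV"
  shows "AE x in Omega. \<bar>f x\<bar> \<le> (\<Sum>\<^sub>\<infinity>k. cmod (fourier_coeff f k))"
proof -
  obtain g F where g: "g \<in> L2" "\<And>k. fourier_coeff g k = fourier_coeff f k" "\<And>n. finite (F n)"
    "AE x in Omega. (\<lambda>n::nat. Re (\<Sum>k\<in>F n. fourier_coeff f k * ek k x)) \<longlonglongrightarrow> g x"
    using riesz_fischer_real[of "fourier_coeff f", OF fourier_coeff_summable[OF f] fourier_coeff_uminus]
    by (elim exE conjE) (rule that, auto)
  have "AE x in Omega. g x = f x"
    by (rule L2_fourier_inject) (use f g in auto)
  with g(4) show ?thesis
  proof eventually_elim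
    case (elim x)
    have "\<bar>Re (\<Sum>k\<in>F n. fourier_coeff f k * ek k x)\<bar> \<le> (\<Sum>\<^sub>\<infinity>k. cmod (fourier_coeff f k))" for n
    proof -
      have "\<bar>Re (\<Sum>k\<in>F n. fourier_coeff f k * ek k x)\<bar> \<le> cmod (\<Sum>k\<in>F n. fourier_coeff f k * ek k x)"
        by (rule abs_Re_le_cmod)
      also have "\<dots> \<le> (\<Sum>k\<in>F n. cmod (fourier_coeff f k))"
        by (rule order_trans[OF norm_sum]) (simp add: norm_mult)
      also have "\<dots> \<le> (\<Sum>\<^sub>\<infinity>k. cmod (fourier_coeff f k))"
        by (rule finite_sum_le_infsum) (use s g(3) in auto)
      finally show ?thesis .
    qed
    then show ?case
      using elim by (intro LIMSEQ_le_const2[OF tendsto_rabs[of "\<lambda>n. Re (\<Sum>k\<in>F n. fourier_coeff f k * ek k x)"]]) auto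
  qed
qed

section \<open>Weak derivatives\<close>

lemma partial_deriv_has_real_derivative:
  assumes "\<And>x. f differentiable (at x)"
  shows "((\<lambda>t. f (x + axis j t)) has_real_derivative partial_deriv j f (x + axis j t)) (at t)"
proof -
  let ?D = "frechet_derivative f (at (x + axis j t))"
  have D: "(f has_derivative ?D) (at (x + axis j t))"
    using assms by (simp add: frechet_derivative_works[symmetric])
  have ax: "axis j s = s *\<^sub>R axis j (1::real)" for s
    by (simp add: vec_eq_iff axis_def)
  have "((\<lambda>t. x + t *\<^sub>R axis j 1) has_derivative (\<lambda>s. s *\<^sub>R axis j 1)) (at t)"
    by (auto intro!: derivative_eq_intros)
  then have "((\<lambda>t. x + axis j t) has_derivative (\<lambda>s. axis j s)) (at t)"
    by (simp only: ax[symmetric])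
  then have "((\<lambda>t. f (x + axis j t)) has_derivative (\<lambda>s. ?D (axis j s))) (at t)"
    by (rule has_derivative_compose) (use D in simp)
  moreover have "?D (axis j s) = partial_deriv j f (x + axis j t) * s" for s
    using linear_scale[OF has_derivative_linear[OF D], of s "axis j 1"]
    by (simp add: partial_deriv_def ax[of s] mult.commute)
  ultimately show ?thesis
    by (simp add: has_field_derivative_def)
qed

text \<open>Difference quotients of a periodic function integrate to zero by translation invariance;
  the mean value theorem dominates them by the maximum of the derivative.\<close>

lemma integral_partial_deriv_zero:
  assumes per: "periodic h" and diff: "\<And>x. h differentiable (at x)"
    and cont: "continuous_on UNIV (partial_deriv j h)"
  shows "(LINT x|Omega. partial_deriv j h x) = 0"
proof -
  have ch: "continuous_on UNIV h"
    using diff by (simp add: continuous_on_eq_continuous_at differentiable_imp_continuous_within)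
  define t where "t n = 1 / real (Suc n)" for n
  have t: "0 < t n" "t n \<le> 1" for n
    by (auto simp: t_def)
  have t0: "t \<longlonglongrightarrow> 0"
    unfolding t_def by (rule LIMSEQ_Suc[OF lim_1_over_n, unfolded]) 
  define q where "q n x = (h (x + axis j (t n)) - h x) / t n" for n x
  have cs: "continuous_on UNIV (\<lambda>x. h (x + axis j s))" for s
    by (rule continuous_on_compose2[OF ch]) (auto intro: continuous_intros)
  have q0: "(LINT x|Omega. q n x) = 0" for n
    unfolding q_def using integral_Omega_shift_unit[OF ch per, of "t n" j] t[of n]
    by (simp add: integrable_Omega_continuous ch cs)
  \<comment> \<open>The intermediate point of the mean value theorem may leave the unit cube, but by
    less than 1, so it stays in the doubled one.\<close>
  have "bounded (partial_deriv j h ` cbox 0 2)"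
    by (intro compact_imp_bounded compact_continuous_image continuous_on_subset[OF cont]) auto
  then obtain B where B: "\<And>x. x \<in> cbox 0 2 \<Longrightarrow> \<bar>partial_deriv j h x\<bar> \<le> B"
    unfolding bounded_iff by auto
  note D = partial_deriv_has_real_derivative[OF diff, of _ j]
  have "(\<lambda>n. LINT x|Omega. q n x) \<longlonglongrightarrow> (LINT x|Omega. partial_deriv j h x)"
  proof (rule integral_dominated_convergence[where w = "\<lambda>x. B"])
    show "partial_deriv j h \<in> borel_measurable Omega"
      by (intro measurable_Omega_continuous cont)
    show "q n \<in> borel_measurable Omega" for n
      unfolding q_def using t[of n] by (intro measurable_Omega_continuous continuous_intros cs ch) auto
    show "integrable Omega (\<lambda>x. B)"
      by (rule finite_measure.integrable_const[OF finite_measure_Omega])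
    show "AE x in Omega. (\<lambda>n. q n x) \<longlonglongrightarrow> partial_deriv j h x"
    proof (rule AE_I2)
      fix x
      have "((\<lambda>s. (h (x + axis j (0 + s)) - h (x + axis j 0)) / s) \<longlongrightarrow> partial_deriv j h (x + axis j 0)) (at 0)"
        using D[of x 0] unfolding DERIV_def .
      moreover have ax0: "axis j (0::real) = 0"
        by (simp add: vec_eq_iff axis_def)
      moreover have "filterlim t (at 0) sequentially"
        using t0 t by (auto simp: filterlim_at less_imp_neq[symmetric])
      ultimately show "(\<lambda>n. q n x) \<longlonglongrightarrow> partial_deriv j h x"
        unfolding q_def by (auto dest: filterlim_compose)
    qed
    show "AE x in Omega. norm (q n x) \<le> B" for n
    proof (rule AE_I2)
      fix x assume "x \<in> space Omega"
      then have x: "x \<in> cbox 0 1"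
        by (simp add: space_restrict_space)
      have ax0: "axis j (0::real) = 0"
        by (simp add: vec_eq_iff axis_def)
      obtain z where z: "0 < z" "z < t n" "h (x + axis j (t n)) - h (x + axis j 0) = (t n - 0) * partial_deriv j h (x + axis j z)"
        using MVT2[of 0 "t n" "\<lambda>s. h (x + axis j s)" "\<lambda>s. partial_deriv j h (x + axis j s)"] t D by auto
      have "x + axis j z \<in> cbox 0 2"
        using x z t(2)[of n] by (auto simp: mem_box_cart axis_def) (smt (verit))+
      then show "norm (q n x) \<le> B"
        using B z t[of n] by (simp add: q_def ax0)
    qed
  qed
  then show ?thesis
    unfolding q0 by (simp add: LIMSEQ_const_iff)
qed

text \<open>Real and imaginary parts of a mode in one family, because test functions are
  real-valued. The family is closed under partial derivatives, which yields smoothness by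
  induction.\<close>

definition wave :: "real \<Rightarrow> real \<Rightarrow> int^3 \<Rightarrow> scalar_field" where
  "wave a b k x = a * Re (ek k x) + b * Im (ek k x)"

lemma wave_has_derivative:
  "(wave a b k has_derivative (\<lambda>h. 2 * pi * (\<Sum>j\<in>UNIV. real_of_int (k $ j) * h $ j) * (b * Re (ek k x) - a * Im (ek k x)))) (at x)"
  unfolding wave_def ek_def cis.sel
  by (auto intro!: derivative_eq_intros bounded_linear.has_derivative[OF bounded_linear_vec_nth] simp: algebra_simps)

lemma partial_deriv_eqI: "(f has_derivative f') (at x) \<Longrightarrow> partial_deriv j f x = f' (axis j 1)"
  unfolding partial_deriv_def by (metis frechet_derivative_at)

lemma partial_deriv_wave:
  "partial_deriv j (wave a b k) = wave (2 * pi * real_of_int (k $ j) * b) (- (2 * pi * real_of_int (k $ j) * a)) k"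
proof
  fix x
  have "(\<Sum>i\<in>UNIV. real_of_int (k $ i) * axis j 1 $ i) = real_of_int (k $ j)"
    by (simp add: axis_def if_distrib cong: if_cong)
  then show "partial_deriv j (wave a b k) x = wave (2 * pi * real_of_int (k $ j) * b) (- (2 * pi * real_of_int (k $ j) * a)) k x"
    by (simp add: partial_deriv_eqI[OF wave_has_derivative] wave_def algebra_simps)
qed

lemma wave_differentiable: "wave a b k differentiable (at x)"
  unfolding differentiable_def by (rule exI, rule wave_has_derivative)

lemma wave_continuous: "continuous_on S (wave a b k)"
  unfolding wave_def by (intro continuous_intros)

lemma Ck_wave: "Ck n (wave a b k)"
  by (induction n arbitrary: a b) (auto simp: wave_continuous wave_differentiable partial_deriv_wave)

lemma periodic_wave: "periodic (wave a b k)"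
  using periodic_ek by (simp add: periodic_def wave_def)

lemma test_function_wave: "test_function (wave a b k)"
  by (simp add: test_function_def Ck_wave periodic_wave)

lemma wave_L2: "wave a b k \<in> L2"
  by (intro L2_continuous periodic_wave wave_continuous)

lemma fourier_coeff_wave:
  assumes "f \<in> L2"
  shows "fourier_coeff f k = Complex (LINT x|Omega. f x * wave 1 0 k x) (- (LINT x|Omega. f x * wave 0 1 k x))"
proof -
  have i: "integrable Omega (\<lambda>x. cx f x * cnj (ek k x))"
    by (intro integrable_fc L2_cx assms)
  have "Re (fourier_coeff f k) = (LINT x|Omega. f x * wave 1 0 k x)"
    unfolding fourier_coeff_ek by (subst integral_Re[OF i, symmetric]) (simp add: wave_def)
  moreover have "Im (fourier_coeff f k) = (LINT x|Omega. - (f x * wave 0 1 k x))"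
    unfolding fourier_coeff_ek by (subst integral_Im[OF i, symmetric]) (simp add: wave_def)
  ultimately show ?thesis
    by (simp add: complex_eq_iff)
qed

text \<open>The Fourier symbol of the partial derivative in direction \<open>j\<close>.\<close>

abbreviation dsym :: "3 \<Rightarrow> int^3 \<Rightarrow> complex" where
  "dsym j k \<equiv> \<i> * complex_of_real (2 * pi * real_of_int (k $ j))"

text \<open>Integration by parts against waves is the only input, so that weak derivatives and
  classical derivatives of test functions are treated at once.\<close>

lemma fourier_coeff_deriv:
  assumes f: "f \<in> L2" and g: "g \<in> L2"
    and ibp: "\<And>a b. (LINT x|Omega. f x * partial_deriv j (wave a b k) x) = - (LINT x|Omega. g x * wave a b k x)"
  shows "fourier_coeff g k = dsym j k * fourier_coeff f k"
proof -
  let ?c = "2 * pi * real_of_int (k $ j)"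
  have "(LINT x|Omega. f x * wave 0 (- ?c) k x) = (LINT x|Omega. (- ?c) * (f x * wave 0 1 k x))"
    by (intro Bochner_Integration.integral_cong) (auto simp: wave_def)
  then have 1: "(LINT x|Omega. g x * wave 1 0 k x) = ?c * (LINT x|Omega. f x * wave 0 1 k x)"
    using ibp[of 1 0] by (simp add: partial_deriv_wave)
  have "(LINT x|Omega. f x * wave ?c 0 k x) = (LINT x|Omega. ?c * (f x * wave 1 0 k x))"
    by (intro Bochner_Integration.integral_cong) (auto simp: wave_def)
  then have 2: "(LINT x|Omega. g x * wave 0 1 k x) = - ?c * (LINT x|Omega. f x * wave 1 0 k x)"
    using ibp[of 0 1] by (simp add: partial_deriv_wave)
  show ?thesis
    unfolding fourier_coeff_wave[OF f] fourier_coeff_wave[OF g] 1 2 by (simp add: complex_eq_iff)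
qed

lemma is_weak_deriv_fourier:
  "f \<in> L2 \<Longrightarrow> is_weak_deriv j f g \<Longrightarrow> fourier_coeff g k = dsym j k * fourier_coeff f k"
  by (rule fourier_coeff_deriv) (auto simp: is_weak_deriv_def test_function_wave)

lemma test_functionD:
  assumes "test_function \<phi>"
  shows "periodic \<phi>" "\<phi> differentiable (at x)" "continuous_on UNIV \<phi>" "continuous_on UNIV (partial_deriv j \<phi>)"
proof -
  have "Ck (Suc 0) \<phi>" "Ck 0 \<phi>"
    using assms unfolding test_function_def by blast+
  then show "\<phi> differentiable (at x)" "continuous_on UNIV \<phi>" "continuous_on UNIV (partial_deriv j \<phi>)"
    by auto
  show "periodic \<phi>"
    using assms by (simp add: test_function_def)
qed

lemma periodic_partial_deriv:
  assumes per: "periodic f" and diff: "\<And>x. f differentiable (at x)"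
  shows "periodic (partial_deriv j f)"
  unfolding periodic_def
proof (intro allI)
  fix x i
  let ?a = "axis i 1 :: real^3"
  have "(f has_derivative frechet_derivative f (at (x + ?a))) (at (x + ?a))"
    using diff by (simp add: frechet_derivative_works[symmetric])
  then have "((\<lambda>x. f (x + ?a)) has_derivative (\<lambda>h. frechet_derivative f (at (x + ?a)) h)) (at x)"
    by (rule has_derivative_compose[rotated]) (auto intro!: derivative_eq_intros)
  moreover have "(\<lambda>x. f (x + ?a)) = f"
    using per by (auto simp: periodic_def)
  ultimately show "partial_deriv j f (x + ?a) = partial_deriv j f x"
    using partial_deriv_eqI by (simp add: partial_deriv_def)
qed

text \<open>Integration by parts for smooth functions: the derivative of the product with a wave has
  integral zero.\<close>

lemma test_function_fourier:
  assumes \<phi>: "test_function \<phi>"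
  shows "\<phi> \<in> L2" "partial_deriv j \<phi> \<in> L2" "fourier_coeff (partial_deriv j \<phi>) k = dsym j k * fourier_coeff \<phi> k"
proof -
  note T = test_functionD[OF \<phi>]
  show L: "\<phi> \<in> L2"
    by (intro L2_continuous T)
  show L': "partial_deriv j \<phi> \<in> L2"
    by (intro L2_continuous T periodic_partial_deriv)
  show "fourier_coeff (partial_deriv j \<phi>) k = dsym j k * fourier_coeff \<phi> k"
  proof (rule fourier_coeff_deriv[OF L L'])
    fix a b
    let ?w = "wave a b k"
    let ?h = "\<lambda>x. \<phi> x * ?w x"
    have D: "(?h has_derivative (\<lambda>h. \<phi> x * frechet_derivative ?w (at x) h + frechet_derivative \<phi> (at x) h * ?w x)) (at x)" for x
      by (intro has_derivative_mult frechet_derivative_works[THEN iffD1] T wave_differentiable)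
    have pd: "partial_deriv j ?h = (\<lambda>x. \<phi> x * partial_deriv j ?w x + partial_deriv j \<phi> x * ?w x)"
      using partial_deriv_eqI[OF D] by (auto simp: partial_deriv_def)
    have "(LINT x|Omega. partial_deriv j ?h x) = 0"
    proof (rule integral_partial_deriv_zero)
      show "periodic ?h"
        using T(1) periodic_wave by (simp add: periodic_def)
      show "?h differentiable (at x)" for x
        using D by (auto simp: differentiable_def)
      show "continuous_on UNIV (partial_deriv j ?h)"
        unfolding pd partial_deriv_wave by (intro continuous_intros T wave_continuous)
    qed
    then show "(LINT x|Omega. \<phi> x * partial_deriv j ?w x) = - (LINT x|Omega. partial_deriv j \<phi> x * ?w x)"
      unfolding pd partial_deriv_wave
      by (subst (asm) Bochner_Integration.integral_add) (auto intro!: L2_integrable_mult L L' wave_L2)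
  qed
qed

text \<open>Nothing is known about the choice made by \<open>wd\<close> until a weak derivative is
  shown to exist. Riesz-Fischer builds a candidate from the multiplied coefficients, and Parseval
  checks it against every test function; any other choice has the same coefficients.\<close>

theorem wd_fourier:
  assumes f: "f \<in> L2" and s: "(\<lambda>k. (cmod (dsym j k * fourier_coeff f k))\<^sup>2) summable_on UNIV"
  shows "is_weak_deriv j f (wd j f)" "wd j f \<in> L2" "fourier_coeff (wd j f) k = dsym j k * fourier_coeff f k"
proof -
  have herm: "dsym j (- k) * fourier_coeff f (- k) = cnj (dsym j k * fourier_coeff f k)" for k
    by (simp add: fourier_coeff_uminus)
  obtain g where g: "g \<in> L2" "\<And>k. fourier_coeff g k = dsym j k * fourier_coeff f k"
    using riesz_fischer_real[of "\<lambda>k. dsym j k * fourier_coeff f k", OF s herm]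
    by (elim exE conjE) (rule that, auto)
  have "is_weak_deriv j f g"
    unfolding is_weak_deriv_def
  proof (intro conjI allI impI)
    fix \<phi> assume "test_function \<phi>"
    note T = test_function_fourier[OF this]
    have "((\<lambda>k. - Re (fourier_coeff g k * cnj (fourier_coeff \<phi> k))) has_sum - (LINT x|Omega. g x * \<phi> x)) UNIV"
      by (intro has_sum_uminusI parseval_real g T)
    moreover have "- Re (fourier_coeff g k * cnj (fourier_coeff \<phi> k))
       = Re (fourier_coeff f k * cnj (fourier_coeff (partial_deriv j \<phi>) k))" for k
      by (simp add: g(2) T(3) algebra_simps)
    ultimately have "((\<lambda>k. Re (fourier_coeff f k * cnj (fourier_coeff (partial_deriv j \<phi>) k)))
        has_sum - (LINT x|Omega. g x * \<phi> x)) UNIV"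
      by simp
    with parseval_real[OF f T(2)] show "(LINT x|Omega. f x * partial_deriv j \<phi> x) = - (LINT x|Omega. g x * \<phi> x)"
      by (rule has_sum_unique)
  qed (rule g)
  then show wd: "is_weak_deriv j f (wd j f)"
    unfolding wd_def by (rule someI[of "is_weak_deriv j f"])
  then show "wd j f \<in> L2"
    by (simp add: is_weak_deriv_def)
  show "fourier_coeff (wd j f) k = dsym j k * fourier_coeff f k"
    using is_weak_deriv_fourier[OF f wd] .
qed

section \<open>Products in Sobolev spaces\<close>

text \<open>The Fourier symbol of the identity minus the Laplacian; \<open>sobolev_weight s\<close>
  is its power \<open>s\<close>.\<close>

definition W :: "int^3 \<Rightarrow> real" where
  "W k = 1 + 4 * pi\<^sup>2 * (\<Sum>j\<in>UNIV. (real_of_int (k $ j))\<^sup>2)"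

lemma W_ge_1: "W k \<ge> 1"
  by (simp add: W_def sum_nonneg)

lemma W_pos: "W k > 0" and W_nonneg: "W k \<ge> 0"
  using W_ge_1[of k] by linarith+

lemma sobolev_weight_1: "sobolev_weight 1 k = W k"
  and sobolev_weight_2: "sobolev_weight 2 k = (W k)\<^sup>2"
  and sobolev_weight_3: "sobolev_weight 3 k = (W k) ^ 3"
  using W_ge_1[of k] by (simp_all add: sobolev_weight_def W_def[symmetric] powr_numeral)

lemma norm_dsym: "(cmod (dsym j k))\<^sup>2 = 4 * pi\<^sup>2 * (real_of_int (k $ j))\<^sup>2"
  by (simp add: norm_mult power_mult_distrib)

lemma sum_norm_dsym: "(\<Sum>j\<in>UNIV. (cmod (dsym j k))\<^sup>2) = W k - 1"
  unfolding norm_dsym by (simp add: W_def sum_distrib_left)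

lemma norm_dsym_le: "(cmod (dsym j k))\<^sup>2 \<le> W k"
proof -
  have "(cmod (dsym j k))\<^sup>2 \<le> (\<Sum>j\<in>UNIV. (cmod (dsym j k))\<^sup>2)"
    by (rule member_le_sum) auto
  then show ?thesis
    unfolding sum_norm_dsym by simp
qed

text \<open>Peetre's inequality, from the bound of the square of a sum by twice the sum of the
  squares. It transfers a weight on a convolution to the two factors.\<close>

lemma W_peetre: "W k \<le> 2 * (W l * W (k - l))"
proof -
  define S where "S k = 4 * pi\<^sup>2 * (\<Sum>j\<in>UNIV. (real_of_int (k $ j))\<^sup>2)" for k :: "int^3"
  have S0: "S k \<ge> 0" for k
    by (simp add: S_def sum_nonneg)
  have "(real_of_int (k $ j))\<^sup>2 \<le> 2 * ((real_of_int (l $ j))\<^sup>2 + (real_of_int ((k - l) $ j))\<^sup>2)" for j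
    using sum_squares_bound[of "real_of_int (l $ j)" "real_of_int (k $ j) - real_of_int (l $ j)"]
    by (simp add: power2_eq_square algebra_simps)
  then have "(\<Sum>j\<in>UNIV. (real_of_int (k $ j))\<^sup>2) \<le> (\<Sum>j\<in>UNIV. 2 * ((real_of_int (l $ j))\<^sup>2 + (real_of_int ((k - l) $ j))\<^sup>2))"
    by (intro sum_mono)
  then have "4 * pi\<^sup>2 * (\<Sum>j\<in>UNIV. (real_of_int (k $ j))\<^sup>2) \<le> 4 * pi\<^sup>2 * (\<Sum>j\<in>UNIV. 2 * ((real_of_int (l $ j))\<^sup>2 + (real_of_int ((k - l) $ j))\<^sup>2))"
    by (intro mult_left_mono) auto
  also have "\<dots> = 2 * (S l + S (k - l))"
    by (simp add: S_def sum.distrib sum_distrib_left[symmetric] ring_distribs)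
  finally have "S k \<le> 2 * (S l + S (k - l))"
    by (simp add: S_def)
  moreover have "0 \<le> S l * S (k - l)"
    using S0 by simp
  moreover have "W k = 1 + S k" for k
    by (simp add: W_def S_def)
  ultimately show ?thesis
    by (simp add: algebra_simps)
qed

section \<open>The lattice sum in dimension three\<close>

lemma summable_on_int_powr: "(\<lambda>n::int. (1 + (real_of_int n)\<^sup>2) powr (-2/3)) summable_on UNIV"
proof -
  let ?f = "\<lambda>n::int. (1 + (real_of_int n)\<^sup>2) powr (-2/3)"
  have "summable (\<lambda>n. real n powr (-4/3))"
    by (simp add: summable_real_powr_iff)
  then have "summable (\<lambda>n::nat. (1 + (real n)\<^sup>2) powr (-2/3))"
  proof (rule summable_comparison_test_ev[rotated])
    show "\<forall>\<^sub>F n in sequentially. norm ((1 + (real n)\<^sup>2) powr (-2/3)) \<le> real n powr (-4/3)"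
    proof (rule eventually_sequentiallyI[of 1])
      fix n :: nat assume "1 \<le> n"
      then have "(1 + (real n)\<^sup>2) powr (-2/3) \<le> ((real n)\<^sup>2) powr (-2/3)"
        by (intro powr_mono2') auto
      also have "((real n)\<^sup>2) powr (-2/3) = (real n powr 2) powr (-2/3)"
        using \<open>1 \<le> n\<close> by (simp add: powr_numeral)
      also have "\<dots> = real n powr (-4/3)"
        by (simp only: powr_powr) simp
      finally show "norm ((1 + (real n)\<^sup>2) powr (-2/3)) \<le> real n powr (-4/3)"
        by simp
    qed
  qed
  then have nat: "(\<lambda>n::nat. (1 + (real n)\<^sup>2) powr (-2/3)) summable_on UNIV"
    by (intro norm_summable_imp_summable_on) simp
  have "?f summable_on range int"
    by (subst summable_on_reindex) (use nat in \<open>auto simp: o_def\<close>)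
  moreover have "?f summable_on range (\<lambda>n. - int n)"
    by (subst summable_on_reindex) (use nat in \<open>auto simp: o_def inj_on_def\<close>)
  moreover have "range int \<union> range (\<lambda>n. - int n) = UNIV"
    by (auto, metis int_cases2 rangeI)
  ultimately show ?thesis
    using summable_on_union by metis
qed

text \<open>\<open>1 / (W k)^2\<close> is shared equally among the three coordinates, which explains
  the exponent 2/3: each factor then decays like the power -4/3 of one integer, still
  summable.\<close>

lemma W_powr_bound: "1 / (W k)\<^sup>2 \<le> (\<Prod>j\<in>UNIV. (1 + (real_of_int (k $ j))\<^sup>2) powr (-2/3))"
proof -
  have le: "1 + (real_of_int (k $ j))\<^sup>2 \<le> W k" for j
  proof -
    have "(real_of_int (k $ j))\<^sup>2 \<le> 4 * pi\<^sup>2 * (real_of_int (k $ j))\<^sup>2"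
    proof -
      have "1 * 1 \<le> pi * pi"
        using pi_gt3 by (intro mult_mono) auto
      then have "1 * (real_of_int (k $ j))\<^sup>2 \<le> 4 * pi\<^sup>2 * (real_of_int (k $ j))\<^sup>2"
        by (intro mult_right_mono) (auto simp: power2_eq_square)
      then show ?thesis by simp
    qed
    also have "\<dots> \<le> 4 * pi\<^sup>2 * (\<Sum>j\<in>UNIV. (real_of_int (k $ j))\<^sup>2)"
      by (intro mult_left_mono member_le_sum) auto
    finally show ?thesis
      by (simp add: W_def)
  qed
  have p: "0 < 1 + (real_of_int (k $ j))\<^sup>2" for j
    by (simp add: add_pos_nonneg)
  have "1 / (W k)\<^sup>2 = W k powr (-2)"
    using W_pos[of k] by (simp add: powr_minus powr_numeral divide_inverse)
  also have "\<dots> = (\<Prod>j\<in>(UNIV::3 set). W k powr (-2/3))"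
    using W_pos[of k] by (simp add: powr_realpow[symmetric] powr_powr)
  also have "\<dots> \<le> (\<Prod>j\<in>UNIV. (1 + (real_of_int (k $ j))\<^sup>2) powr (-2/3))"
    using le p by (intro prod_mono) (auto intro!: powr_mono2')
  finally show ?thesis .
qed

text \<open>A finite set of frequencies lies in the product of its coordinate projections, and over
  a product the bound of \<open>W_powr_bound\<close> factorizes into three one-dimensional
  sums.\<close>

theorem summable_W: "(\<lambda>k. 1 / (W k)\<^sup>2) summable_on UNIV"
proof -
  let ?g = "\<lambda>n::int. (1 + (real_of_int n)\<^sup>2) powr (-2/3)"
  have bound: "(\<Sum>k\<in>F. 1 / (W k)\<^sup>2) \<le> (infsum ?g UNIV) ^ 3" if F: "finite F" for F
  proof -
    define G where "G j = (\<lambda>k. k $ j) ` F" for j :: 3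
    have G: "finite (G j)" for j
      by (simp add: G_def F)
    let ?P = "PiE UNIV G"
    have FP: "F \<subseteq> (\<lambda>p. \<chi> j. p j) ` ?P"
    proof
      fix k assume "k \<in> F"
      then have "(\<lambda>j. k $ j) \<in> ?P"
        by (auto simp: G_def)
      then show "k \<in> (\<lambda>p. \<chi> j. p j) ` ?P"
        by (rule rev_image_eqI) (simp add: vec_eq_iff)
    qed
    have finP: "finite ?P"
      by (intro finite_PiE G) auto
    have "(\<Sum>k\<in>F. 1 / (W k)\<^sup>2) \<le> (\<Sum>k\<in>(\<lambda>p. \<chi> j. p j) ` ?P. 1 / (W k)\<^sup>2)"
      using finP by (intro sum_mono2 FP) auto
    also have "\<dots> = (\<Sum>p\<in>?P. 1 / (W (\<chi> j. p j))\<^sup>2)"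
      by (subst sum.reindex) (auto simp: inj_on_def vec_eq_iff)
    also have "\<dots> \<le> (\<Sum>p\<in>?P. \<Prod>j\<in>UNIV. ?g (p j))"
      by (intro sum_mono order_trans[OF W_powr_bound]) simp
    also have "\<dots> = (\<Prod>j\<in>UNIV. \<Sum>n\<in>G j. ?g n)"
      using G by (intro prod_sum_PiE[symmetric]) auto
    also have "\<dots> \<le> (\<Prod>j\<in>(UNIV::3 set). infsum ?g UNIV)"
      by (intro prod_mono conjI sum_nonneg finite_sum_le_infsum summable_on_int_powr G) auto
    finally show ?thesis by simp
  qed
  show ?thesis
    by (rule nonneg_bdd_above_summable_on) (auto intro!: bdd_aboveI2 bound)
qed

definition CW :: real where "CW = (\<Sum>\<^sub>\<infinity>k. 1 / (W k)\<^sup>2)"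

lemma sum_W_le: "finite F \<Longrightarrow> (\<Sum>k\<in>F. 1 / (W k)\<^sup>2) \<le> CW"
  unfolding CW_def by (rule finite_sum_le_infsum[OF summable_W]) auto

lemma CW_nonneg: "CW \<ge> 0"
  using sum_W_le[of "{}"] by simp

text \<open>Cauchy-Schwarz with the weights \<open>1 / (W l * W (k - l))\<close>, whose sum over \<open>l\<close> is at most \<open>CW\<close>
  for every \<open>k\<close>.  This plays the role of the embedding of \<open>H\<^sup>1\<close> into \<open>L\<^sup>4\<close>.\<close>

lemma convolution_bound:
  fixes a b :: "int^3 \<Rightarrow> real"
  assumes a0: "\<And>k. a k \<ge> 0" and b0: "\<And>k. b k \<ge> 0"
    and a: "(\<lambda>k. W k * (a k)\<^sup>2) summable_on UNIV" and b: "(\<lambda>k. W k * (b k)\<^sup>2) summable_on UNIV"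
  shows "(\<lambda>l. a l * b (k - l)) summable_on UNIV"
    and "(\<lambda>k. (\<Sum>\<^sub>\<infinity>l. a l * b (k - l))\<^sup>2) summable_on UNIV"
    and "(\<Sum>\<^sub>\<infinity>k. (\<Sum>\<^sub>\<infinity>l. a l * b (k - l))\<^sup>2)
      \<le> CW * ((\<Sum>\<^sub>\<infinity>k. W k * (a k)\<^sup>2) * (\<Sum>\<^sub>\<infinity>k. W k * (b k)\<^sup>2))"
proof -
  define A where "A = (\<Sum>\<^sub>\<infinity>k. W k * (a k)\<^sup>2)"
  define B where "B = (\<Sum>\<^sub>\<infinity>k. W k * (b k)\<^sup>2)"
  \<comment> \<open>The square of the product with both weights. Its sum over \<open>k\<close> for
    fixed \<open>l\<close> is explicit by translation; its sum over \<open>l\<close> for fixed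
    \<open>k\<close> is what Cauchy-Schwarz leaves in the convolution.\<close>
  define p where "p l k = (W l * (a l)\<^sup>2) * (W (k - l) * (b (k - l))\<^sup>2)" for l k
  have p0: "p l k \<ge> 0" for l k
    by (simp add: p_def W_nonneg)
  have shift: "((\<lambda>k. W (k - l) * (b (k - l))\<^sup>2) has_sum B) UNIV" for l
  proof -
    have "((\<lambda>k. W k * (b k)\<^sup>2) has_sum B) UNIV"
      using b by (simp add: B_def)
    then show ?thesis
      by (subst has_sum_reindex_bij_witness[of _ "\<lambda>k. k + l" "\<lambda>k. k - l" UNIV "\<lambda>k. W k * (b k)\<^sup>2"]) auto
  qed
  have row: "((\<lambda>k. p l k) has_sum (W l * (a l)\<^sup>2) * B) UNIV" for l
    unfolding p_def by (intro has_sum_cmult_right shift)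
  have sg: "(\<lambda>l. (W l * (a l)\<^sup>2) * B) summable_on UNIV"
    by (intro summable_on_cmult_left a)
  have sp: "(\<lambda>(l, k). p l k) summable_on UNIV \<times> UNIV"
    by (rule summable_on_SigmaI[OF _ sg]) (use row p0 in auto)
  \<comment> \<open>The rows are known and the columns are wanted: joint summability of a
    nonnegative family allows the exchange and gives the column sums \<open>P\<close> the total
    \<open>A * B\<close>.\<close>
  then have sp': "(\<lambda>(k, l). p l k) summable_on UNIV \<times> UNIV"
    by (subst summable_on_swap) simp
  have col: "(\<lambda>l. p l k) summable_on UNIV" for k
    using summable_on_SigmaD1[OF sp', of k] by simp
  define P where "P k = (\<Sum>\<^sub>\<infinity>l. p l k)" for k
  have P0: "P k \<ge> 0" for k
    unfolding P_def by (intro infsum_nonneg p0)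
  have "infsum (\<lambda>(l, k). p l k) (UNIV \<times> UNIV) = (\<Sum>\<^sub>\<infinity>l. (W l * (a l)\<^sup>2) * B)"
    using infsum_Sigma'_banach[OF sp] by (simp add: infsumI[OF row])
  also have "\<dots> = A * B"
    unfolding A_def by (rule infsum_cmult_left) (use a in auto)
  finally have "((\<lambda>(l, k). p l k) has_sum A * B) (UNIV \<times> UNIV)"
    using sp by (metis has_sum_infsum)
  then have "((\<lambda>(k, l). p l k) has_sum A * B) (UNIV \<times> UNIV)"
    by (subst has_sum_swap) simp
  then have P: "(P has_sum A * B) UNIV"
    by (rule has_sum_SigmaD) (use col in \<open>auto simp: P_def\<close>)
  have fin: "(\<Sum>l\<in>F. a l * b (k - l)) \<le> sqrt (CW * P k)" if F: "finite F" for F k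
  proof -
    have "(\<Sum>l\<in>F. a l * b (k - l))\<^sup>2 =
      (\<Sum>l\<in>F. 1 / sqrt (W l * W (k - l)) * (sqrt (W l * W (k - l)) * (a l * b (k - l))))\<^sup>2"
      using W_pos by (intro arg_cong[of _ _ "\<lambda>x. x\<^sup>2"] sum.cong) (auto simp: less_imp_neq[symmetric])
    also have "\<dots> \<le> (\<Sum>l\<in>F. (1 / sqrt (W l * W (k - l)))\<^sup>2) * (\<Sum>l\<in>F. (sqrt (W l * W (k - l)) * (a l * b (k - l)))\<^sup>2)"
      by (rule Cauchy_Schwarz_ineq_sum)
    also have "(\<Sum>l\<in>F. (sqrt (W l * W (k - l)) * (a l * b (k - l)))\<^sup>2) = (\<Sum>l\<in>F. p l k)"
      using W_nonneg by (intro sum.cong) (auto simp: p_def power_mult_distrib)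
    \<comment> \<open>The arithmetic-geometric mean inequality separates the two weights. Both
      halves are sums of \<open>1 / W^2\<close> over distinct frequencies, so \<open>CW\<close>
      bounds their average for every \<open>k\<close>.\<close>
    also have "(\<Sum>l\<in>F. (1 / sqrt (W l * W (k - l)))\<^sup>2) \<le> (\<Sum>l\<in>F. (1 / (W l)\<^sup>2 + 1 / (W (k - l))\<^sup>2) / 2)"
    proof (rule sum_mono)
      fix l
      have "(1 / sqrt (W l * W (k - l)))\<^sup>2 = 1 / W l * (1 / W (k - l))"
        using W_nonneg by (simp add: power_divide)
      also have "\<dots> \<le> ((1 / W l)\<^sup>2 + (1 / W (k - l))\<^sup>2) / 2"
        using sum_squares_bound[of "1 / W l" "1 / W (k - l)"] by simp
      finally show "(1 / sqrt (W l * W (k - l)))\<^sup>2 \<le> (1 / (W l)\<^sup>2 + 1 / (W (k - l))\<^sup>2) / 2"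
        by (simp add: power_divide)
    qed
    also have "\<dots> = ((\<Sum>l\<in>F. 1 / (W l)\<^sup>2) + (\<Sum>l\<in>F. 1 / (W (k - l))\<^sup>2)) / 2"
      by (simp add: sum_divide_distrib[symmetric] sum.distrib)
    also have "(\<Sum>l\<in>F. 1 / (W (k - l))\<^sup>2) = (\<Sum>m\<in>(\<lambda>l. k - l) ` F. 1 / (W m)\<^sup>2)"
      by (subst sum.reindex) (auto simp: inj_on_def)
    also have "((\<Sum>l\<in>F. 1 / (W l)\<^sup>2) + (\<Sum>m\<in>(\<lambda>l. k - l) ` F. 1 / (W m)\<^sup>2)) / 2 \<le> CW"
      using sum_W_le[OF F] sum_W_le[of "(\<lambda>l. k - l) ` F"] F by simp
    also have "(\<Sum>l\<in>F. p l k) \<le> P k"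
      unfolding P_def by (rule finite_sum_le_infsum[OF col F]) (auto simp: p0)
    finally have "(\<Sum>l\<in>F. a l * b (k - l))\<^sup>2 \<le> CW * P k"
      using p0 CW_nonneg by (simp add: mult_right_mono mult_left_mono sum_nonneg)
    then show ?thesis
      by (rule real_le_rsqrt)
  qed
  show s: "(\<lambda>l. a l * b (k - l)) summable_on UNIV" for k
    by (rule nonneg_bdd_above_summable_on) (auto intro!: bdd_aboveI2 fin simp: a0 b0)
  have le: "(\<Sum>\<^sub>\<infinity>l. a l * b (k - l))\<^sup>2 \<le> CW * P k" for k
  proof -
    have "(\<Sum>\<^sub>\<infinity>l. a l * b (k - l)) \<le> sqrt (CW * P k)"
      by (rule infsum_le_finite_sums[OF s]) (rule fin)
    moreover have "(\<Sum>\<^sub>\<infinity>l. a l * b (k - l)) \<ge> 0"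
      by (intro infsum_nonneg) (simp add: a0 b0)
    ultimately have "(\<Sum>\<^sub>\<infinity>l. a l * b (k - l))\<^sup>2 \<le> (sqrt (CW * P k))\<^sup>2"
      by (intro power_mono)
    then show ?thesis
      using CW_nonneg P0 by simp
  qed
  have CP: "((\<lambda>k. CW * P k) has_sum CW * (A * B)) UNIV"
    by (intro has_sum_cmult_right P)
  then show s2: "(\<lambda>k. (\<Sum>\<^sub>\<infinity>l. a l * b (k - l))\<^sup>2) summable_on UNIV"
    by (intro summable_on_comparison_test[OF has_sum_imp_summable[OF CP]] le) auto
  have "(\<Sum>\<^sub>\<infinity>k. (\<Sum>\<^sub>\<infinity>l. a l * b (k - l))\<^sup>2) \<le> (\<Sum>\<^sub>\<infinity>k. CW * P k)"
    by (intro infsum_mono s2 has_sum_imp_summable[OF CP] le)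
  also have "\<dots> = CW * (A * B)"
    using CP by (rule infsumI)
  finally show "(\<Sum>\<^sub>\<infinity>k. (\<Sum>\<^sub>\<infinity>l. a l * b (k - l))\<^sup>2)
      \<le> CW * ((\<Sum>\<^sub>\<infinity>k. W k * (a k)\<^sup>2) * (\<Sum>\<^sub>\<infinity>k. W k * (b k)\<^sup>2))"
    by (simp add: A_def B_def)
qed

text \<open>Parseval for \<open>f\<close> against \<open>g\<close> times \<open>ek k\<close>; as
  \<open>g\<close> is real, the conjugated coefficients of that product are the coefficients of
  \<open>g\<close> at \<open>k - l\<close>.\<close>

lemma fourier_coeff_mult:
  assumes f: "f \<in> L2" and g: "g \<in> L2"
  shows "((\<lambda>l. fourier_coeff f l * fourier_coeff g (k - l)) has_sum fourier_coeff (\<lambda>x. f x * g x) k) UNIV"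
proof -
  let ?G = "\<lambda>x. cx g x * ek k x"
  have G: "?G \<in> L2c"
    by (intro L2c_mult_ek L2_cx g)
  have "cnj (fc ?G l) = fourier_coeff g (k - l)" for l
  proof -
    have "cnj (fc ?G l) = (LINT x|Omega. cnj (cx g x * ek k x * cnj (ek l x)))"
      unfolding fc_def by (rule Bochner_Integration.integral_cnj[symmetric])
    also have "\<dots> = fourier_coeff g (k - l)"
      unfolding fourier_coeff_ek by (simp add: ek_diff mult.assoc)
    finally show ?thesis .
  qed
  moreover have "(LINT x|Omega. cx f x * cnj (?G x)) = fourier_coeff (\<lambda>x. f x * g x) k"
    unfolding fourier_coeff_ek by (simp add: mult.assoc)
  ultimately show ?thesis
    using parseval[OF L2_cx[OF f] G] by (simp add: fourier_coeff_fc)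
qed

lemma fourier_coeff_mult_le:
  assumes f: "f \<in> L2" and g: "g \<in> L2"
    and s: "(\<lambda>l. cmod (fourier_coeff f l) * cmod (fourier_coeff g (k - l))) summable_on UNIV"
  shows "cmod (fourier_coeff (\<lambda>x. f x * g x) k)
    \<le> (\<Sum>\<^sub>\<infinity>l. cmod (fourier_coeff f l) * cmod (fourier_coeff g (k - l)))"
  by (rule norm_has_sum_bound[OF _ fourier_coeff_mult[OF f g]])
    (use s in \<open>simp add: norm_mult\<close>)

section \<open>Scalar Sobolev spaces: products, boundedness, derivatives\<close>

definition sob :: "real \<Rightarrow> scalar_field \<Rightarrow> real" where
  "sob s f = (\<Sum>\<^sub>\<infinity>k. sobolev_weight s k * (cmod (fourier_coeff f k))\<^sup>2)"

lemma sobolev_weight_eq: "sobolev_weight s k = W k powr s"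
  by (simp add: sobolev_weight_def W_def)

lemma sobolev_weight_nonneg: "sobolev_weight s k \<ge> 0"
  by (simp add: sobolev_weight_eq)

lemma sob_nonneg: "sob s f \<ge> 0"
  unfolding sob_def by (intro infsum_nonneg mult_nonneg_nonneg sobolev_weight_nonneg) auto

lemma H_L2: "f \<in> H s \<Longrightarrow> f \<in> L2"
  by (simp add: H_def)

lemma H_summable: "f \<in> H s \<Longrightarrow> (\<lambda>k. sobolev_weight s k * (cmod (fourier_coeff f k))\<^sup>2) summable_on UNIV"
  by (simp add: H_def)

lemma H_mono:
  assumes "s \<le> t" "f \<in> H t"
  shows "f \<in> H s"
proof -
  have "sobolev_weight s k * (cmod (fourier_coeff f k))\<^sup>2 \<le> sobolev_weight t k * (cmod (fourier_coeff f k))\<^sup>2" for k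
    unfolding sobolev_weight_eq using assms W_ge_1 by (intro mult_right_mono powr_mono) auto
  then show ?thesis
    using assms(2) unfolding H_def
    by (auto intro: summable_on_comparison_test simp: sobolev_weight_nonneg)
qed

lemma sob_mono:
  assumes "s \<le> t" "f \<in> H t"
  shows "sob s f \<le> sob t f"
  unfolding sob_def
  by (intro infsum_mono H_summable H_mono[OF assms] assms mult_right_mono)
    (use assms(1) W_ge_1 in \<open>auto simp: sobolev_weight_eq intro: powr_mono\<close>)

text \<open>A priori the product is only integrable. Its coefficients are convolutions, square
  summable by \<open>convolution_bound\<close>; the square integrable function with these
  coefficients equals the product by uniqueness. The absolute versions in the last two conclusions
  justify the double series of the advection term.\<close>

theorem H1_mult_L2:
  assumes f: "f \<in> H 1" and g: "g \<in> H 1"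
  shows "(\<lambda>x. f x * g x) \<in> L2"
    and "(\<lambda>l. cmod (fourier_coeff f l) * cmod (fourier_coeff g (k - l))) summable_on UNIV"
    and "(\<lambda>k. (\<Sum>\<^sub>\<infinity>l. cmod (fourier_coeff f l) * cmod (fourier_coeff g (k - l)))\<^sup>2) summable_on UNIV"
proof -
  note fL = H_L2[OF f] and gL = H_L2[OF g]
  have W: "(\<lambda>k. W k * (cmod (fourier_coeff h k))\<^sup>2) summable_on UNIV" if "h \<in> H 1" for h
    using H_summable[OF that] by (simp add: sobolev_weight_1)
  note conv = convolution_bound[of "\<lambda>k. cmod (fourier_coeff f k)" "\<lambda>k. cmod (fourier_coeff g k)", OF _ _ W[OF f] W[OF g]]
  show s: "(\<lambda>l. cmod (fourier_coeff f l) * cmod (fourier_coeff g (k - l))) summable_on UNIV" for k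
    by (rule conv) auto
  show s2: "(\<lambda>k. (\<Sum>\<^sub>\<infinity>l. cmod (fourier_coeff f l) * cmod (fourier_coeff g (k - l)))\<^sup>2) summable_on UNIV"
    by (rule conv) auto
  let ?c = "fourier_coeff (\<lambda>x. f x * g x)"
  have le: "(cmod (?c k))\<^sup>2 \<le> (\<Sum>\<^sub>\<infinity>l. cmod (fourier_coeff f l) * cmod (fourier_coeff g (k - l)))\<^sup>2" for k
    by (intro power_mono fourier_coeff_mult_le fL gL s) auto
  have "(\<lambda>k. (cmod (?c k))\<^sup>2) summable_on UNIV"
    by (rule summable_on_comparison_test[OF s2]) (use le in auto)
  from riesz_fischer_real[OF this fourier_coeff_uminus]
  obtain h where h: "h \<in> L2" "\<And>k. fourier_coeff h k = ?c k"
    by (elim exE conjE) (rule that, assumption, auto)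
  have int: "integrable Omega (\<lambda>x. f x * g x)"
    by (intro L2_integrable_mult fL gL)
  have ae: "AE x in Omega. h x = f x * g x"
    by (intro fourier_coeff_inject L2_integrable h int)
  have "integrable Omega (\<lambda>x. (f x * g x)\<^sup>2)"
    by (rule integrable_cong_AE_imp[OF L2_square_integrable[OF h(1)]])
      (use ae borel_measurable_integrable[OF int] in \<open>auto elim: eventually_mono\<close>)
  then show "(\<lambda>x. f x * g x) \<in> L2"
    using int L2_periodic[OF fL] L2_periodic[OF gL] by (simp add: L2_def periodic_def borel_measurable_integrable)
qed

text \<open>Peetre's inequality puts the square root of \<open>W\<close> on each factor at the price
  of the constant 2; the convolution bound for the weighted coefficients \<open>a f\<close> and
  \<open>a g\<close> then involves exactly the \<open>H 2\<close> norms.\<close>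

theorem H2_mult_H1:
  assumes f: "f \<in> H 2" and g: "g \<in> H 2"
  shows "(\<lambda>x. f x * g x) \<in> H 1" "sob 1 (\<lambda>x. f x * g x) \<le> 2 * CW * (sob 2 f * sob 2 g)"
proof -
  note f1 = H_mono[of 1, OF _ f, simplified] and g1 = H_mono[of 1, OF _ g, simplified]
  define a where "a h k = sqrt (W k) * cmod (fourier_coeff h k)" for h k
  have a0: "a h k \<ge> 0" for h k
    by (simp add: a_def W_nonneg)
  have aW: "W k * (a h k)\<^sup>2 = sobolev_weight 2 k * (cmod (fourier_coeff h k))\<^sup>2" for h k
    using W_nonneg[of k] by (simp add: a_def power_mult_distrib sobolev_weight_2 power2_eq_square)
  have W: "(\<lambda>k. W k * (a h k)\<^sup>2) summable_on UNIV" if "h \<in> H 2" for h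
    unfolding aW using that by (rule H_summable)
  note conv = convolution_bound[of "a f" "a g", OF a0 a0 W[OF f] W[OF g]]
  let ?c = "fourier_coeff (\<lambda>x. f x * g x)"
  have le: "sobolev_weight 1 k * (cmod (?c k))\<^sup>2 \<le> 2 * (\<Sum>\<^sub>\<infinity>l. a f l * a g (k - l))\<^sup>2" for k
  proof -
    let ?s = "\<lambda>l. cmod (fourier_coeff f l) * cmod (fourier_coeff g (k - l))"
    have s: "?s summable_on UNIV"
      by (rule H1_mult_L2(2)[OF f1 g1])
    have "sqrt (W k) * cmod (?c k) \<le> sqrt (W k) * infsum ?s UNIV"
      by (intro mult_left_mono fourier_coeff_mult_le H_L2[OF f] H_L2[OF g] s) (simp add: W_nonneg)
    also have "\<dots> = (\<Sum>\<^sub>\<infinity>l. sqrt (W k) * ?s l)"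
      by (rule infsum_cmult_right[symmetric]) (use s in auto)
    also have "\<dots> \<le> (\<Sum>\<^sub>\<infinity>l. sqrt 2 * (a f l * a g (k - l)))"
    proof (rule infsum_mono)
      show "(\<lambda>l. sqrt (W k) * ?s l) summable_on UNIV" "(\<lambda>l. sqrt 2 * (a f l * a g (k - l))) summable_on UNIV"
        by (intro summable_on_cmult_right s conv)+
      fix l
      have "sqrt (W k) \<le> sqrt (2 * (W l * W (k - l)))"
        by (intro real_sqrt_le_mono W_peetre)
      also have "\<dots> = sqrt 2 * (sqrt (W l) * sqrt (W (k - l)))"
        by (simp add: real_sqrt_mult)
      finally have "sqrt (W k) * ?s l \<le> sqrt 2 * (sqrt (W l) * sqrt (W (k - l))) * ?s l"
        by (intro mult_right_mono) auto
      then show "sqrt (W k) * ?s l \<le> sqrt 2 * (a f l * a g (k - l))"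
        by (simp add: a_def mult_ac)
    qed
    also have "\<dots> = sqrt 2 * (\<Sum>\<^sub>\<infinity>l. a f l * a g (k - l))"
      by (rule infsum_cmult_right) (use conv(1) in auto)
    finally have "(sqrt (W k) * cmod (?c k))\<^sup>2 \<le> (sqrt 2 * (\<Sum>\<^sub>\<infinity>l. a f l * a g (k - l)))\<^sup>2"
      by (intro power_mono) (simp_all add: W_nonneg)
    then show ?thesis
      by (simp add: power_mult_distrib W_nonneg sobolev_weight_1)
  qed
  have s2: "(\<lambda>k. 2 * (\<Sum>\<^sub>\<infinity>l. a f l * a g (k - l))\<^sup>2) summable_on UNIV"
    by (intro summable_on_cmult_right conv)
  have s1: "(\<lambda>k. sobolev_weight 1 k * (cmod (?c k))\<^sup>2) summable_on UNIV"
    by (rule summable_on_comparison_test[OF s2]) (use le in \<open>auto simp: sobolev_weight_nonneg\<close>)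
  then show "(\<lambda>x. f x * g x) \<in> H 1"
    using H1_mult_L2(1)[OF f1 g1] by (simp add: H_def)
  have "sob 1 (\<lambda>x. f x * g x) \<le> (\<Sum>\<^sub>\<infinity>k. 2 * (\<Sum>\<^sub>\<infinity>l. a f l * a g (k - l))\<^sup>2)"
    unfolding sob_def by (intro infsum_mono s1 s2 le)
  also have "\<dots> = 2 * (\<Sum>\<^sub>\<infinity>k. (\<Sum>\<^sub>\<infinity>l. a f l * a g (k - l))\<^sup>2)"
    by (rule infsum_cmult_right) (use conv(2) in auto)
  also have "\<dots> \<le> 2 * (CW * (sob 2 f * sob 2 g))"
    using conv(3) unfolding aW sob_def by simp
  finally show "sob 1 (\<lambda>x. f x * g x) \<le> 2 * CW * (sob 2 f * sob 2 g)"
    by simp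
qed

text \<open>Sobolev embedding: Cauchy-Schwarz with the weights \<open>1 / W\<close> and
  \<open>W\<close> makes the coefficients absolutely summable.\<close>

theorem H2_bounded:
  assumes f: "f \<in> H 2"
  shows "AE x in Omega. \<bar>f x\<bar> \<le> sqrt (CW * sob 2 f)"
proof -
  have fin: "(\<Sum>k\<in>F. cmod (fourier_coeff f k)) \<le> sqrt (CW * sob 2 f)" if F: "finite F" for F
  proof -
    have "(\<Sum>k\<in>F. cmod (fourier_coeff f k))\<^sup>2 = (\<Sum>k\<in>F. 1 / W k * (W k * cmod (fourier_coeff f k)))\<^sup>2"
      using W_pos by (intro arg_cong[of _ _ "\<lambda>x. x\<^sup>2"] sum.cong) (auto simp: less_imp_neq[symmetric])
    also have "\<dots> \<le> (\<Sum>k\<in>F. (1 / W k)\<^sup>2) * (\<Sum>k\<in>F. (W k * cmod (fourier_coeff f k))\<^sup>2)"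
      by (rule Cauchy_Schwarz_ineq_sum)
    also have "\<dots> \<le> CW * sob 2 f"
    proof (rule mult_mono)
      show "(\<Sum>k\<in>F. (1 / W k)\<^sup>2) \<le> CW"
        using sum_W_le[OF F] by (simp add: power_divide)
      have "(\<Sum>k\<in>F. sobolev_weight 2 k * (cmod (fourier_coeff f k))\<^sup>2) \<le> sob 2 f"
        unfolding sob_def by (rule finite_sum_le_infsum[OF H_summable[OF f] F]) (auto simp: sobolev_weight_nonneg)
      then show "(\<Sum>k\<in>F. (W k * cmod (fourier_coeff f k))\<^sup>2) \<le> sob 2 f"
        by (simp add: sobolev_weight_2 power_mult_distrib)
    qed (auto simp: CW_nonneg sum_nonneg)
    finally show ?thesis
      by (rule real_le_rsqrt)
  qed
  have s: "(\<lambda>k. cmod (fourier_coeff f k)) summable_on UNIV"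
    by (rule nonneg_bdd_above_summable_on) (auto intro!: bdd_aboveI2 fin)
  have "(\<Sum>\<^sub>\<infinity>k. cmod (fourier_coeff f k)) \<le> sqrt (CW * sob 2 f)"
    by (rule infsum_le_finite_sums[OF s]) (rule fin)
  with AE_bound_fourier[OF H_L2[OF f] s] show ?thesis
    by (auto elim!: eventually_mono)
qed

theorem wd_H:
  assumes s: "s \<ge> 1" and f: "f \<in> H s"
  shows "wd j f \<in> H (s - 1)" "sob (s - 1) (wd j f) \<le> sob s f"
    "wd j f \<in> L2" "fourier_coeff (wd j f) k = dsym j k * fourier_coeff f k"
proof -
  have f1: "f \<in> H 1"
    by (rule H_mono[OF s f])
  have "(cmod (dsym j k * fourier_coeff f k))\<^sup>2 \<le> sobolev_weight 1 k * (cmod (fourier_coeff f k))\<^sup>2" for k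
    unfolding norm_mult[of "dsym j k" "fourier_coeff f k"] power_mult_distrib sobolev_weight_1
    by (intro mult_right_mono norm_dsym_le) auto
  then have "(\<lambda>k. (cmod (dsym j k * fourier_coeff f k))\<^sup>2) summable_on UNIV"
    by (intro summable_on_comparison_test[OF H_summable[OF f1]]) auto
  note wd = wd_fourier[OF H_L2[OF f] this]
  show "wd j f \<in> L2" "fourier_coeff (wd j f) k = dsym j k * fourier_coeff f k"
    by (rule wd)+
  have le: "sobolev_weight (s - 1) k * (cmod (fourier_coeff (wd j f) k))\<^sup>2
    \<le> sobolev_weight s k * (cmod (fourier_coeff f k))\<^sup>2" for k
  proof -
    have "sobolev_weight (s - 1) k * (cmod (dsym j k))\<^sup>2 \<le> sobolev_weight (s - 1) k * W k"
      by (intro mult_left_mono norm_dsym_le sobolev_weight_nonneg)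
    also have "\<dots> = sobolev_weight s k"
      using W_pos[of k] by (simp add: sobolev_weight_eq powr_diff)
    finally have "sobolev_weight (s - 1) k * (cmod (dsym j k))\<^sup>2 * (cmod (fourier_coeff f k))\<^sup>2
        \<le> sobolev_weight s k * (cmod (fourier_coeff f k))\<^sup>2"
      by (intro mult_right_mono) auto
    then show ?thesis
      unfolding wd(3) norm_mult[of "dsym j k" "fourier_coeff f k"] power_mult_distrib by (simp only: mult.assoc)
  qed
  have s1: "(\<lambda>k. sobolev_weight (s - 1) k * (cmod (fourier_coeff (wd j f) k))\<^sup>2) summable_on UNIV"
    by (intro summable_on_comparison_test[OF H_summable[OF f]] le) (auto simp: sobolev_weight_nonneg)
  then show "wd j f \<in> H (s - 1)"
    using wd(2) by (simp add: H_def)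
  show "sob (s - 1) (wd j f) \<le> sob s f"
    unfolding sob_def by (intro infsum_mono s1 H_summable[OF f] le)
qed

section \<open>Weighted inner products of vector fields\<close>

text \<open>The weight \<open>1\<close> gives the \<open>L\<^sup>2\<close> inner product, \<open>W - 1\<close> that of the gradients,
  \<open>sobolev_weight s\<close> that of \<open>H\<^sup>s\<close>.\<close>

definition Xv :: "(int^3 \<Rightarrow> real) \<Rightarrow> vector_field set" where
  "Xv m = {u. \<forall>i. component u i \<in> L2 \<and>
     (\<lambda>k. m k * (cmod (fourier_coeff (component u i) k))\<^sup>2) summable_on UNIV}"

definition vip :: "(int^3 \<Rightarrow> real) \<Rightarrow> vector_field \<Rightarrow> vector_field \<Rightarrow> real" where
  "vip m u v = (\<Sum>i\<in>UNIV. \<Sum>\<^sub>\<infinity>k. m k *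
     Re (fourier_coeff (component u i) k * cnj (fourier_coeff (component v i) k)))"

definition nrm :: "(int^3 \<Rightarrow> real) \<Rightarrow> vector_field \<Rightarrow> real" where
  "nrm m u = sqrt (vip m u u)"

lemma Re_mult_cnj_self: "Re (z * cnj z) = (cmod z)\<^sup>2"
  unfolding complex_norm_square[symmetric] by (rule Re_complex_of_real)

lemma Xv_L2: "u \<in> Xv m \<Longrightarrow> component u i \<in> L2"
  by (simp add: Xv_def)

lemma Xv_summable: "u \<in> Xv m \<Longrightarrow> (\<lambda>k. m k * (cmod (fourier_coeff (component u i) k))\<^sup>2) summable_on UNIV"
  by (simp add: Xv_def)

lemma Hv_eq_Xv: "Hv s = Xv (sobolev_weight s)"
  by (auto simp: Hv_def Xv_def H_def)

lemma Hv_H: "u \<in> Hv s \<Longrightarrow> component u i \<in> H s"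
  by (simp add: Hv_def)

lemma L2v_eq_Xv: "L2v = Xv (\<lambda>_. 1)"
  by (auto simp: L2v_def Xv_def fourier_coeff_summable)

lemma Hv_norm_eq_nrm: "Hv_norm s u = nrm (sobolev_weight s) u"
  unfolding Hv_norm_def nrm_def vip_def Re_mult_cnj_self ..

lemma Xv_le:
  assumes "\<And>k. 0 \<le> m k" "\<And>k. m k \<le> c * m' k" "u \<in> Xv m'"
  shows "u \<in> Xv m"
  unfolding Xv_def
proof (intro CollectI allI conjI)
  fix i
  show "component u i \<in> L2"
    using assms(3) by (rule Xv_L2)
  let ?f = "fourier_coeff (component u i)"
  have s: "(\<lambda>k. c * (m' k * (cmod (?f k))\<^sup>2)) summable_on UNIV"
    by (intro summable_on_cmult_right Xv_summable assms(3))
  have "m k * (cmod (?f k))\<^sup>2 \<le> c * (m' k * (cmod (?f k))\<^sup>2)" for k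
    using mult_right_mono[OF assms(2), of "(cmod (?f k))\<^sup>2" k] by (simp add: mult.assoc)
  then show "(\<lambda>k. m k * (cmod (?f k))\<^sup>2) summable_on UNIV"
    by (intro summable_on_comparison_test[OF s]) (auto simp: assms(1))
qed

lemma Hv_mono: "s \<le> t \<Longrightarrow> u \<in> Hv t \<Longrightarrow> u \<in> Hv s"
  by (auto simp: Hv_def intro: H_mono)

lemma Hv_L2v: "u \<in> Hv s \<Longrightarrow> u \<in> L2v"
  by (auto simp: Hv_def L2v_def intro: H_L2)

text \<open>Only nonnegativity is imposed because the gradient weight \<open>W k - 1\<close>
  vanishes at frequency zero. Thus \<open>vip\<close> is a semi-inner product and \<open>nrm\<close>
  a seminorm.\<close>

locale fourier_weight =
  fixes m :: "int^3 \<Rightarrow> real"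
  assumes m_nonneg: "0 \<le> m k"
begin

lemma summable_cross:
  assumes u: "u \<in> Xv m" and v: "v \<in> Xv m"
  shows "(\<lambda>k. m k * Re (fourier_coeff (component u i) k * cnj (fourier_coeff (component v i) k))) summable_on UNIV"
proof (rule abs_summable_summable, rule summable_on_comparison_test)
  let ?f = "fourier_coeff (component u i)" and ?g = "fourier_coeff (component v i)"
  show "(\<lambda>k. m k * (cmod (?f k))\<^sup>2 + m k * (cmod (?g k))\<^sup>2) summable_on UNIV"
    by (intro summable_on_add Xv_summable u v)
  fix k
  have "\<bar>Re (?f k * cnj (?g k))\<bar> \<le> cmod (?f k) * cmod (?g k)"
    using abs_Re_le_cmod[of "?f k * cnj (?g k)"] by (simp only: norm_mult complex_mod_cnj)
  also have "\<dots> \<le> (cmod (?f k))\<^sup>2 + (cmod (?g k))\<^sup>2"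
    using sum_squares_bound[of "cmod (?f k)" "cmod (?g k)"]
      mult_nonneg_nonneg[OF norm_ge_zero[of "?f k"] norm_ge_zero[of "?g k"]] by linarith
  finally have "m k * \<bar>Re (?f k * cnj (?g k))\<bar> \<le> m k * ((cmod (?f k))\<^sup>2 + (cmod (?g k))\<^sup>2)"
    by (intro mult_left_mono m_nonneg)
  then show "norm (m k * Re (?f k * cnj (?g k))) \<le> m k * (cmod (?f k))\<^sup>2 + m k * (cmod (?g k))\<^sup>2"
    using m_nonneg[of k] by (simp only: real_norm_def abs_mult abs_of_nonneg ring_distribs)
qed auto

lemma Xv_add:
  assumes u: "u \<in> Xv m" and v: "v \<in> Xv m"
  shows "(\<lambda>x. u x + v x) \<in> Xv m"
  unfolding Xv_def
proof (intro CollectI allI conjI)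
  fix i
  let ?f = "fourier_coeff (component u i)" and ?g = "fourier_coeff (component v i)"
  show "component (\<lambda>x. u x + v x) i \<in> L2"
    using L2_add[OF Xv_L2[OF u] Xv_L2[OF v]] by simp
  have c: "fourier_coeff (component (\<lambda>x. u x + v x) i) k = ?f k + ?g k" for k
    using fourier_coeff_add[OF Xv_L2[OF u] Xv_L2[OF v]] by simp
  have e: "(cmod (a + b))\<^sup>2 = (cmod a)\<^sup>2 + 2 * Re (a * cnj b) + (cmod b)\<^sup>2" for a b
    by (simp add: cmod_power2) (simp add: power2_eq_square algebra_simps)
  have "(\<lambda>k. m k * (cmod (?f k))\<^sup>2 + 2 * (m k * Re (?f k * cnj (?g k))) + m k * (cmod (?g k))\<^sup>2) summable_on UNIV"
    by (intro summable_on_add summable_on_cmult_right Xv_summable summable_cross u v)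
  then show "(\<lambda>k. m k * (cmod (fourier_coeff (component (\<lambda>x. u x + v x) i) k))\<^sup>2) summable_on UNIV"
    unfolding c e by (simp only: ring_distribs mult.left_commute[of _ 2])
qed

lemma Xv_scale:
  assumes u: "u \<in> Xv m"
  shows "(\<lambda>x. c *\<^sub>R u x) \<in> Xv m"
proof -
  have "(\<lambda>k. c\<^sup>2 * (m k * (cmod (fourier_coeff (component u i) k))\<^sup>2)) summable_on UNIV" for i
    by (intro summable_on_cmult_right Xv_summable u)
  then show ?thesis
    using L2_cmult[OF Xv_L2[OF u]]
    by (simp add: Xv_def fourier_coeff_cmult norm_mult power_mult_distrib mult.left_commute)
qed

lemma Xv_diff: "u \<in> Xv m \<Longrightarrow> v \<in> Xv m \<Longrightarrow> (\<lambda>x. u x - v x) \<in> Xv m"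
  using Xv_add[of u "\<lambda>x. (-1) *\<^sub>R v x"] Xv_scale[of v "-1"] by simp

lemma vip_add_left:
  assumes "u \<in> Xv m" "v \<in> Xv m" "z \<in> Xv m"
  shows "vip m (\<lambda>x. u x + v x) z = vip m u z + vip m v z"
proof -
  have "fourier_coeff (component (\<lambda>x. u x + v x) i) k = fourier_coeff (component u i) k + fourier_coeff (component v i) k" for i k
    using fourier_coeff_add[OF Xv_L2[OF assms(1)] Xv_L2[OF assms(2)]] by simp
  then show ?thesis
    unfolding vip_def
    using infsum_add[OF summable_cross[OF assms(1,3)] summable_cross[OF assms(2,3)]]
    by (simp only: ring_distribs plus_complex.sel sum.distrib)
qed

lemma vip_scale_left: "vip m (\<lambda>x. c *\<^sub>R u x) z = c * vip m u z"
proof -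
  have "(\<Sum>\<^sub>\<infinity>k. m k * Re (fourier_coeff (component (\<lambda>x. c *\<^sub>R u x) i) k * cnj (fourier_coeff (component z i) k)))
    = (\<Sum>\<^sub>\<infinity>k. c * (m k * Re (fourier_coeff (component u i) k * cnj (fourier_coeff (component z i) k))))" for i
    by (intro infsum_cong) (simp add: fourier_coeff_cmult algebra_simps)
  then show ?thesis
    unfolding vip_def by (simp only: infsum_cmult_right' sum_distrib_left)
qed

lemma vip_sym: "vip m u v = vip m v u"
  unfolding vip_def by (intro sum.cong infsum_cong) (auto simp: algebra_simps)

lemma vip_diff_left:
  assumes "u \<in> Xv m" "v \<in> Xv m" "z \<in> Xv m"
  shows "vip m (\<lambda>x. u x - v x) z = vip m u z - vip m v z"
  using vip_add_left[OF assms(1) Xv_scale[OF assms(2), of "-1"] assms(3)] vip_scale_left[of "-1" v z] by simp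

lemma vip_diff_right:
  assumes "u \<in> Xv m" "v \<in> Xv m" "z \<in> Xv m"
  shows "vip m z (\<lambda>x. u x - v x) = vip m z u - vip m z v"
  using vip_diff_left[OF assms] by (simp add: vip_sym[of z])

lemma vip_nonneg: "vip m u u \<ge> 0"
  unfolding vip_def Re_mult_cnj_self by (intro sum_nonneg infsum_nonneg mult_nonneg_nonneg m_nonneg) auto

lemma nrm_nonneg: "nrm m u \<ge> 0"
  by (simp add: nrm_def vip_nonneg)

lemma nrm_power2: "(nrm m u)\<^sup>2 = vip m u u"
  by (simp add: nrm_def vip_nonneg)

lemma nrm_scale: "nrm m (\<lambda>x. c *\<^sub>R u x) = \<bar>c\<bar> * nrm m u"
proof -
  have "vip m (\<lambda>x. c *\<^sub>R u x) (\<lambda>x. c *\<^sub>R u x) = c\<^sup>2 * vip m u u"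
    unfolding vip_scale_left vip_sym[of u "\<lambda>x. c *\<^sub>R u x"] by (simp add: power2_eq_square)
  then show ?thesis
    by (simp add: nrm_def real_sqrt_mult)
qed

lemma vip_Cauchy_Schwarz:
  assumes u: "u \<in> Xv m" and v: "v \<in> Xv m"
  shows "\<bar>vip m u v\<bar> \<le> nrm m u * nrm m v"
proof -
  define A B C where "A = vip m u u" and "B = vip m u v" and "C = vip m v v"
  have q: "0 \<le> A + 2 * t * B + t\<^sup>2 * C" for t
  proof -
    let ?w = "\<lambda>x. u x + t *\<^sub>R v x"
    have tv: "(\<lambda>x. t *\<^sub>R v x) \<in> Xv m" by (rule Xv_scale[OF v])
    have w: "?w \<in> Xv m" by (rule Xv_add[OF u tv])
    have "vip m ?w ?w = vip m u ?w + t * vip m v ?w"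
      by (simp add: vip_add_left[OF u tv w] vip_scale_left)
    also have "vip m u ?w = A + t * B"
      by (simp add: vip_sym[of u ?w] vip_add_left[OF u tv u] vip_scale_left A_def B_def vip_sym[of v u])
    also have "vip m v ?w = B + t * C"
      by (simp add: vip_sym[of v ?w] vip_add_left[OF u tv v] vip_scale_left B_def C_def)
    finally have "vip m ?w ?w = A + 2 * t * B + t\<^sup>2 * C"
      by (simp add: algebra_simps power2_eq_square)
    then show ?thesis
      using vip_nonneg[of ?w] by simp
  qed
  have C0: "C \<ge> 0" and A0: "A \<ge> 0"
    by (auto simp: A_def C_def vip_nonneg)
  have "B\<^sup>2 \<le> A * C"
  \<comment> \<open>The form may be degenerate, so \<open>C = 0\<close> does not make
    \<open>v\<close> vanish; a nonnegative affine function of \<open>t\<close> must then have slope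
    zero.\<close>
  proof (cases "C = 0")
    case True
    have "B = 0"
    proof (rule ccontr)
      assume "B \<noteq> 0"
      then show False
        \<comment> \<open>At this parameter the expression equals -1.\<close>
        using q[of "- (A + 1) / (2 * B)"] True by (simp add: field_simps)
    qed
    then show ?thesis using True by simp
  next
    case False
    then have C: "C > 0" using C0 by simp
    have "0 \<le> A - B\<^sup>2 / C"
      using q[of "- B / C"] C by (simp add: field_simps power2_eq_square)
    then show ?thesis
      using C by (simp add: field_simps)
  qed
  then have "sqrt (B\<^sup>2) \<le> sqrt (A * C)"
    by (rule real_sqrt_le_mono)
  then show ?thesis
    by (simp add: nrm_def A_def B_def C_def real_sqrt_mult)
qed

lemma nrm_add_le:
  assumes u: "u \<in> Xv m" and v: "v \<in> Xv m"
  shows "nrm m (\<lambda>x. u x + v x) \<le> nrm m u + nrm m v"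
proof (rule power2_le_imp_le)
  have uv: "(\<lambda>x. u x + v x) \<in> Xv m" by (rule Xv_add[OF u v])
  have "(nrm m (\<lambda>x. u x + v x))\<^sup>2 = vip m u u + 2 * vip m u v + vip m v v"
    unfolding nrm_power2
    by (simp add: vip_add_left[OF u v uv] vip_sym[of u "\<lambda>x. u x + v x"] vip_sym[of v "\<lambda>x. u x + v x"]
        vip_add_left[OF u v u] vip_add_left[OF u v v] vip_sym[of v u])
  also have "\<dots> \<le> (nrm m u)\<^sup>2 + 2 * (nrm m u * nrm m v) + (nrm m v)\<^sup>2"
    using vip_Cauchy_Schwarz[OF u v] by (simp add: nrm_power2)
  finally show "(nrm m (\<lambda>x. u x + v x))\<^sup>2 \<le> (nrm m u + nrm m v)\<^sup>2"
    by (simp add: power2_sum)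
qed (simp add: nrm_nonneg)

lemma nrm_minus: "nrm m (\<lambda>x. u x - v x) = nrm m (\<lambda>x. v x - u x)"
  using nrm_scale[of "-1" "\<lambda>x. u x - v x"] by simp

lemma nrm_diff_le:
  assumes u: "u \<in> Xv m" and v: "v \<in> Xv m"
  shows "nrm m (\<lambda>x. u x - v x) \<le> nrm m u + nrm m v"
  using nrm_add_le[OF u Xv_scale[OF v, of "-1"]] nrm_scale[of "-1" v] by simp

lemma nrm_le_diff_add:
  assumes u: "u \<in> Xv m" and v: "v \<in> Xv m"
  shows "nrm m u \<le> nrm m (\<lambda>x. u x - v x) + nrm m v"
  using nrm_add_le[OF Xv_diff[OF u v] v] by simp

lemma nrm_abs_diff:
  assumes u: "u \<in> Xv m" and v: "v \<in> Xv m"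
  shows "\<bar>nrm m u - nrm m v\<bar> \<le> nrm m (\<lambda>x. u x - v x)"
  using nrm_le_diff_add[OF u v] nrm_le_diff_add[OF v u] nrm_minus[of u v] by linarith

text \<open>Cauchy-Schwarz turns differentiability in norm into differentiability of the pairing
  with a fixed field.\<close>

lemma vip_has_derivative:
  assumes D: "deriv_curve (nrm m) I u u'" and t: "t \<in> I"
    and u: "\<And>r. r \<in> I \<Longrightarrow> u r \<in> Xv m" and u': "u' t \<in> Xv m" and z: "z \<in> Xv m"
  shows "((\<lambda>r. vip m (u r) z) has_real_derivative vip m (u' t) z) (at t within I)"
  unfolding has_field_derivative_iff
proof (rule LIM_zero_cancel, rule tendsto_rabs_zero_cancel, rule tendsto_sandwich[where f = "\<lambda>_. 0"])
  let ?q = "\<lambda>r x. (1 / (r - t)) *\<^sub>R (u r x - u t x) - u' t x"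
  have "((\<lambda>r. nrm m (?q r)) \<longlongrightarrow> 0) (at t within I)"
    using D t by (simp add: deriv_curve_def)
  then have "((\<lambda>r. nrm m (?q r) * nrm m z) \<longlongrightarrow> 0 * nrm m z) (at t within I)"
    by (intro tendsto_intros)
  then show "((\<lambda>r. nrm m (?q r) * nrm m z) \<longlongrightarrow> 0) (at t within I)"
    by simp
  have "\<forall>\<^sub>F r in at t within I. r \<in> I"
    by (simp add: eventually_at_filter)
  then show "\<forall>\<^sub>F r in at t within I. \<bar>(vip m (u r) z - vip m (u t) z) / (r - t) - vip m (u' t) z\<bar> \<le> nrm m (?q r) * nrm m z"
  proof eventually_elim
    case (elim r)
    have d: "(\<lambda>x. u r x - u t x) \<in> Xv m"
      by (intro Xv_diff u elim t)
    have q: "?q r \<in> Xv m"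
      by (intro Xv_diff Xv_scale d u')
    have "vip m (?q r) z = (vip m (u r) z - vip m (u t) z) / (r - t) - vip m (u' t) z"
      by (simp only: vip_diff_left[OF Xv_scale[OF d] u' z] vip_scale_left vip_diff_left[OF u[OF elim] u[OF t] z])
        simp
    then show ?case
      using vip_Cauchy_Schwarz[OF q z] by simp
  qed
qed auto

text \<open>Close to \<open>t\<close> the difference quotient lies within distance 1 of the
  derivative, hence the added 1.\<close>

lemma deriv_curve_Lipschitz:
  assumes D: "deriv_curve (nrm m) I u u'" and t: "t \<in> I"
    and u: "\<And>r. r \<in> I \<Longrightarrow> u r \<in> Xv m" and u': "u' t \<in> Xv m"
  shows "\<forall>\<^sub>F r in at t within I. nrm m (\<lambda>x. u r x - u t x) \<le> \<bar>r - t\<bar> * (nrm m (u' t) + 1)"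
proof -
  let ?q = "\<lambda>r x. (1 / (r - t)) *\<^sub>R (u r x - u t x) - u' t x"
  have "((\<lambda>r. nrm m (?q r)) \<longlongrightarrow> 0) (at t within I)"
    using D t by (simp add: deriv_curve_def)
  then have "\<forall>\<^sub>F r in at t within I. nrm m (?q r) < 1"
    by (rule order_tendstoD) simp
  moreover have "\<forall>\<^sub>F r in at t within I. r \<in> I \<and> r \<noteq> t"
    by (simp add: eventually_at_filter)
  ultimately show ?thesis
  proof eventually_elim
    case (elim r)
    then have r: "r \<in> I" "r \<noteq> t" by auto
    have d: "(\<lambda>x. u r x - u t x) \<in> Xv m"
      by (intro Xv_diff u r t)
    have "nrm m (\<lambda>x. (1 / (r - t)) *\<^sub>R (u r x - u t x)) \<le> nrm m (?q r) + nrm m (u' t)"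
      by (rule nrm_le_diff_add[OF Xv_scale[OF d] u'])
    then have "\<bar>1 / (r - t)\<bar> * nrm m (\<lambda>x. u r x - u t x) \<le> nrm m (u' t) + 1"
      using elim(1) unfolding nrm_scale by linarith
    then show ?case
      using r(2) by (simp add: field_simps)
  qed
qed

lemma vip_mono:
  assumes u: "u \<in> Xv m" and m': "\<And>k. 0 \<le> m' k" "\<And>k. m' k \<le> c * m k"
  shows "vip m' u u \<le> c * vip m u u"
proof -
  have "(\<Sum>\<^sub>\<infinity>k. m' k * (cmod (fourier_coeff (component u i) k))\<^sup>2)
    \<le> (\<Sum>\<^sub>\<infinity>k. c * (m k * (cmod (fourier_coeff (component u i) k))\<^sup>2))" for i
  proof (rule infsum_mono)
    show "(\<lambda>k. m' k * (cmod (fourier_coeff (component u i) k))\<^sup>2) summable_on UNIV"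
      by (rule Xv_summable[OF Xv_le[OF m' u]])
    show "(\<lambda>k. c * (m k * (cmod (fourier_coeff (component u i) k))\<^sup>2)) summable_on UNIV"
      by (intro summable_on_cmult_right Xv_summable u)
    show "m' k * (cmod (fourier_coeff (component u i) k))\<^sup>2 \<le> c * (m k * (cmod (fourier_coeff (component u i) k))\<^sup>2)" for k
      using mult_right_mono[OF m'(2), of "(cmod (fourier_coeff (component u i) k))\<^sup>2" k] by (simp add: mult.assoc)
  qed
  then show ?thesis
    unfolding vip_def Re_mult_cnj_self sum_distrib_left
    by (intro sum_mono) (simp only: infsum_cmult_right')
qed

lemma nrm_mono:
  assumes u: "u \<in> Xv m" and m': "\<And>k. 0 \<le> m' k" "\<And>k. m' k \<le> c\<^sup>2 * m k" and c: "c \<ge> 0"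
  shows "nrm m' u \<le> c * nrm m u"
proof -
  have "nrm m' u \<le> sqrt (c\<^sup>2 * vip m u u)"
    unfolding nrm_def by (intro real_sqrt_le_mono vip_mono u m')
  then show ?thesis
    using c by (simp add: real_sqrt_mult nrm_def)
qed

end

section \<open>Integrals of vector fields as Fourier pairings\<close>

lemma has_sum_finite_sum:
  fixes f :: "'i \<Rightarrow> 'a \<Rightarrow> 'b::topological_comm_monoid_add"
  shows "finite I \<Longrightarrow> (\<And>i. i \<in> I \<Longrightarrow> (f i has_sum S i) A) \<Longrightarrow> ((\<lambda>x. \<Sum>i\<in>I. f i x) has_sum (\<Sum>i\<in>I. S i)) A"
  by (induction I rule: finite_induct) (auto intro: has_sum_add)

lemma vip_cong_AE:
  assumes "AE x in Omega. u x = u' x" "u \<in> L2v" "u' \<in> L2v"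
  shows "vip m u v = vip m u' v"
proof -
  have "fourier_coeff (component u i) k = fourier_coeff (component u' i) k" for i k
    by (rule fourier_coeff_cong_AE)
      (use assms in \<open>auto simp: L2v_def intro: L2_measurable elim: eventually_mono\<close>)
  then show ?thesis
    by (simp add: vip_def)
qed

lemma fourier_weight_1: "fourier_weight (\<lambda>_. 1)"
  and fourier_weight_sobolev: "fourier_weight (sobolev_weight s)"
  and fourier_weight_grad: "fourier_weight (\<lambda>k. W k - 1)"
  using W_ge_1 by (auto simp: fourier_weight_def sobolev_weight_nonneg)

lemma inner_L2_eq_vip:
  assumes u: "u \<in> L2v" and v: "v \<in> L2v"
  shows "inner_L2 u v = vip (\<lambda>_. 1) u v"
proof -
  have uv: "component u i \<in> L2" "component v i \<in> L2" for i
    using u v by (auto simp: L2v_def)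
  have "inner_L2 u v = (\<Sum>i\<in>UNIV. LINT x|Omega. u x $ i * v x $ i)"
    unfolding inner_L2_def inner_vec_def inner_real_def
    by (intro Bochner_Integration.integral_sum L2_integrable_mult uv)
  also have "\<dots> = vip (\<lambda>_. 1) u v"
    unfolding vip_def by (intro sum.cong refl) (simp only: mult_1_left infsumI[OF parseval_real[OF uv]])
  finally show ?thesis .
qed

lemma L2v_norm_eq_nrm: "u \<in> L2v \<Longrightarrow> L2v_norm u = nrm (\<lambda>_. 1) u"
  using inner_L2_eq_vip[of u u] by (simp add: L2v_norm_def nrm_def inner_L2_def power2_norm_eq_inner)

lemma Re_dsym: "Re (dsym j k * a * cnj (dsym j k * b)) = (cmod (dsym j k))\<^sup>2 * Re (a * cnj b)"
proof -
  have "dsym j k * a * cnj (dsym j k * b) = complex_of_real ((cmod (dsym j k))\<^sup>2) * (a * cnj b)"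
    unfolding complex_norm_square by (simp only: complex_cnj_mult mult_ac)
  then show ?thesis
    by (simp only: Re_complex_of_real times_complex.sel) simp
qed

lemma inner_grad_eq_vip:
  assumes u: "u \<in> Hv 1" and v: "v \<in> Hv 1"
  shows "inner_grad u v = vip (\<lambda>k. W k - 1) u v"
proof -
  note wu = wd_H(3,4)[OF order_refl Hv_H[OF u]] and wv = wd_H(3,4)[OF order_refl Hv_H[OF v]]
  have "inner_grad u v = (\<Sum>i\<in>UNIV. LINT x|Omega. (\<Sum>j\<in>UNIV. wd j (component u i) x * wd j (component v i) x))"
    unfolding inner_grad_def
    by (intro Bochner_Integration.integral_sum Bochner_Integration.integrable_sum L2_integrable_mult wu wv)
  also have "\<dots> = (\<Sum>i\<in>UNIV. \<Sum>j\<in>UNIV. LINT x|Omega. wd j (component u i) x * wd j (component v i) x)"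
    by (intro sum.cong refl Bochner_Integration.integral_sum L2_integrable_mult wu wv)
  also have "\<dots> = vip (\<lambda>k. W k - 1) u v"
    unfolding vip_def
  proof (intro sum.cong refl)
    fix i
    let ?p = "\<lambda>k. Re (fourier_coeff (component u i) k * cnj (fourier_coeff (component v i) k))"
    have "((\<lambda>k. (cmod (dsym j k))\<^sup>2 * ?p k) has_sum
      (LINT x|Omega. wd j (component u i) x * wd j (component v i) x)) UNIV" for j
      using parseval_real[OF wu(1) wv(1), of j i j i] unfolding wu(2) wv(2) Re_dsym .
    then have "((\<lambda>k. \<Sum>j\<in>UNIV. (cmod (dsym j k))\<^sup>2 * ?p k) has_sum
      (\<Sum>j\<in>UNIV. LINT x|Omega. wd j (component u i) x * wd j (component v i) x)) UNIV"
      by (intro has_sum_finite_sum) auto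
    then have "((\<lambda>k. (W k - 1) * ?p k) has_sum
      (\<Sum>j\<in>UNIV. LINT x|Omega. wd j (component u i) x * wd j (component v i) x)) UNIV"
      unfolding sum_distrib_right[symmetric] sum_norm_dsym .
    then show "(\<Sum>j\<in>UNIV. LINT x|Omega. wd j (component u i) x * wd j (component v i) x)
      = (\<Sum>\<^sub>\<infinity>k. (W k - 1) * ?p k)"
      by (rule infsumI[symmetric])
  qed
  finally show ?thesis .
qed

lemma grad_norm_eq_nrm: "u \<in> Hv 1 \<Longrightarrow> grad_norm u = nrm (\<lambda>k. W k - 1) u"
  using inner_grad_eq_vip[of u u] by (simp add: grad_norm_def nrm_def inner_grad_def power2_eq_square)

text \<open>Vanishing divergence stated frequency by frequency, independent of the choice made by
  \<open>wd\<close>; on \<open>Hv 1\<close> it agrees with \<open>divergence_free\<close>.\<close>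

definition solenoidal :: "vector_field \<Rightarrow> bool" where
  "solenoidal u \<longleftrightarrow> (\<forall>k. (\<Sum>j\<in>UNIV. dsym j k * fourier_coeff (component u j) k) = 0)"

lemma divergence_fourier:
  assumes u: "u \<in> Hv 1"
  shows "divergence u \<in> L2"
    "fourier_coeff (divergence u) k = (\<Sum>j\<in>UNIV. dsym j k * fourier_coeff (component u j) k)"
proof -
  note w = wd_H(3,4)[OF order_refl Hv_H[OF u]]
  have d: "divergence u = (\<lambda>x. \<Sum>j\<in>UNIV. wd j (component u j) x)"
    by (auto simp: divergence_def)
  show "divergence u \<in> L2"
    unfolding d by (intro L2_sum w) auto
  show "fourier_coeff (divergence u) k = (\<Sum>j\<in>UNIV. dsym j k * fourier_coeff (component u j) k)"
    unfolding d using w by (simp add: fourier_coeff_sum)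
qed

lemma solenoidal_iff:
  assumes u: "u \<in> Hv 1"
  shows "solenoidal u \<longleftrightarrow> divergence_free u"
proof
  assume "solenoidal u"
  then have "fourier_coeff (divergence u) k = fourier_coeff (\<lambda>x. 0) k" for k
    using divergence_fourier(2)[OF u] by (simp add: solenoidal_def fourier_coeff_zero)
  then show "divergence_free u"
    unfolding divergence_free_def by (intro L2_fourier_inject divergence_fourier(1)[OF u] L2_zero)
next
  assume "divergence_free u"
  then have "fourier_coeff (divergence u) k = fourier_coeff (\<lambda>x. 0) k" for k
    unfolding divergence_free_def
    by (intro fourier_coeff_cong_AE) (auto intro: L2_measurable divergence_fourier(1)[OF u])
  then show "solenoidal u"
    using divergence_fourier(2)[OF u] by (simp add: solenoidal_def fourier_coeff_zero)
qed

lemma solenoidal_diff: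
  assumes "u \<in> L2v" "v \<in> L2v" "solenoidal u" "solenoidal v"
  shows "solenoidal (\<lambda>x. u x - v x)"
proof -
  have "component u i \<in> L2" "component v i \<in> L2" for i
    using assms by (auto simp: L2v_def)
  then have "fourier_coeff (component (\<lambda>x. u x - v x) j) k = fourier_coeff (component u j) k - fourier_coeff (component v j) k" for j k
    by (simp add: fourier_coeff_diff)
  then show ?thesis
    using assms(3,4) by (simp add: solenoidal_def right_diff_distrib sum_subtractf)
qed

text \<open>At each frequency the coefficient of a gradient is parallel to the wave vector and that
  of a solenoidal field is orthogonal to it, so the pairing vanishes term by term.\<close>

lemma inner_grad_pressure:
  assumes p: "p \<in> H 1" and u: "u \<in> L2v" and sol: "solenoidal u"
  shows "grad p \<in> L2v" "inner_L2 (grad p) u = 0"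
proof -
  note w = wd_H(3,4)[OF order_refl p]
  show g: "grad p \<in> L2v"
    using w by (simp add: L2v_def grad_def)
  have uL: "component u i \<in> L2" for i
    using u by (auto simp: L2v_def)
  let ?p = "fourier_coeff p"
  have "((\<lambda>k. \<Sum>i\<in>UNIV. Re (fourier_coeff (component (grad p) i) k * cnj (fourier_coeff (component u i) k))) has_sum
    (\<Sum>i\<in>UNIV. LINT x|Omega. component (grad p) i x * u x $ i)) UNIV"
    using w uL by (intro has_sum_finite_sum parseval_real) (auto simp: grad_def)
  moreover have "(\<Sum>i\<in>UNIV. Re (fourier_coeff (component (grad p) i) k * cnj (fourier_coeff (component u i) k))) = 0" for k
  proof -
    have "(\<Sum>i\<in>UNIV. Re (fourier_coeff (component (grad p) i) k * cnj (fourier_coeff (component u i) k)))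
      = Re (\<Sum>i\<in>UNIV. dsym i k * ?p k * cnj (fourier_coeff (component u i) k))"
      by (simp add: grad_def w(2))
    also have "(\<Sum>i\<in>UNIV. dsym i k * ?p k * cnj (fourier_coeff (component u i) k))
      = - (?p k * cnj (\<Sum>i\<in>UNIV. dsym i k * fourier_coeff (component u i) k))"
      by (simp add: cnj_sum sum_distrib_left sum_negf[symmetric] mult_ac)
    also have "\<dots> = 0"
      using sol by (simp only: solenoidal_def) simp
    finally show ?thesis by simp
  qed
  ultimately have "(\<Sum>i\<in>UNIV. LINT x|Omega. component (grad p) i x * u x $ i) = 0"
    by (simp add: has_sum_unique[OF _ has_sum_0_simp])
  moreover have "inner_L2 (grad p) u = (\<Sum>i\<in>UNIV. LINT x|Omega. component (grad p) i x * u x $ i)"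
    unfolding inner_L2_def inner_vec_def inner_real_def
    using g uL by (intro Bochner_Integration.integral_sum L2_integrable_mult) (auto simp: L2v_def)
  ultimately show "inner_L2 (grad p) u = 0"
    by simp
qed

section \<open>The advection term\<close>

text \<open>The two factors in \<open>H 1\<close> are multiplied together; their product is square
  integrable and pairs with the third.\<close>

lemma integrable_triple:
  assumes "f \<in> H 1" "g \<in> L2" "h \<in> H 1"
  shows "integrable Omega (\<lambda>x. f x * g x * h x)"
  using L2_integrable_mult[OF H1_mult_L2(1)[OF assms(1,3)] assms(2)] by (simp add: mult_ac)

text \<open>Expanding the product and then the pairing gives a double series. It converges
  absolutely, since the convolution of absolute values and the coefficients of the derivative are
  both square summable; this licenses the exchange of indices in the next theorem.\<close>

lemma transport_pairing:
  assumes u: "f \<in> H 1" and g: "g \<in> H 1"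
  shows "((\<lambda>(k, l). fourier_coeff g l * fourier_coeff f (k - l) * cnj (dsym j k * fourier_coeff g k))
    has_sum complex_of_real (LINT x|Omega. f x * wd j g x * g x)) (UNIV \<times> UNIV)"
proof -
  note w = wd_H(3,4)[OF order_refl g]
  let ?g = "fourier_coeff g" and ?f = "fourier_coeff f"
  let ?h = "\<lambda>x. g x * f x"
  have hL: "?h \<in> L2"
    by (rule H1_mult_L2(1)[OF g u])
  let ?t = "\<lambda>k l. ?g l * ?f (k - l) * cnj (dsym j k * ?g k)"
  define c where "c k = (\<Sum>\<^sub>\<infinity>l. cmod (?g l) * cmod (?f (k - l)))" for k
  have row: "((\<lambda>l. cmod (?t k l)) has_sum c k * cmod (dsym j k * ?g k)) UNIV" for k
  proof -
    have "((\<lambda>l. cmod (?g l) * cmod (?f (k - l))) has_sum c k) UNIV"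
      unfolding c_def by (rule has_sum_infsum) (rule H1_mult_L2(2)[OF g u])
    then have "((\<lambda>l. cmod (?g l) * cmod (?f (k - l)) * cmod (dsym j k * ?g k)) has_sum c k * cmod (dsym j k * ?g k)) UNIV"
      by (rule has_sum_cmult_left)
    then show ?thesis
      by (simp only: norm_mult complex_mod_cnj)
  qed
  have c0: "c k \<ge> 0" for k
    unfolding c_def by (intro infsum_nonneg) auto
  have rows: "(\<lambda>k. c k * cmod (dsym j k * ?g k)) summable_on UNIV"
  proof (rule summable_on_comparison_test)
    have "(\<lambda>k. (c k)\<^sup>2) summable_on UNIV"
      unfolding c_def by (rule H1_mult_L2(3)[OF g u])
    moreover have "(\<lambda>k. (cmod (dsym j k * ?g k))\<^sup>2) summable_on UNIV"
      using fourier_coeff_summable[OF w(1)] unfolding w(2) .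
    ultimately show "(\<lambda>k. (c k)\<^sup>2 + (cmod (dsym j k * ?g k))\<^sup>2) summable_on UNIV"
      by (rule summable_on_add)
    fix k
    show "c k * cmod (dsym j k * ?g k) \<le> (c k)\<^sup>2 + (cmod (dsym j k * ?g k))\<^sup>2"
      using sum_squares_bound[of "c k" "cmod (dsym j k * ?g k)"]
        mult_nonneg_nonneg[OF c0[of k] norm_ge_zero[of "dsym j k * ?g k"]] by linarith
    show "0 \<le> c k * cmod (dsym j k * ?g k)"
      by (intro mult_nonneg_nonneg c0 norm_ge_zero)
  qed
  have "(\<lambda>(k, l). cmod (?t k l)) summable_on UNIV \<times> UNIV"
  proof (rule summable_on_SigmaI[where g = "\<lambda>k. c k * cmod (dsym j k * ?g k)"])
    show "((\<lambda>l. case (k, l) of (k, l) \<Rightarrow> cmod (?t k l)) has_sum c k * cmod (dsym j k * ?g k)) UNIV" for k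
      unfolding prod.case by (rule row)
    show "(\<lambda>k. c k * cmod (dsym j k * ?g k)) summable_on UNIV"
      by (rule rows)
    show "0 \<le> (case (k, l) of (k, l) \<Rightarrow> cmod (?t k l))" for k l
      unfolding prod.case by (rule norm_ge_zero)
  qed
  then have abs: "(\<lambda>(k, l). ?t k l) summable_on UNIV \<times> UNIV"
    unfolding case_prod_unfold by (rule abs_summable_summable)
  have inner: "((\<lambda>l. ?t k l) has_sum fourier_coeff ?h k * cnj (dsym j k * ?g k)) UNIV" for k
    by (intro has_sum_cmult_left fourier_coeff_mult H_L2[OF g] H_L2[OF u])
  obtain S where S: "((\<lambda>(k, l). ?t k l) has_sum S) (UNIV \<times> UNIV)"
    using abs by (auto simp: summable_on_def)
  have "((\<lambda>k. fourier_coeff ?h k * cnj (dsym j k * ?g k)) has_sum S) UNIV"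
    by (rule has_sum_SigmaD[OF S]) (simp only: prod.case inner)
  moreover have "((\<lambda>k. fourier_coeff ?h k * cnj (dsym j k * ?g k)) has_sum
    (LINT x|Omega. cx ?h x * cnj (cx (wd j g) x))) UNIV"
    using parseval[OF L2_cx[OF hL] L2_cx[OF w(1)]] unfolding fourier_coeff_fc[symmetric] w(2) .
  ultimately have "S = (LINT x|Omega. cx ?h x * cnj (cx (wd j g) x))"
    by (rule has_sum_unique)
  also have "\<dots> = complex_of_real (LINT x|Omega. f x * wd j g x * g x)"
    by (subst integral_complex_of_real[symmetric]) (simp add: mult_ac)
  finally show ?thesis
    using S by simp
qed

text \<open>Exchanging the two summation indices conjugates and negates the double Fourier series.\<close>

theorem transport_orthogonal:
  assumes u: "u \<in> Hv 1" and sol: "solenoidal u" and g: "g \<in> H 1"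
  shows "(\<Sum>j\<in>UNIV. LINT x|Omega. u x $ j * wd j g x * g x) = 0"
proof -
  let ?g = "fourier_coeff g" and ?u = "\<lambda>j. fourier_coeff (component u j)"
  define t where "t k l = (\<Sum>j\<in>UNIV. ?g l * ?u j (k - l) * cnj (dsym j k * ?g k))" for k l
  define Z where "Z = (\<Sum>j\<in>UNIV. LINT x|Omega. u x $ j * wd j g x * g x)"
  have "((\<lambda>p. \<Sum>j\<in>UNIV. (case p of (k, l) \<Rightarrow> ?g l * ?u j (k - l) * cnj (dsym j k * ?g k))) has_sum
    (\<Sum>j\<in>UNIV. complex_of_real (LINT x|Omega. u x $ j * wd j g x * g x))) (UNIV \<times> UNIV)"
    by (rule has_sum_finite_sum[OF finite transport_pairing[OF Hv_H[OF u] g]])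
  then have sum: "((\<lambda>(k, l). t k l) has_sum complex_of_real Z) (UNIV \<times> UNIV)"
    by (simp only: t_def Z_def case_prod_unfold of_real_sum)
  have swap: "t l k = - cnj (t k l)" for k l
  proof -
    have dd: "dsym j (k - l) = dsym j k - dsym j l" for j
      by (simp add: algebra_simps)
    have "(\<Sum>j\<in>UNIV. dsym j (k - l) * ?u j (k - l)) = 0"
      using sol unfolding solenoidal_def by blast
    \<comment> \<open>The solenoidal condition at frequency \<open>k - l\<close> lets the derivative
      act on either of the two frequencies.\<close>
    then have eq: "(\<Sum>j\<in>UNIV. dsym j k * ?u j (k - l)) = (\<Sum>j\<in>UNIV. dsym j l * ?u j (k - l))"
      unfolding dd left_diff_distrib sum_subtractf by (simp only: right_minus_eq)
    have cd: "cnj (dsym j k * z) = - (dsym j k * cnj z)" for j k z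
      by simp
    have tkl: "t k l = - (?g l * cnj (?g k) * (\<Sum>j\<in>UNIV. dsym j k * ?u j (k - l)))" for k l
      unfolding t_def cd sum_distrib_left sum_negf[symmetric]
      by (intro sum.cong refl) (simp only: mult_minus_right mult_ac)
    have "cnj (?u j (k - l)) = ?u j (l - k)" for j
      using fourier_coeff_uminus[of "component u j" "k - l"] by simp
    then have cS: "cnj (\<Sum>j\<in>UNIV. dsym j l * ?u j (k - l)) = - (\<Sum>j\<in>UNIV. dsym j l * ?u j (l - k))"
      unfolding cnj_sum cd sum_negf by simp
    have "cnj (t k l) = - (cnj (?g l) * ?g k * cnj (\<Sum>j\<in>UNIV. dsym j l * ?u j (k - l)))"
      unfolding tkl eq by (simp only: complex_cnj_minus complex_cnj_mult complex_cnj_cnj)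
    then show ?thesis
      unfolding tkl[of l k] cS by (simp only: mult_minus_right minus_minus mult_ac)
  qed
  have "((\<lambda>(k, l). t l k) has_sum complex_of_real Z) (UNIV \<times> UNIV)"
    using sum by (subst has_sum_swap) simp
  moreover have "((\<lambda>(k, l). - cnj (t k l)) has_sum - cnj (complex_of_real Z)) (UNIV \<times> UNIV)"
    using sum by (simp only: case_prod_unfold has_sum_uminus has_sum_cnj_iff minus_minus)
  then have "((\<lambda>(k, l). t l k) has_sum - cnj (complex_of_real Z)) (UNIV \<times> UNIV)"
    by (simp only: swap[symmetric])
  ultimately have "complex_of_real Z = - cnj (complex_of_real Z)"
    by (rule has_sum_unique)
  then have "Z = 0"
    by (simp add: complex_eq_iff)
  then show ?thesis
    by (simp add: Z_def)
qed

lemma inner_advect: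
  assumes u: "u \<in> Hv 1" and v: "v \<in> Hv 1" and w: "w \<in> Hv 1"
  shows "inner_L2 (advect u v) w
    = (\<Sum>i\<in>UNIV. \<Sum>j\<in>UNIV. LINT x|Omega. u x $ j * wd j (component v i) x * w x $ i)"
    and "integrable Omega (\<lambda>x. advect u v x \<bullet> w x)"
proof -
  have t: "integrable Omega (\<lambda>x. u x $ j * wd j (component v i) x * w x $ i)" for i j
    by (rule integrable_triple[OF Hv_H[OF u] wd_H(3)[OF order_refl Hv_H[OF v]] Hv_H[OF w]])
  have e: "advect u v x \<bullet> w x = (\<Sum>i\<in>UNIV. \<Sum>j\<in>UNIV. u x $ j * wd j (component v i) x * w x $ i)" for x
    by (simp add: inner_vec_def advect_def sum_distrib_right)
  show "integrable Omega (\<lambda>x. advect u v x \<bullet> w x)"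
    unfolding e by (intro Bochner_Integration.integrable_sum t)
  show "inner_L2 (advect u v) w
    = (\<Sum>i\<in>UNIV. \<Sum>j\<in>UNIV. LINT x|Omega. u x $ j * wd j (component v i) x * w x $ i)"
    unfolding inner_L2_def e
    apply (subst Bochner_Integration.integral_sum)
     apply (rule Bochner_Integration.integrable_sum, rule t)
    apply (subst Bochner_Integration.integral_sum)
     apply (rule t)
    apply (rule refl)
    done
qed

lemma Hv_diff: "u \<in> Hv s \<Longrightarrow> v \<in> Hv s \<Longrightarrow> (\<lambda>x. u x - v x) \<in> Hv s"
  unfolding Hv_eq_Xv by (rule fourier_weight.Xv_diff[OF fourier_weight_sobolev])

text \<open>Linearity holds only almost everywhere, because the three weak derivatives are
  independent choices of representatives.\<close>

lemma wd_diff: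
  assumes f: "f \<in> H 1" and g: "g \<in> H 1" and fg: "(\<lambda>x. f x - g x) \<in> H 1"
  shows "AE x in Omega. wd j (\<lambda>x. f x - g x) x = wd j f x - wd j g x"
proof (rule L2_fourier_inject)
  note w = wd_H(3,4)[OF order_refl]
  show "wd j (\<lambda>x. f x - g x) \<in> L2" "(\<lambda>x. wd j f x - wd j g x) \<in> L2"
    by (intro L2_diff w f g fg)+
  show "fourier_coeff (wd j (\<lambda>x. f x - g x)) k = fourier_coeff (\<lambda>x. wd j f x - wd j g x) k" for k
    using w[OF f] w[OF g] w[OF fg] H_L2[OF f] H_L2[OF g]
    by (simp only: fourier_coeff_diff right_diff_distrib)
qed

lemma inner_advect_diff_left:
  assumes u: "u \<in> Hv 1" and u': "u' \<in> Hv 1" and v: "v \<in> Hv 1" and w: "w \<in> Hv 1"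
  shows "inner_L2 (advect (\<lambda>x. u x - u' x) v) w = inner_L2 (advect u v) w - inner_L2 (advect u' v) w"
proof -
  have "advect (\<lambda>x. u x - u' x) v x \<bullet> w x = advect u v x \<bullet> w x - advect u' v x \<bullet> w x" for x
    by (simp add: inner_vec_def advect_def sum_distrib_right left_diff_distrib sum_subtractf)
  then show ?thesis
    unfolding inner_L2_def using inner_advect(2)[OF u v w] inner_advect(2)[OF u' v w] by simp
qed

lemma inner_advect_diff_right:
  assumes u: "u \<in> Hv 1" and v: "v \<in> Hv 1" and v': "v' \<in> Hv 1" and w: "w \<in> Hv 1"
  shows "inner_L2 (advect u (\<lambda>x. v x - v' x)) w = inner_L2 (advect u v) w - inner_L2 (advect u v') w"
proof -
  have vv: "(\<lambda>x. v x - v' x) \<in> Hv 1"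
    by (rule Hv_diff[OF v v'])
  note t = integrable_triple[OF Hv_H[OF u] wd_H(3)[OF order_refl] Hv_H[OF w]]
  have "(LINT x|Omega. u x $ j * wd j (component (\<lambda>x. v x - v' x) i) x * w x $ i)
    = (LINT x|Omega. u x $ j * wd j (component v i) x * w x $ i) - (LINT x|Omega. u x $ j * wd j (component v' i) x * w x $ i)" for i j
  proof -
    note tt = t[OF Hv_H[OF vv, of i], of j j i] and tv = t[OF Hv_H[OF v, of i], of j j i] and tv' = t[OF Hv_H[OF v', of i], of j j i]
    have fg: "(\<lambda>x. v x $ i - v' x $ i) \<in> H 1"
      using Hv_H[OF vv, of i] by simp
    have "(LINT x|Omega. u x $ j * wd j (component (\<lambda>x. v x - v' x) i) x * w x $ i)
      = (LINT x|Omega. u x $ j * wd j (component v i) x * w x $ i - u x $ j * wd j (component v' i) x * w x $ i)"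
    proof (rule integral_cong_AE)
      show "AE x in Omega. u x $ j * wd j (component (\<lambda>x. v x - v' x) i) x * w x $ i
          = u x $ j * wd j (component v i) x * w x $ i - u x $ j * wd j (component v' i) x * w x $ i"
        using wd_diff[OF Hv_H[OF v, of i] Hv_H[OF v', of i] fg, of j]
      proof eventually_elim
        case (elim x)
        then have "wd j (component (\<lambda>x. v x - v' x) i) x = wd j (component v i) x - wd j (component v' i) x"
          by simp
        then show ?case
          by (simp only: left_diff_distrib right_diff_distrib)
      qed
    qed (use tt tv tv' in \<open>auto intro!: borel_measurable_diff borel_measurable_integrable\<close>)
    also have "\<dots> = (LINT x|Omega. u x $ j * wd j (component v i) x * w x $ i) - (LINT x|Omega. u x $ j * wd j (component v' i) x * w x $ i)"
      by (rule Bochner_Integration.integral_diff[OF tv tv'])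
    finally show ?thesis .
  qed
  then show ?thesis
    unfolding inner_advect(1)[OF u v w] inner_advect(1)[OF u v' w] inner_advect(1)[OF u vv w]
    by (simp only: sum_subtractf)
qed

lemma inner_advect_self:
  assumes u: "u \<in> Hv 1" and sol: "solenoidal u" and w: "w \<in> Hv 1"
  shows "inner_L2 (advect u w) w = 0"
  unfolding inner_advect(1)[OF u w w]
  by (rule sum.neutral) (rule ballI, rule transport_orthogonal[OF u sol Hv_H[OF w]])

text \<open>Young's inequality on each of the nine products of components; every squared component
  is counted three times, hence the factor 3.\<close>

lemma inner_advect_bound:
  assumes v: "v \<in> Hv 1" and w: "w \<in> Hv 1"
    and L: "\<And>i j. AE x in Omega. \<bar>wd j (component v i) x\<bar> \<le> L"
  shows "\<bar>inner_L2 (advect w v) w\<bar> \<le> 3 * L * vip (\<lambda>_. 1) w w"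
proof -
  have wL: "component w i \<in> L2" for i
    using H_L2[OF Hv_H[OF w]] .
  define N where "N i = (LINT x|Omega. (w x $ i)\<^sup>2)" for i
  have bd: "\<bar>LINT x|Omega. w x $ j * wd j (component v i) x * w x $ i\<bar> \<le> L * ((N j + N i) / 2)" for i j
  proof -
    have i1: "integrable Omega (\<lambda>x. w x $ j * wd j (component v i) x * w x $ i)"
      by (rule integrable_triple[OF Hv_H[OF w] wd_H(3)[OF order_refl Hv_H[OF v]] Hv_H[OF w]])
    have i2: "integrable Omega (\<lambda>x. L * (((w x $ j)\<^sup>2 + (w x $ i)\<^sup>2) / 2))"
      using L2_square_integrable[OF wL[of i]] L2_square_integrable[OF wL[of j]] by simp
    have "\<bar>LINT x|Omega. w x $ j * wd j (component v i) x * w x $ i\<bar>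
      \<le> (LINT x|Omega. \<bar>w x $ j * wd j (component v i) x * w x $ i\<bar>)"
      by (rule integral_abs_bound)
    also have "\<dots> \<le> (LINT x|Omega. L * (((w x $ j)\<^sup>2 + (w x $ i)\<^sup>2) / 2))"
    proof (rule integral_mono_AE)
      show "AE x in Omega. \<bar>w x $ j * wd j (component v i) x * w x $ i\<bar> \<le> L * (((w x $ j)\<^sup>2 + (w x $ i)\<^sup>2) / 2)"
        using L[where i=i and j=j]
      proof eventually_elim
        case (elim x)
        have "2 * (\<bar>w x $ j\<bar> * \<bar>w x $ i\<bar>) \<le> (w x $ j)\<^sup>2 + (w x $ i)\<^sup>2"
          using sum_squares_bound[of "\<bar>w x $ j\<bar>" "\<bar>w x $ i\<bar>"] by (simp add: mult.assoc)
        then have "\<bar>wd j (component v i) x\<bar> * (\<bar>w x $ j\<bar> * \<bar>w x $ i\<bar>) \<le> L * (((w x $ j)\<^sup>2 + (w x $ i)\<^sup>2) / 2)"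
          using elim by (intro mult_mono) auto
        then show ?case
          by (simp add: abs_mult mult_ac)
      qed
    qed (use i1 i2 in auto)
    also have "\<dots> = L * ((N j + N i) / 2)"
      using L2_square_integrable[OF wL[of i]] L2_square_integrable[OF wL[of j]] by (simp add: N_def)
    finally show ?thesis .
  qed
  have "\<bar>inner_L2 (advect w v) w\<bar> \<le> (\<Sum>i\<in>UNIV. \<Sum>j\<in>UNIV. L * ((N j + N i) / 2))"
    unfolding inner_advect(1)[OF w v w]
    by (intro order_trans[OF sum_abs] sum_mono order_trans[OF sum_abs] bd)
  also have "\<dots> = 3 * L * (\<Sum>i\<in>UNIV. N i)"
    by (simp add: sum_3 algebra_simps)
  also have "(\<Sum>i\<in>UNIV. N i) = inner_L2 w w"
    unfolding inner_L2_def inner_vec_def inner_real_def N_def power2_eq_square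
    by (intro Bochner_Integration.integral_sum[symmetric] L2_integrable_mult wL)
  also have "\<dots> = vip (\<lambda>_. 1) w w"
    by (intro inner_L2_eq_vip Hv_L2v[OF w])
  finally show ?thesis .
qed

section \<open>Bounds in terms of the \<open>H 3\<close> norm\<close>

lemma sob_component_le: "sob s (component v i) \<le> vip (sobolev_weight s) v v"
  unfolding vip_def Re_mult_cnj_self sob_def[symmetric]
  by (rule member_le_sum) (auto simp: sob_nonneg)

lemma wd_bounded_Hv3:
  assumes v: "v \<in> Hv 3"
  shows "AE x in Omega. \<bar>wd j (component v i) x\<bar> \<le> sqrt (CW * vip (sobolev_weight 3) v v)"
proof -
  have h: "wd j (component v i) \<in> H 2" "sob 2 (wd j (component v i)) \<le> sob 3 (component v i)"
    using wd_H(1,2)[OF _ Hv_H[OF v, of i], of j] by auto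
  have "sob 2 (wd j (component v i)) \<le> vip (sobolev_weight 3) v v"
    using h(2) sob_component_le[of 3 v i] by linarith
  then have "sqrt (CW * sob 2 (wd j (component v i))) \<le> sqrt (CW * vip (sobolev_weight 3) v v)"
    by (intro real_sqrt_le_mono mult_left_mono CW_nonneg)
  then show ?thesis
    by (intro eventually_mono[OF H2_bounded[OF h(1)]]) (rule order_trans)
qed

lemma H_sum:
  fixes f :: "3 \<Rightarrow> scalar_field"
  assumes f: "\<And>j. f j \<in> H s"
  shows "(\<lambda>x. \<Sum>j\<in>UNIV. f j x) \<in> H s" "sob s (\<lambda>x. \<Sum>j\<in>UNIV. f j x) \<le> 3 * (\<Sum>j\<in>UNIV. sob s (f j))"
proof -
  let ?F = "\<lambda>x. \<Sum>j\<in>UNIV. f j x" and ?c = "\<lambda>j. fourier_coeff (f j)"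
  let ?w = "\<lambda>j k. sobolev_weight s k * (cmod (?c j k))\<^sup>2"
  have L: "f j \<in> L2" for j
    by (rule H_L2[OF f])
  have c: "fourier_coeff ?F k = (\<Sum>j\<in>UNIV. ?c j k)" for k
    by (simp add: fourier_coeff_sum L)
  have bound: "sobolev_weight s k * (cmod (fourier_coeff ?F k))\<^sup>2 \<le> 3 * (\<Sum>j\<in>UNIV. ?w j k)" for k
  proof -
    have "(cmod (fourier_coeff ?F k))\<^sup>2 \<le> (\<Sum>j\<in>UNIV. 1 * cmod (?c j k))\<^sup>2"
      unfolding c by (intro power_mono) (auto intro: norm_sum)
    also have "\<dots> \<le> (\<Sum>j\<in>(UNIV::3 set). 1\<^sup>2) * (\<Sum>j\<in>UNIV. (cmod (?c j k))\<^sup>2)"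
      by (rule Cauchy_Schwarz_ineq_sum)
    finally have "(cmod (fourier_coeff ?F k))\<^sup>2 \<le> 3 * (\<Sum>j\<in>UNIV. (cmod (?c j k))\<^sup>2)"
      by simp
    then have "sobolev_weight s k * (cmod (fourier_coeff ?F k))\<^sup>2 \<le> sobolev_weight s k * (3 * (\<Sum>j\<in>UNIV. (cmod (?c j k))\<^sup>2))"
      by (rule mult_left_mono) (rule sobolev_weight_nonneg)
    then show ?thesis
      by (simp add: sum_distrib_left mult_ac)
  qed
  have hs: "((\<lambda>k. 3 * (\<Sum>j\<in>UNIV. ?w j k)) has_sum 3 * (\<Sum>j\<in>UNIV. sob s (f j))) UNIV"
    unfolding sob_def by (intro has_sum_cmult_right has_sum_finite_sum has_sum_infsum H_summable f) auto
  have s1: "(\<lambda>k. sobolev_weight s k * (cmod (fourier_coeff ?F k))\<^sup>2) summable_on UNIV"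
    by (rule summable_on_comparison_test[OF has_sum_imp_summable[OF hs] bound]) (auto simp: sobolev_weight_nonneg)
  then show "?F \<in> H s"
    using L by (simp add: H_def L2_sum)
  have "sob s ?F \<le> (\<Sum>\<^sub>\<infinity>k. 3 * (\<Sum>j\<in>UNIV. ?w j k))"
    unfolding sob_def by (intro infsum_mono s1 has_sum_imp_summable[OF hs] bound)
  then show "sob s ?F \<le> 3 * (\<Sum>j\<in>UNIV. sob s (f j))"
    unfolding infsumI[OF hs] .
qed

text \<open>For fields in \<open>Hv 3\<close> each product \<open>v_j\<close> times
  \<open>wd j v_i\<close> has both factors in \<open>H 2\<close>. The constant 54 is 2 from the
  product estimate, 3 times 3 from squaring and adding three terms, and 3 for the
  components.\<close>

lemma advect_Hv1:
  assumes v: "v \<in> Hv 3"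
  shows "advect v v \<in> Hv 1"
    "vip (sobolev_weight 1) (advect v v) (advect v v) \<le> 54 * CW * (vip (sobolev_weight 3) v v)\<^sup>2"
proof -
  let ?R = "vip (sobolev_weight 3) v v"
  have R: "?R \<ge> 0"
    by (rule fourier_weight.vip_nonneg[OF fourier_weight_sobolev])
  let ?p = "\<lambda>i j x. v x $ j * wd j (component v i) x"
  have vj: "component v j \<in> H 2" "sob 2 (component v j) \<le> ?R" for j
    using H_mono[of 2 3, OF _ Hv_H[OF v]] sob_mono[of 2 3, OF _ Hv_H[OF v, of j]] sob_component_le[of 3 v j] by auto
  have wv: "wd j (component v i) \<in> H 2" "sob 2 (wd j (component v i)) \<le> ?R" for i j
    using wd_H(1,2)[OF _ Hv_H[OF v, of i], of j] sob_component_le[of 3 v i] by auto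
  have p: "?p i j \<in> H 1" "sob 1 (?p i j) \<le> 2 * CW * ?R\<^sup>2" for i j
  proof -
    show "?p i j \<in> H 1"
      by (rule H2_mult_H1(1)[OF vj(1) wv(1)])
    have "sob 1 (?p i j) \<le> 2 * CW * (sob 2 (component v j) * sob 2 (wd j (component v i)))"
      by (rule H2_mult_H1(2)[OF vj(1) wv(1)])
    also have "\<dots> \<le> 2 * CW * (?R * ?R)"
      by (intro mult_left_mono mult_mono vj wv) (auto simp: CW_nonneg sob_nonneg R)
    finally show "sob 1 (?p i j) \<le> 2 * CW * ?R\<^sup>2"
      by (simp add: power2_eq_square)
  qed
  have comp: "component (advect v v) i = (\<lambda>x. \<Sum>j\<in>UNIV. ?p i j x)" for i
    by (simp add: advect_def)
  show "advect v v \<in> Hv 1"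
  proof -
    have "component (advect v v) i \<in> H 1" for i
      unfolding comp by (rule H_sum(1)) (rule p(1))
    then show ?thesis
      by (simp only: Hv_def mem_Collect_eq) blast
  qed
  have "sob 1 (component (advect v v) i) \<le> 18 * CW * ?R\<^sup>2" for i
  proof -
    have "sob 1 (component (advect v v) i) \<le> 3 * (\<Sum>j\<in>UNIV. sob 1 (?p i j))"
      unfolding comp by (rule H_sum(2)) (rule p(1))
    also have "\<dots> \<le> 3 * (\<Sum>j\<in>(UNIV::3 set). 2 * CW * ?R\<^sup>2)"
      by (intro mult_left_mono sum_mono p) auto
    finally show ?thesis by simp
  qed
  then have "(\<Sum>i\<in>UNIV. sob 1 (component (advect v v) i)) \<le> (\<Sum>i\<in>(UNIV::3 set). 18 * CW * ?R\<^sup>2)"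
    by (intro sum_mono)
  then show "vip (sobolev_weight 1) (advect v v) (advect v v) \<le> 54 * CW * ?R\<^sup>2"
    unfolding vip_def Re_mult_cnj_self sob_def[symmetric] by simp
qed

section \<open>Comparison of Euler and Euler-Voigt solutions\<close>

text \<open>Only right difference quotients are bounded, since the Euler solution is known to be Lipschitz
  but not differentiable in time with values in \<open>H\<^sup>1\<close>.\<close>

lemma dini_gronwall:
  fixes E :: "real \<Rightarrow> real"
  assumes cont: "continuous_on {0..T} E" and E0: "E 0 \<le> D" and c: "c \<ge> 0" and d: "d < D" and D: "D > 0"
    and dini: "\<And>t e. 0 \<le> t \<Longrightarrow> t < T \<Longrightarrow> e > 0 \<Longrightarrow>
      \<forall>\<^sub>F r in at_right t. E r - E t \<le> (r - t) * (c * E t + d + e)"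
    and t: "0 \<le> t" "t \<le> T"
  shows "E t \<le> D * exp ((c + 1) * t)"
proof -
  \<comment> \<open>The rate is \<open>c + 1\<close> rather than \<open>c\<close> because the
    constant source is absorbed by \<open>D \<le> B s\<close>.\<close>
  define B where "B s = D * exp ((c + 1) * s)" for s
  have contB: "continuous_on A B" for A
    unfolding B_def by (intro continuous_intros)
  have BD: "D \<le> B s" if "s \<ge> 0" for s
    using D c that by (simp add: B_def)
  \<comment> \<open>Continuous induction: the times up to which the comparison holds without
    interruption. Their supremum must be \<open>T\<close>.\<close>
  define A where "A = {s \<in> {0..T}. \<forall>r\<in>{0..s}. E r \<le> B r}"
  have A0: "0 \<in> A"
    using t E0 by (simp add: A_def B_def)
  have bdd: "bdd_above A"
    by (rule bdd_aboveI[of _ T]) (simp add: A_def)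
  define t0 where "t0 = Sup A"
  have t0: "0 \<le> t0" "t0 \<le> T"
    unfolding t0_def using A0 by (auto intro!: cSup_upper bdd cSup_least simp: A_def)
  have below: "E s \<le> B s" if "0 \<le> s" "s < t0" for s
  proof -
    obtain r where "r \<in> A" "s < r"
      using \<open>s < t0\<close> A0 bdd unfolding t0_def by (metis less_cSup_iff empty_iff)
    then show ?thesis
      using that(1) by (auto simp: A_def)
  qed
  have at_t0: "E t0 \<le> B t0"
  proof (cases "t0 = 0")
    case True
    then show ?thesis using E0 by (simp add: B_def)
  next
    case False
    then have cl: "closure {0..<t0} = {0..t0}"
      using t0 by (intro closure_atLeastLessThan) auto
    have "closed {s \<in> {0..T}. E s \<le> B s}"
      by (intro continuous_on_closed_Collect_le cont contB closed_atLeastAtMost)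
    moreover have "{0..<t0} \<subseteq> {s \<in> {0..T}. E s \<le> B s}"
      using below t0 by auto
    ultimately have "closure {0..<t0} \<subseteq> {s \<in> {0..T}. E s \<le> B s}"
      by (rule closure_minimal[rotated])
    then show ?thesis
      using cl t0 by auto
  qed
  have "t0 = T"
  proof (rule ccontr)
    assume "t0 \<noteq> T"
    then have lt: "t0 < T" using t0 by simp
    \<comment> \<open>The tolerance \<open>D - d\<close> is positive by assumption and turns the
      source into exactly \<open>D\<close>.\<close>
    have "\<forall>\<^sub>F r in at_right t0. E r - E t0 \<le> (r - t0) * (c * E t0 + d + (D - d))"
      using dini[OF t0(1) lt, of "D - d"] d by simp
    moreover have "\<forall>\<^sub>F r in at_right t0. r > t0"
      by (rule eventually_at_right_less)
    ultimately have "\<forall>\<^sub>F r in at_right t0. E r \<le> B r"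
    proof eventually_elim
      case (elim r)
      have "c * E t0 + D \<le> c * B t0 + B t0"
        using at_t0 c BD[OF t0(1)] by (intro add_mono mult_left_mono)
      then have "(r - t0) * (c * E t0 + D) \<le> (r - t0) * (c * B t0 + B t0)"
        using elim(2) by (intro mult_left_mono) auto
      then have "E r \<le> B t0 + (r - t0) * (c * B t0 + B t0)"
        using elim(1) at_t0 by simp
      also have "\<dots> = B t0 * (1 + (c + 1) * (r - t0))"
        by (simp add: algebra_simps)
      also have "\<dots> \<le> B t0 * exp ((c + 1) * (r - t0))"
        using BD[OF t0(1)] D by (intro mult_left_mono exp_ge_add_one_self) auto
      also have "\<dots> = B r"
        by (simp add: B_def exp_add[symmetric] algebra_simps)
      finally show ?case .
    qed
    then obtain b where b: "b > t0" "\<And>r. r > t0 \<Longrightarrow> r < b \<Longrightarrow> E r \<le> B r"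
      by (auto simp: eventually_at_right_field)
    define r where "r = min ((t0 + b) / 2) T"
    have r: "t0 < r" "r < b" "r \<le> T"
      using b(1) lt by (auto simp: r_def min_less_iff_disj)
    have "E s \<le> B s" if "0 \<le> s" "s \<le> r" for s
      using that r b(2)[of s] below[of s] at_t0 by (cases s t0 rule: linorder_cases) auto
    then have "r \<in> A"
      using r t0 by (simp add: A_def)
    then have "r \<le> t0"
      unfolding t0_def by (intro cSup_upper bdd)
    then show False
      using r by simp
  qed
  then show ?thesis
    using below[of t] at_t0 t by (cases "t = T") (auto simp: B_def)
qed

section \<open>The Laplacian as a Fourier multiplier, and time regularity of the Euler
  solution\<close>

definition laplacian :: "vector_field \<Rightarrow> vector_field" where
  "laplacian u x = (\<chi> i. \<Sum>j\<in>UNIV. wd j (wd j (component u i)) x)"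

lemma laplacian_fourier:
  assumes u: "u \<in> Hv 3"
  shows "laplacian u \<in> Hv 1"
    "fourier_coeff (component (laplacian u) i) k = - (complex_of_real (W k - 1) * fourier_coeff (component u i) k)"
proof -
  have w1: "wd j (component u i) \<in> H 2" "fourier_coeff (wd j (component u i)) k = dsym j k * fourier_coeff (component u i) k" for i j k
    using wd_H(1,4)[OF _ Hv_H[OF u, of i], of j] by auto
  have w2: "wd j (wd j (component u i)) \<in> H 1"
    "fourier_coeff (wd j (wd j (component u i))) k = dsym j k * (dsym j k * fourier_coeff (component u i) k)" for i j k
    using wd_H(1,4)[OF _ w1(1)[of j i], of j] w1(2) by auto
  have comp: "component (laplacian u) i = (\<lambda>x. \<Sum>j\<in>UNIV. wd j (wd j (component u i)) x)" for i
    by (simp add: laplacian_def)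
  have "component (laplacian u) i \<in> H 1" for i
    unfolding comp by (rule H_sum(1)) (rule w2(1))
  then show "laplacian u \<in> Hv 1"
    by (simp only: Hv_def mem_Collect_eq) blast
  have "dsym j k * (dsym j k * z) = - (complex_of_real ((cmod (dsym j k))\<^sup>2) * z)" for j k z
    unfolding norm_dsym by (simp add: power2_eq_square)
  then have "fourier_coeff (component (laplacian u) i) k = (\<Sum>j\<in>UNIV. - (complex_of_real ((cmod (dsym j k))\<^sup>2) * fourier_coeff (component u i) k))"
    unfolding comp using w2(2) by (subst fourier_coeff_sum) (auto intro: H_L2[OF w2(1)])
  also have "\<dots> = - (complex_of_real (\<Sum>j\<in>UNIV. (cmod (dsym j k))\<^sup>2) * fourier_coeff (component u i) k)"
    by (simp only: sum_negf sum_distrib_right of_real_sum)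
  finally show "fourier_coeff (component (laplacian u) i) k = - (complex_of_real (W k - 1) * fourier_coeff (component u i) k)"
    unfolding sum_norm_dsym .
qed

text \<open>The Laplacian multiplies every component by the same scalar. Hence it yields admissible
  test fields, against which the pressure drops out.\<close>

lemma solenoidal_laplacian:
  assumes u: "u \<in> Hv 3" and sol: "solenoidal u"
  shows "solenoidal (laplacian u)"
  unfolding solenoidal_def
proof
  fix k
  have "(\<Sum>j\<in>UNIV. dsym j k * fourier_coeff (component (laplacian u) j) k)
    = (\<Sum>j\<in>UNIV. - complex_of_real (W k - 1) * (dsym j k * fourier_coeff (component u j) k))"
    unfolding laplacian_fourier(2)[OF u] by (intro sum.cong refl) (simp only: mult_minus_left mult_minus_right mult_ac)
  also have "\<dots> = - complex_of_real (W k - 1) * (\<Sum>j\<in>UNIV. dsym j k * fourier_coeff (component u j) k)"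
    by (simp only: sum_distrib_left)
  also have "\<dots> = 0"
    using sol unfolding solenoidal_def by (metis mult_zero_right)
  finally show "(\<Sum>j\<in>UNIV. dsym j k * fourier_coeff (component (laplacian u) j) k) = 0" .
qed

text \<open>Integration by parts, as an identity between the terms of two series.\<close>

lemma vip_laplacian:
  assumes u: "u \<in> Hv 3"
  shows "vip (\<lambda>_. 1) z (laplacian u) = - vip (\<lambda>k. W k - 1) z u"
proof -
  have "1 * Re (a * cnj (- (complex_of_real c * b))) = - (c * Re (a * cnj b))" for a b c
    by (simp add: algebra_simps)
  then show ?thesis
    unfolding vip_def laplacian_fourier(2)[OF u] by (simp only: infsum_uminus sum_negf)
qed

lemma deriv_curve_L2v_nrm:
  assumes D: "deriv_curve L2v_norm I v v'" and v: "\<And>r. r \<in> I \<Longrightarrow> v r \<in> L2v" and v': "\<And>r. r \<in> I \<Longrightarrow> v' r \<in> L2v"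
  shows "deriv_curve (nrm (\<lambda>_. 1)) I v v'"
  unfolding deriv_curve_def
proof
  fix t assume t: "t \<in> I"
  interpret fourier_weight "\<lambda>_. 1" by (rule fourier_weight_1)
  let ?q = "\<lambda>r x. (1 / (r - t)) *\<^sub>R (v r x - v t x) - v' t x"
  have q: "?q r \<in> L2v" if "r \<in> I" for r
    using v[OF that] v[OF t] v'[OF t] unfolding L2v_eq_Xv by (intro Xv_diff Xv_scale)
  have "((\<lambda>r. L2v_norm (?q r)) \<longlongrightarrow> 0) (at t within I)"
    using D t by (simp add: deriv_curve_def)
  moreover have "\<forall>\<^sub>F r in at t within I. L2v_norm (?q r) = nrm (\<lambda>_. 1) (?q r)"
    unfolding eventually_at_filter by (intro always_eventually allI impI L2v_norm_eq_nrm q)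
  ultimately show "((\<lambda>r. nrm (\<lambda>_. 1) (?q r)) \<longlongrightarrow> 0) (at t within I)"
    by (simp add: filterlim_cong)
qed

text \<open>Existence strictly beyond \<open>T\<close> makes [0,T] a compact part of the interval of
  existence, and \<open>R\<close> bounds the squared \<open>H 3\<close> norm there.\<close>

locale euler_flow =
  fixes v v' :: "real \<Rightarrow> vector_field" and p :: "real \<Rightarrow> scalar_field" and S T R :: real
  assumes T0: "0 < T" and TS: "T < S"
    and v3: "\<And>t. t \<in> {0..<S} \<Longrightarrow> v t \<in> Hv 3"
    and sol: "\<And>t. t \<in> {0..<S} \<Longrightarrow> solenoidal (v t)"
    and v'_L2: "\<And>t. t \<in> {0..<S} \<Longrightarrow> v' t \<in> L2v"
    and p_H1: "\<And>t. t \<in> {0..<S} \<Longrightarrow> p t \<in> H 1"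
    and cont: "cont_curve (Hv_norm 3) {0..<S} v"
    and deriv: "deriv_curve L2v_norm {0..<S} v v'"
    and momentum: "\<And>t. t \<in> {0..<S} \<Longrightarrow> AE x in Omega. v' t x + advect (v t) (v t) x + grad (p t) x = 0"
    and R: "\<And>t. t \<in> {0..T} \<Longrightarrow> vip (sobolev_weight 3) (v t) (v t) \<le> R"
begin

lemma v1: "t \<in> {0..<S} \<Longrightarrow> v t \<in> Hv 1"
  using Hv_mono[OF _ v3, of 1] by simp

lemma R_nonneg: "0 \<le> R"
  using R[of 0] T0 fourier_weight.vip_nonneg[OF fourier_weight_sobolev, of 3 "v 0"] by auto

text \<open>The pointwise equation integrated against a solenoidal field, to which the pressure
  gradient is orthogonal.\<close>

lemma euler_pairing:
  assumes t: "t \<in> {0..<S}" and z: "z \<in> Hv 1" and zs: "solenoidal z"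
  shows "vip (\<lambda>_. 1) (v' t) z = - inner_L2 (advect (v t) (v t)) z"
proof -
  note g = inner_grad_pressure[OF p_H1[OF t] Hv_L2v[OF z] zs]
  have dot: "integrable Omega (\<lambda>x. f x \<bullet> z x)" if "f \<in> L2v" for f
    unfolding inner_vec_def inner_real_def
    using that Hv_L2v[OF z] by (intro Bochner_Integration.integrable_sum L2_integrable_mult) (auto simp: L2v_def)
  note ia = inner_advect(2)[OF v1[OF t] v1[OF t] z]
  have "vip (\<lambda>_. 1) (v' t) z = (LINT x|Omega. v' t x \<bullet> z x)"
    using inner_L2_eq_vip[OF v'_L2[OF t] Hv_L2v[OF z]] by (simp add: inner_L2_def)
  also have "\<dots> = (LINT x|Omega. - (advect (v t) (v t) x \<bullet> z x) - grad (p t) x \<bullet> z x)"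
  proof (rule integral_cong_AE)
    show "AE x in Omega. v' t x \<bullet> z x = - (advect (v t) (v t) x \<bullet> z x) - grad (p t) x \<bullet> z x"
      using momentum[OF t]
    proof eventually_elim
      case (elim x)
      then have "v' t x = - advect (v t) (v t) x - grad (p t) x"
        by (simp add: algebra_simps eq_neg_iff_add_eq_0)
      then show ?case
        by (simp add: inner_diff_left)
    qed
  qed (use dot[OF v'_L2[OF t]] dot[OF g(1)] ia in \<open>auto intro!: borel_measurable_diff borel_measurable_uminus borel_measurable_integrable\<close>)
  also have "\<dots> = - (LINT x|Omega. advect (v t) (v t) x \<bullet> z x) - (LINT x|Omega. grad (p t) x \<bullet> z x)"
    using ia dot[OF g(1)] by simp
  finally show ?thesis
    using g(2) by (simp add: inner_L2_def)
qed

text \<open>The bound of \<open>advect_Hv1\<close> for the nonlinearity on [0,T], which becomes the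
  Lipschitz constant of the gradient of \<open>v\<close>.\<close>

definition M :: real where "M = sqrt (54 * CW * R\<^sup>2)"

lemma M_nonneg: "M \<ge> 0"
  by (simp add: M_def CW_nonneg)

text \<open>Testing the Euler equation with the Laplacian of the increment itself.\<close>

lemma Lipschitz_grad:
  assumes t: "t \<in> {0..T}" and r: "r \<in> {0..T}"
  shows "nrm (\<lambda>k. W k - 1) (\<lambda>x. v r x - v t x) \<le> M * \<bar>r - t\<bar>"
proof -
  interpret L: fourier_weight "\<lambda>_. 1" by (rule fourier_weight_1)
  interpret G: fourier_weight "\<lambda>k. W k - 1" by (rule fourier_weight_grad)
  have sub: "s \<in> {0..<S}" if "s \<in> {0..T}" for s
    using that TS by auto
  define \<phi> where "\<phi> = (\<lambda>x. v r x - v t x)"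
  have \<phi>3: "\<phi> \<in> Hv 3"
    unfolding \<phi>_def by (intro Hv_diff v3 sub t r)
  have \<phi>s: "solenoidal \<phi>"
    unfolding \<phi>_def by (intro solenoidal_diff Hv_L2v[OF v3] sol sub t r)
  have G1: "Hv 1 \<subseteq> Xv (\<lambda>k. W k - 1)"
    unfolding Hv_eq_Xv using W_ge_1 by (auto intro!: Xv_le[of "\<lambda>k. W k - 1" 1 "sobolev_weight 1"] simp: sobolev_weight_1)
  have \<phi>G: "\<phi> \<in> Xv (\<lambda>k. W k - 1)"
    using Hv_mono[OF _ \<phi>3, of 1] G1 by auto
  note lap = laplacian_fourier(1)[OF \<phi>3]
  have lapX: "laplacian \<phi> \<in> Xv (\<lambda>_. 1)"
    using Hv_L2v[OF lap] by (simp only: L2v_eq_Xv)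
  have vX: "v s \<in> Xv (\<lambda>_. 1)" "v' s \<in> Xv (\<lambda>_. 1)" if "s \<in> {0..<S}" for s
    using Hv_L2v[OF v3[OF that]] v'_L2[OF that] by (simp_all only: L2v_eq_Xv)
  \<comment> \<open>The increment \<open>\<phi>\<close> is frozen, so \<open>h\<close> is a real
    function differentiable on [0,T]; the mean value inequality between \<open>t\<close> and
    \<open>r\<close> applies to it.\<close>
  define h where "h s = vip (\<lambda>_. 1) (v s) (laplacian \<phi>)" for s
  define h' where "h' s = vip (\<lambda>_. 1) (v' s) (laplacian \<phi>)" for s
  have D: "deriv_curve (nrm (\<lambda>_. 1)) {0..<S} v v'"
    by (rule deriv_curve_L2v_nrm[OF deriv Hv_L2v[OF v3] v'_L2])
  have hd: "(h has_field_derivative h' s) (at s within {0..T})" if "s \<in> {0..T}" for s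
  proof (rule has_field_derivative_subset)
    show "(h has_field_derivative h' s) (at s within {0..<S})"
      unfolding h_def h'_def by (rule L.vip_has_derivative[OF D sub[OF that] vX(1) vX(2)[OF sub[OF that]] lapX])
    show "{0..T} \<subseteq> {0..<S}"
      using sub by auto
  qed
  have h'_le: "norm (h' s) \<le> M * nrm (\<lambda>k. W k - 1) \<phi>" if s: "s \<in> {0..T}" for s
  proof -
    note adv = advect_Hv1[OF v3[OF sub[OF s]]]
    let ?a = "advect (v s) (v s)"
    have aG: "?a \<in> Xv (\<lambda>k. W k - 1)"
      using adv(1) G1 by auto
    have "h' s = - inner_L2 ?a (laplacian \<phi>)"
      unfolding h'_def by (rule euler_pairing[OF sub[OF s] lap solenoidal_laplacian[OF \<phi>3 \<phi>s]])
    also have "\<dots> = vip (\<lambda>k. W k - 1) ?a \<phi>"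
      using inner_L2_eq_vip[OF Hv_L2v[OF adv(1)] Hv_L2v[OF lap]] vip_laplacian[OF \<phi>3] by simp
    finally have "norm (h' s) \<le> nrm (\<lambda>k. W k - 1) ?a * nrm (\<lambda>k. W k - 1) \<phi>"
      using G.vip_Cauchy_Schwarz[OF aG \<phi>G] by simp
    also have "nrm (\<lambda>k. W k - 1) ?a \<le> M"
    proof -
      have "vip (\<lambda>k. W k - 1) ?a ?a \<le> 1 * vip (sobolev_weight 1) ?a ?a"
        using adv(1) W_ge_1
        by (intro fourier_weight.vip_mono[OF fourier_weight_sobolev]) (auto simp: Hv_eq_Xv sobolev_weight_1)
      also have "\<dots> \<le> 54 * CW * (vip (sobolev_weight 3) (v s) (v s))\<^sup>2"
        using adv(2) by simp
      also have "\<dots> \<le> 54 * CW * R\<^sup>2"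
        using R[OF s] fourier_weight.vip_nonneg[OF fourier_weight_sobolev]
        by (intro mult_left_mono power_mono) (auto simp: CW_nonneg)
      finally show ?thesis
        unfolding nrm_def M_def by (rule real_sqrt_le_mono)
    qed
    finally show ?thesis
      using G.nrm_nonneg by (simp add: mult_right_mono)
  qed
  have "norm (h r - h t) \<le> M * nrm (\<lambda>k. W k - 1) \<phi> * norm (r - t)"
    by (rule field_differentiable_bound[OF _ hd h'_le]) (use t r in auto)
  \<comment> \<open>The increment of \<open>h\<close> pairs \<open>\<phi>\<close> with its own
    Laplacian. The mean value inequality thus bounds a square by a multiple of its root, and one
    factor cancels.\<close>
  moreover have "h r - h t = - (nrm (\<lambda>k. W k - 1) \<phi>)\<^sup>2"
    using L.vip_diff_left[OF vX(1)[OF sub[OF r]] vX(1)[OF sub[OF t]] lapX] vip_laplacian[OF \<phi>3, of \<phi>]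
    by (simp add: h_def G.nrm_power2 \<phi>_def)
  ultimately have le: "(nrm (\<lambda>k. W k - 1) \<phi>)\<^sup>2 \<le> M * nrm (\<lambda>k. W k - 1) \<phi> * \<bar>r - t\<bar>"
    by simp
  show ?thesis
  proof (cases "nrm (\<lambda>k. W k - 1) \<phi> = 0")
    case True
    then show ?thesis
      using M_nonneg by (simp add: \<phi>_def[symmetric])
  next
    case False
    then have pos: "nrm (\<lambda>k. W k - 1) \<phi> > 0"
      using G.nrm_nonneg[of \<phi>] by simp
    have "nrm (\<lambda>k. W k - 1) \<phi> * nrm (\<lambda>k. W k - 1) \<phi> \<le> nrm (\<lambda>k. W k - 1) \<phi> * (M * \<bar>r - t\<bar>)"
      using le by (simp add: power2_eq_square mult_ac)
    then show ?thesis
      using pos by (simp add: \<phi>_def[symmetric])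
  qed
qed

end

section \<open>The Voigt energy and the comparison estimate\<close>

lemma Hv1_subset_Xv:
  assumes "\<And>k. 0 \<le> m k" "\<And>k. m k \<le> c * W k" "u \<in> Hv 1"
  shows "u \<in> Xv m"
  using Xv_le[of m c "sobolev_weight 1" u] assms by (simp add: Hv_eq_Xv sobolev_weight_1)

text \<open>The symbol of the identity minus \<open>\<alpha>^2\<close> times the Laplacian, so that
  \<open>vip\<close> with this weight is the quadratic form of the energy \<open>E\<close>.\<close>

definition voigt_weight :: "real \<Rightarrow> int^3 \<Rightarrow> real" where
  "voigt_weight \<alpha> k = 1 + \<alpha>\<^sup>2 * (W k - 1)"

lemma voigt_weight_ge_1: "1 \<le> voigt_weight \<alpha> k"
  using W_ge_1[of k] by (simp add: voigt_weight_def)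

text \<open>The constant is written as a square so that the norms compare with the factor
  \<open>1 + \<alpha>\<close>.\<close>

lemma voigt_weight_le:
  assumes "\<alpha> > 0"
  shows "voigt_weight \<alpha> k \<le> (1 + \<alpha>)\<^sup>2 * W k"
proof -
  have "voigt_weight \<alpha> k \<le> W k + \<alpha>\<^sup>2 * W k"
    unfolding voigt_weight_def using W_ge_1[of k] by (intro add_mono mult_left_mono) auto
  also have "\<dots> \<le> (1 + \<alpha>)\<^sup>2 * W k"
    using assms W_pos[of k] by (simp add: power2_eq_square algebra_simps)
  finally show ?thesis .
qed

lemma fourier_weight_voigt: "fourier_weight (voigt_weight \<alpha>)"
  using voigt_weight_ge_1[of \<alpha>] by (auto simp: fourier_weight_def intro: order_trans[of 0 1])

lemma vip_voigt:
  assumes u: "u \<in> Hv 1" and v: "v \<in> Hv 1"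
  shows "vip (voigt_weight \<alpha>) u v = vip (\<lambda>_. 1) u v + \<alpha>\<^sup>2 * vip (\<lambda>k. W k - 1) u v"
proof -
  let ?p = "\<lambda>i k. Re (fourier_coeff (component u i) k * cnj (fourier_coeff (component v i) k))"
  have X: "z \<in> Xv (\<lambda>_. 1)" "z \<in> Xv (\<lambda>k. W k - 1)" if "z \<in> Hv 1" for z
    using W_ge_1 by (auto intro!: Hv1_subset_Xv[of _ 1] that)
  have s1: "(\<lambda>k. 1 * ?p i k) summable_on UNIV" for i
    by (rule fourier_weight.summable_cross[OF fourier_weight_1 X(1)[OF u] X(1)[OF v]])
  have s2: "(\<lambda>k. (W k - 1) * ?p i k) summable_on UNIV" for i
    by (rule fourier_weight.summable_cross[OF fourier_weight_grad X(2)[OF u] X(2)[OF v]])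
  have "(\<Sum>\<^sub>\<infinity>k. voigt_weight \<alpha> k * ?p i k) = (\<Sum>\<^sub>\<infinity>k. 1 * ?p i k) + \<alpha>\<^sup>2 * (\<Sum>\<^sub>\<infinity>k. (W k - 1) * ?p i k)" for i
  proof -
    have "(\<Sum>\<^sub>\<infinity>k. voigt_weight \<alpha> k * ?p i k) = (\<Sum>\<^sub>\<infinity>k. 1 * ?p i k + \<alpha>\<^sup>2 * ((W k - 1) * ?p i k))"
      unfolding voigt_weight_def by (simp only: distrib_right mult.assoc)
    also have "\<dots> = (\<Sum>\<^sub>\<infinity>k. 1 * ?p i k) + (\<Sum>\<^sub>\<infinity>k. \<alpha>\<^sup>2 * ((W k - 1) * ?p i k))"
      by (intro infsum_add s1 summable_on_cmult_right s2)
    finally show ?thesis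
      by (simp only: infsum_cmult_right')
  qed
  then show ?thesis
    unfolding vip_def by (simp only: sum.distrib sum_distrib_left)
qed

text \<open>The time-derivative terms of the weak equation form the Voigt pairing, and a solenoidal
  test field annihilates the pressure.\<close>

lemma voigt_pairing:
  assumes u: "u \<in> Hv 1" and u': "u' \<in> Hv 1" and z: "z \<in> Hv 1" and zs: "solenoidal z"
    and eq: "\<alpha>\<^sup>2 * inner_grad u' z + inner_L2 u' z + inner_L2 (advect u u) z
             - (LINT x|Omega. q x * divergence z x) = 0"
  shows "vip (voigt_weight \<alpha>) u' z = - inner_L2 (advect u u) z"
proof -
  have "AE x in Omega. divergence z x = 0"
    using zs solenoidal_iff[OF z] by (simp add: divergence_free_def)
  then have "(LINT x|Omega. q x * divergence z x) = 0"
    by (intro integral_eq_zero_AE) (auto elim!: eventually_mono)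
  then show ?thesis
    using eq unfolding vip_voigt[OF u' z] inner_grad_eq_vip[OF u' z]
      inner_L2_eq_vip[OF Hv_L2v[OF u'] Hv_L2v[OF z]] by simp
qed

lemma abs_bound_tendsto:
  fixes f g :: "'a \<Rightarrow> real"
  assumes "\<forall>\<^sub>F x in F. \<bar>f x - l\<bar> \<le> g x" "(g \<longlongrightarrow> 0) F"
  shows "(f \<longlongrightarrow> l) F"
proof (rule LIM_zero_cancel, rule tendsto_rabs_zero_cancel)
  show "((\<lambda>x. \<bar>f x - l\<bar>) \<longlongrightarrow> 0) F"
    by (rule tendsto_sandwich[OF _ assms(1) tendsto_const assms(2)]) simp
qed

lemma nrm_mono_Hv:
  assumes "u \<in> Hv s" "\<And>k. 0 \<le> m k" "\<And>k. m k \<le> c\<^sup>2 * sobolev_weight s k" "c \<ge> 0"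
  shows "nrm m u \<le> c * nrm (sobolev_weight s) u"
  by (rule fourier_weight.nrm_mono[OF fourier_weight_sobolev]) (use assms in \<open>auto simp: Hv_eq_Xv\<close>)

lemma diff_diff_le:
  "x \<le> A \<Longrightarrow> B \<le> y \<Longrightarrow> - z \<le> C \<Longrightarrow> x - y - z \<le> A - B + (C :: real)"
  by linarith

context euler_flow
begin

text \<open>The Gronwall bound at time \<open>T\<close> without its factor
  \<open>\<alpha>^2\<close>: the rate is one more than \<open>c = 6 * sqrt (CW * R) + 1\<close>, and
  the 1 added to \<open>M^2\<close> provides the strict inequality between source and
  barrier.\<close>

definition growth :: real where
  "growth = (M\<^sup>2 + 1) * exp ((6 * sqrt (CW * R) + 1 + 1) * T)"

text \<open>The difference of the nonlinearities is \<open>u\<close> advecting \<open>w\<close> plus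
  \<open>w\<close> advecting \<open>v\<close>. The first is orthogonal to \<open>w\<close> because
  \<open>u\<close> is solenoidal; the second costs only the maximum of the gradient of
  \<open>v\<close>.\<close>

lemma advect_difference:
  assumes t: "t \<in> {0..T}" and u: "u \<in> Hv 1" and us: "solenoidal u"
  defines "w \<equiv> \<lambda>x. u x - v t x"
  shows "inner_L2 (advect (v t) (v t)) w - inner_L2 (advect u u) w \<le> 3 * sqrt (CW * R) * vip (\<lambda>_. 1) w w"
proof -
  have tS: "t \<in> {0..<S}"
    using t TS by auto
  note vt = v1[OF tS]
  have w: "w \<in> Hv 1"
    unfolding w_def by (rule Hv_diff[OF u vt])
  have "inner_L2 (advect u w) w = 0"
    by (rule inner_advect_self[OF u us w])
  then have 1: "inner_L2 (advect u u) w = inner_L2 (advect u (v t)) w"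
    using inner_advect_diff_right[OF u u vt w] by (simp add: w_def)
  have 2: "inner_L2 (advect w (v t)) w = inner_L2 (advect u (v t)) w - inner_L2 (advect (v t) (v t)) w"
    using inner_advect_diff_left[OF u vt vt w] by (simp add: w_def)
  have "AE x in Omega. \<bar>wd j (component (v t) i) x\<bar> \<le> sqrt (CW * R)" for i j
    using wd_bounded_Hv3[OF v3[OF tS], of j i]
  proof eventually_elim
    case (elim x)
    also have "sqrt (CW * vip (sobolev_weight 3) (v t) (v t)) \<le> sqrt (CW * R)"
      by (intro real_sqrt_le_mono mult_left_mono CW_nonneg R t)
    finally show ?case .
  qed
  from inner_advect_bound[OF vt w this]
  show ?thesis
    using 1 2 by linarith
qed

lemma voigt_grad_bound:
  assumes \<alpha>: "\<alpha> > 0" and voigt: "euler_voigt_solution \<alpha> u0 u"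
    and init: "AE x in Omega. v 0 x = u0 x" and t: "t \<in> {0..T}"
  shows "grad_norm (u t) \<le> sqrt growth + sqrt R"
proof -
  let ?m = "voigt_weight \<alpha>" and ?g = "\<lambda>k. W k - 1" and ?L = "sqrt (CW * R)"
  interpret A: fourier_weight ?m by (rule fourier_weight_voigt)
  interpret L: fourier_weight "\<lambda>_. 1" by (rule fourier_weight_1)
  interpret G: fourier_weight ?g by (rule fourier_weight_grad)
  have uV: "u t \<in> V" and u0: "AE x in Omega. u 0 x = u0 x" for t
    using voigt by (simp_all add: euler_voigt_solution_def)
  obtain u' q where du: "deriv_curve (Hv_norm 1) UNIV u u'" and u'V: "\<forall>t. u' t \<in> V"
    and weak_all: "\<forall>t. \<forall>z\<in>Hv 1. \<alpha>\<^sup>2 * inner_grad (u' t) z + inner_L2 (u' t) z + inner_L2 (advect (u t) (u t)) z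
             - (LINT x|Omega. q t x * divergence z x) = 0"
    using voigt unfolding euler_voigt_solution_def by (elim conjE exE) (rule that, assumption+)
  have weak: "\<alpha>\<^sup>2 * inner_grad (u' t) z + inner_L2 (u' t) z + inner_L2 (advect (u t) (u t)) z
             - (LINT x|Omega. q t x * divergence z x) = 0" if "z \<in> Hv 1" for t z
    using weak_all that by blast
  have u1: "u t \<in> Hv 1" and u'1: "u' t \<in> Hv 1" and us: "solenoidal (u t)" for t
    using uV[of t] u'V solenoidal_iff[of "u t"] by (auto simp: V_def)
  have sub: "s \<in> {0..<S}" if "s \<in> {0..T}" for s
    using that TS by auto
  have m0: "0 \<le> ?m k" for k
    using voigt_weight_ge_1[of \<alpha> k] by simp
  have XA: "z \<in> Xv ?m" and XL: "z \<in> Xv (\<lambda>_. 1)" and XG: "z \<in> Xv ?g" if "z \<in> Hv 1" for z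
  proof -
    show "z \<in> Xv ?m"
      by (rule Hv1_subset_Xv[OF m0 voigt_weight_le[OF \<alpha>] that])
    show "z \<in> Xv (\<lambda>_. 1)" "z \<in> Xv ?g"
      using W_ge_1 by (auto intro!: Hv1_subset_Xv[of _ 1] that)
  qed
  \<comment> \<open>The \<open>H 1\<close> norm dominates the Voigt norm up to
    \<open>1 + \<alpha>\<close>, so differentiability in time carries over.\<close>
  have duA: "deriv_curve (nrm ?m) UNIV u u'"
    unfolding deriv_curve_def
  proof
    fix s
    let ?q = "\<lambda>r x. (1 / (r - s)) *\<^sub>R (u r x - u s x) - u' s x"
    have q1: "?q r \<in> Hv 1" for r
      using u1 u'1 unfolding Hv_eq_Xv
      by (intro fourier_weight.Xv_diff[OF fourier_weight_sobolev] fourier_weight.Xv_scale[OF fourier_weight_sobolev])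
    have "((\<lambda>r. (1 + \<alpha>) * nrm (sobolev_weight 1) (?q r)) \<longlongrightarrow> (1 + \<alpha>) * 0) (at s within UNIV)"
      using du by (intro tendsto_intros) (simp add: deriv_curve_def Hv_norm_eq_nrm)
    then have lim: "((\<lambda>r. (1 + \<alpha>) * nrm (sobolev_weight 1) (?q r)) \<longlongrightarrow> 0) (at s within UNIV)"
      by simp
    have le: "nrm ?m (?q r) \<le> (1 + \<alpha>) * nrm (sobolev_weight 1) (?q r)" for r
      using \<alpha> m0 voigt_weight_le[OF \<alpha>] by (intro nrm_mono_Hv q1) (auto simp: sobolev_weight_1)
    show "((\<lambda>r. nrm ?m (?q r)) \<longlongrightarrow> 0) (at s within UNIV)"
      by (rule tendsto_sandwich[OF _ _ tendsto_const lim]) (auto simp: A.nrm_nonneg le)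
  qed
  have dvL: "deriv_curve (nrm (\<lambda>_. 1)) {0..<S} v v'"
    by (rule deriv_curve_L2v_nrm[OF deriv Hv_L2v[OF v3] v'_L2])
  have vXL: "v s \<in> Xv (\<lambda>_. 1)" and v'XL: "v' s \<in> Xv (\<lambda>_. 1)" if "s \<in> {0..<S}" for s
    using Hv_L2v[OF v3[OF that]] v'_L2[OF that] by (simp_all only: L2v_eq_Xv)
  define w where "w s = (\<lambda>x. u s x - v s x)" for s
  have w1: "w s \<in> Hv 1" if "s \<in> {0..<S}" for s
    unfolding w_def by (rule Hv_diff[OF u1 v1[OF that]])
  have ws: "solenoidal (w s)" if "s \<in> {0..<S}" for s
    unfolding w_def by (rule solenoidal_diff[OF Hv_L2v[OF u1] Hv_L2v[OF v1[OF that]] us sol[OF that]])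
  define E where "E s = vip ?m (w s) (w s)" for s
  have E_split: "E s = vip (\<lambda>_. 1) (w s) (w s) + \<alpha>\<^sup>2 * (nrm ?g (w s))\<^sup>2" if "s \<in> {0..<S}" for s
    unfolding E_def G.nrm_power2 by (rule vip_voigt[OF w1[OF that] w1[OF that]])
  have incr: "nrm ?m (\<lambda>x. w r x - w s x) \<le> nrm ?m (\<lambda>x. u r x - u s x) + nrm ?m (\<lambda>x. v r x - v s x)"
    if "r \<in> {0..<S}" "s \<in> {0..<S}" for r s
  proof -
    have e: "(\<lambda>x. w r x - w s x) = (\<lambda>x. (u r x - u s x) - (v r x - v s x))"
      by (auto simp: w_def algebra_simps)
    show ?thesis
      unfolding e by (intro A.nrm_diff_le XA Hv_diff u1 v1 that)
  qed
  \<comment> \<open>\<open>u\<close> is continuous because it is locally Lipschitz in the Voigt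
    norm, \<open>v\<close> because the \<open>H 3\<close> norm dominates that norm up to
    \<open>1 + \<alpha>\<close>.\<close>
  have contE: "continuous_on {0..T} E"
  proof -
    have "continuous_on {0..T} (\<lambda>s. nrm ?m (w s))"
      unfolding continuous_on_def
    proof
      fix s assume s: "s \<in> {0..T}"
      let ?F = "at s within {0..T}"
      have ev: "\<forall>\<^sub>F r in ?F. r \<in> {0..T}"
        by (simp add: eventually_at_filter)
      have "\<forall>\<^sub>F r in at s within UNIV. nrm ?m (\<lambda>x. u r x - u s x) \<le> \<bar>r - s\<bar> * (nrm ?m (u' s) + 1)"
        by (rule A.deriv_curve_Lipschitz[OF duA UNIV_I XA[OF u1] XA[OF u'1]])
      then have evu: "\<forall>\<^sub>F r in ?F. nrm ?m (\<lambda>x. u r x - u s x) \<le> \<bar>r - s\<bar> * (nrm ?m (u' s) + 1)"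
        by (rule filter_leD[OF at_le[OF subset_UNIV]])
      have "((\<lambda>r. nrm (sobolev_weight 3) (\<lambda>x. v r x - v s x)) \<longlongrightarrow> 0) (at s within {0..<S})"
        using cont sub[OF s] by (simp add: cont_curve_def Hv_norm_eq_nrm)
      then have limv: "((\<lambda>r. nrm (sobolev_weight 3) (\<lambda>x. v r x - v s x)) \<longlongrightarrow> 0) ?F"
        by (rule tendsto_within_subset) (use sub in auto)
      have "((\<lambda>r. \<bar>r - s\<bar> * (nrm ?m (u' s) + 1) + (1 + \<alpha>) * nrm (sobolev_weight 3) (\<lambda>x. v r x - v s x))
          \<longlongrightarrow> \<bar>s - s\<bar> * (nrm ?m (u' s) + 1) + (1 + \<alpha>) * 0) ?F"
        by (intro tendsto_intros limv)
      then have lim: "((\<lambda>r. \<bar>r - s\<bar> * (nrm ?m (u' s) + 1) + (1 + \<alpha>) * nrm (sobolev_weight 3) (\<lambda>x. v r x - v s x)) \<longlongrightarrow> 0) ?F"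
        by simp
      have "\<forall>\<^sub>F r in ?F. \<bar>nrm ?m (w r) - nrm ?m (w s)\<bar>
        \<le> \<bar>r - s\<bar> * (nrm ?m (u' s) + 1) + (1 + \<alpha>) * nrm (sobolev_weight 3) (\<lambda>x. v r x - v s x)"
        using ev evu
      proof eventually_elim
        case (elim r)
        have W3: "?m k \<le> (1 + \<alpha>)\<^sup>2 * sobolev_weight 3 k" for k
        proof -
          have "W k \<le> W k ^ 3"
            using power_increasing[of 1 3 "W k"] W_ge_1[of k] by simp
          then have "(1 + \<alpha>)\<^sup>2 * W k \<le> (1 + \<alpha>)\<^sup>2 * sobolev_weight 3 k"
            unfolding sobolev_weight_3 by (intro mult_left_mono) auto
          then show ?thesis
            using voigt_weight_le[OF \<alpha>, of k] by linarith
        qed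
        have "nrm ?m (\<lambda>x. v r x - v s x) \<le> (1 + \<alpha>) * nrm (sobolev_weight 3) (\<lambda>x. v r x - v s x)"
          using \<alpha> by (intro nrm_mono_Hv Hv_diff v3 sub elim(1) s m0 W3) auto
        moreover have "\<bar>nrm ?m (w r) - nrm ?m (w s)\<bar> \<le> nrm ?m (\<lambda>x. w r x - w s x)"
          by (intro A.nrm_abs_diff XA w1 sub elim(1) s)
        ultimately show ?case
          using incr[OF sub[OF elim(1)] sub[OF s]] elim(2) by linarith
      qed
      then show "((\<lambda>s. nrm ?m (w s)) \<longlongrightarrow> nrm ?m (w s)) ?F"
        by (rule abs_bound_tendsto[OF _ lim])
    qed
    then have "continuous_on {0..T} (\<lambda>s. (nrm ?m (w s))\<^sup>2)"
      by (intro continuous_intros)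
    then show ?thesis
      by (simp add: E_def A.nrm_power2)
  qed
  have E0: "E 0 = 0"
  proof -
    have 0: "0 \<in> {0..<S}"
      using T0 TS by simp
    have "AE x in Omega. w 0 x = 0"
      using u0 init by eventually_elim (simp add: w_def)
    then have "E 0 = vip ?m (\<lambda>x. 0) (w 0)"
      unfolding E_def by (rule vip_cong_AE[OF _ Hv_L2v[OF w1[OF 0]]]) (simp_all add: L2v_def L2_zero)
    also have "\<dots> = 0"
      by (simp add: vip_def fourier_coeff_zero)
    finally show ?thesis .
  qed
  \<comment> \<open>\<open>E r\<close> is expanded around \<open>w s\<close>: the linear term
    carries the estimate, and the square of the increment is of second order in
    \<open>r - s\<close>, hence absorbed by \<open>e\<close>.\<close>
  have dini: "\<forall>\<^sub>F r in at_right s. E r - E s \<le> (r - s) * ((6 * ?L + 1) * E s + \<alpha>\<^sup>2 * M\<^sup>2 + e)"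
    if s0: "0 \<le> s" and sT: "s < T" and e: "e > 0" for s e
  proof -
    have s: "s \<in> {0..T}" "s \<in> {0..<S}"
      using s0 sT TS by auto
    have ev: "\<forall>\<^sub>F r in at_right s. r \<in> {0..T} \<and> s < r"
      unfolding eventually_at_right_field using s0 sT by (intro exI[of _ T]) auto
    have right: "at_right s \<le> at s within {0..<S}"
    proof -
      have "at s within {s..T} \<le> at s within {0..<S}"
        using s0 TS by (intro at_le) auto
      then show ?thesis
        using at_within_Icc_at_right[OF sT] by simp
    qed
    have rightU: "at_right s \<le> at s within UNIV"
      by (rule at_le) simp
    define P where "P = nrm ?m (u' s) + 1"
    define Q where "Q = nrm (\<lambda>_. 1) (v' s) + 1"
    \<comment> \<open>\<open>K * (r - s)^2\<close> will bound the energy of the increment of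
      \<open>w\<close>: \<open>P\<close> controls the part of \<open>u\<close>, \<open>Q\<close> and
      \<open>M\<close> the value and gradient parts of \<open>v\<close>.\<close>
    define K where "K = 2 * P\<^sup>2 + 2 * (Q\<^sup>2 + \<alpha>\<^sup>2 * M\<^sup>2)"
    have K0: "K \<ge> 0"
      by (simp add: K_def)
    have lipu: "\<forall>\<^sub>F r in at_right s. nrm ?m (\<lambda>x. u r x - u s x) \<le> \<bar>r - s\<bar> * P"
      unfolding P_def
      by (rule filter_leD[OF rightU A.deriv_curve_Lipschitz[OF duA UNIV_I XA[OF u1] XA[OF u'1]]])
    have lipv: "\<forall>\<^sub>F r in at_right s. nrm (\<lambda>_. 1) (\<lambda>x. v r x - v s x) \<le> \<bar>r - s\<bar> * Q"
      unfolding Q_def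
      by (rule filter_leD[OF right L.deriv_curve_Lipschitz[OF dvL s(2) vXL v'XL[OF s(2)]]])
    let ?w = "w s"
    \<comment> \<open>\<open>a\<close> pairs the derivative of \<open>u\<close> in the Voigt form,
      \<open>b\<close> that of \<open>v\<close> in the \<open>L2\<close> form only; the gradient
      part of the increment of \<open>v\<close> enters through \<open>Lipschitz_grad\<close>
      instead.\<close>
    define a where "a = vip ?m (u' s) ?w"
    define b where "b = vip (\<lambda>_. 1) (v' s) ?w"
    have "((\<lambda>r. vip ?m (u r) ?w) has_real_derivative a) (at s within UNIV)"
      unfolding a_def by (rule A.vip_has_derivative[OF duA UNIV_I XA[OF u1] XA[OF u'1] XA[OF w1[OF s(2)]]])
    then have "((\<lambda>r. (vip ?m (u r) ?w - vip ?m (u s) ?w) / (r - s)) \<longlongrightarrow> a) (at_right s)"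
      unfolding has_field_derivative_iff by (rule tendsto_mono[OF rightU])
    then have da: "\<forall>\<^sub>F r in at_right s. (vip ?m (u r) ?w - vip ?m (u s) ?w) / (r - s) < a + e / 8"
      by (rule order_tendstoD) (use e in simp)
    have "((\<lambda>r. vip (\<lambda>_. 1) (v r) ?w) has_real_derivative b) (at s within {0..<S})"
      unfolding b_def by (rule L.vip_has_derivative[OF dvL s(2) vXL v'XL[OF s(2)] XL[OF w1[OF s(2)]]])
    then have "((\<lambda>r. (vip (\<lambda>_. 1) (v r) ?w - vip (\<lambda>_. 1) (v s) ?w) / (r - s)) \<longlongrightarrow> b) (at_right s)"
      unfolding has_field_derivative_iff by (rule tendsto_mono[OF right])
    then have db: "\<forall>\<^sub>F r in at_right s. (vip (\<lambda>_. 1) (v r) ?w - vip (\<lambda>_. 1) (v s) ?w) / (r - s) > b - e / 8"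
      by (rule order_tendstoD) (use e in simp)
    have small: "\<forall>\<^sub>F r in at_right s. r - s < e / (4 * (K + 1))"
    proof -
      have "e / (4 * (K + 1)) > 0"
        using e K0 by (intro divide_pos_pos) auto
      then show ?thesis
        unfolding eventually_at_right_field by (intro exI[of _ "s + e / (4 * (K + 1))"]) auto
    qed
    \<comment> \<open>Both equations are tested with the same solenoidal field \<open>w s\<close>,
      so only the difference of the two nonlinearities remains.\<close>
    have ab: "a - b \<le> 3 * ?L * vip (\<lambda>_. 1) ?w ?w"
      using advect_difference[OF s(1) u1[of s] us[of s]]
        voigt_pairing[OF u1[of s] u'1[of s] w1[OF s(2)] ws[OF s(2)] weak[OF w1[OF s(2)]]] euler_pairing[OF s(2) w1[OF s(2)] ws[OF s(2)]]
      unfolding a_def b_def w_def by simp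
    show ?thesis
      using ev lipu lipv da db small
    proof eventually_elim
      case (elim r)
      then have r: "r \<in> {0..T}" "r \<in> {0..<S}" "s < r"
        using sub by auto
      let ?h = "r - s"
      have h: "?h > 0" "\<bar>?h\<bar> = ?h"
        using r by auto
      let ?du = "\<lambda>x. u r x - u s x" and ?dv = "\<lambda>x. v r x - v s x" and ?dw = "\<lambda>x. w r x - w s x"
      have du1: "?du \<in> Hv 1" and dv1: "?dv \<in> Hv 1" and dw1: "?dw \<in> Hv 1"
        by (intro Hv_diff u1 v1 w1 r s)+
      have dw_eq: "?dw = (\<lambda>x. ?du x - ?dv x)"
        by (auto simp: w_def algebra_simps)
      note W1 = w1[OF s(2)]
      have lip: "nrm ?g ?dv \<le> M * ?h"
        using Lipschitz_grad[OF s(1) r(1)] h by simp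
      \<comment> \<open>The budget for \<open>e\<close>: the two slacks of \<open>e / 8\<close> are
        doubled by the factor 2 of the linear term, and with \<open>e / 4\<close> from the quadratic
        term they add up to \<open>3 * e / 4\<close>.\<close>
      have cross: "vip ?m ?dw ?w \<le> ?h * (a + e / 8) - ?h * (b - e / 8) + \<alpha>\<^sup>2 * (M * ?h * nrm ?g ?w)"
      proof -
        have "vip ?m ?dw ?w = vip ?m ?du ?w - vip ?m ?dv ?w"
          unfolding dw_eq by (rule A.vip_diff_left[OF XA[OF du1] XA[OF dv1] XA[OF W1]])
        also have "vip ?m ?dv ?w = vip (\<lambda>_. 1) ?dv ?w + \<alpha>\<^sup>2 * vip ?g ?dv ?w"
          by (rule vip_voigt[OF dv1 W1])
        finally have 1: "vip ?m ?dw ?w = vip ?m ?du ?w - vip (\<lambda>_. 1) ?dv ?w - \<alpha>\<^sup>2 * vip ?g ?dv ?w"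
          by simp
        have "vip ?m ?du ?w \<le> ?h * (a + e / 8)"
          using elim(4) h A.vip_diff_left[OF XA[OF u1] XA[OF u1] XA[OF W1], of r s]
          by (simp add: divide_less_eq mult.commute less_imp_le)
        moreover have "vip (\<lambda>_. 1) ?dv ?w \<ge> ?h * (b - e / 8)"
          using elim(5) h L.vip_diff_left[OF vXL[OF r(2)] vXL[OF s(2)] XL[OF W1]]
          by (simp add: less_divide_eq mult.commute less_imp_le)
        moreover have "- (\<alpha>\<^sup>2 * vip ?g ?dv ?w) \<le> \<alpha>\<^sup>2 * (M * ?h * nrm ?g ?w)"
        proof -
          have "- vip ?g ?dv ?w \<le> nrm ?g ?dv * nrm ?g ?w"
            using G.vip_Cauchy_Schwarz[OF XG[OF dv1] XG[OF W1]] by linarith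
          also have "\<dots> \<le> M * ?h * nrm ?g ?w"
            by (intro mult_right_mono lip G.nrm_nonneg)
          finally have "\<alpha>\<^sup>2 * (- vip ?g ?dv ?w) \<le> \<alpha>\<^sup>2 * (M * ?h * nrm ?g ?w)"
            by (intro mult_left_mono) auto
          then show ?thesis by simp
        qed
        ultimately show ?thesis
          unfolding 1 by (rule diff_diff_le)
      qed
      have quad: "vip ?m ?dw ?dw \<le> ?h * (e / 4)"
      proof -
        have "nrm ?m ?dv ^ 2 \<le> (?h * Q)\<^sup>2 + \<alpha>\<^sup>2 * (M * ?h)\<^sup>2"
          unfolding A.nrm_power2 vip_voigt[OF dv1 dv1] L.nrm_power2[symmetric] G.nrm_power2[symmetric]
          using elim(3) h lip by (intro add_mono power_mono mult_left_mono) (auto simp: L.nrm_nonneg G.nrm_nonneg)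
        moreover have "nrm ?m ?du ^ 2 \<le> (?h * P)\<^sup>2"
          using elim(2) h by (intro power_mono) (auto simp: A.nrm_nonneg)
        moreover have "vip ?m ?dw ?dw \<le> 2 * nrm ?m ?du ^ 2 + 2 * nrm ?m ?dv ^ 2"
        proof -
          have "vip ?m ?dw ?dw \<le> (nrm ?m ?du + nrm ?m ?dv)\<^sup>2"
            unfolding A.nrm_power2[symmetric] by (intro power_mono incr[OF r(2) s(2)] A.nrm_nonneg)
          also have "\<dots> \<le> 2 * nrm ?m ?du ^ 2 + 2 * nrm ?m ?dv ^ 2"
            using sum_squares_bound[of "nrm ?m ?du" "nrm ?m ?dv"] by (simp add: power2_sum)
          finally show ?thesis .
        qed
        ultimately have "vip ?m ?dw ?dw \<le> ?h * (?h * K)"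
          by (simp add: K_def power_mult_distrib power2_eq_square algebra_simps)
        also have "\<dots> \<le> ?h * (e / 4)"
        proof (rule mult_left_mono)
          have "?h * K \<le> ?h * (K + 1)"
            using h by simp
          also have "\<dots> \<le> e / (4 * (K + 1)) * (K + 1)"
            using elim(6) K0 by (intro mult_right_mono) auto
          also have "\<dots> = e / 4"
            using K0 by (simp add: field_simps)
          finally show "?h * K \<le> e / 4" .
        qed (use h in simp)
        finally show ?thesis .
      qed
      have "E r = E s + 2 * vip ?m ?dw ?w + vip ?m ?dw ?dw"
      proof -
        note XS = XA[OF w1[OF r(2)]] XA[OF W1] XA[OF dw1]
        have "vip ?m ?dw ?dw = vip ?m (w r) ?dw - vip ?m ?w ?dw"
          by (rule A.vip_diff_left[OF XS])
        also have "\<dots> = E r - 2 * vip ?m (w r) ?w + E s"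
          unfolding A.vip_diff_right[OF XS(1,2,1)] A.vip_diff_right[OF XS(1,2,2)] E_def
          using A.vip_sym[of ?w "w r"] by simp
        finally show ?thesis
          using A.vip_diff_left[OF XS(1,2,2)] by (simp add: E_def)
      qed
      also have "\<dots> \<le> E s + ?h * ((6 * ?L + 1) * E s + \<alpha>\<^sup>2 * M\<^sup>2 + e)"
      proof -
        have "2 * vip ?m ?dw ?w + vip ?m ?dw ?dw
          \<le> 2 * (?h * (a + e / 8) - ?h * (b - e / 8) + \<alpha>\<^sup>2 * (M * ?h * nrm ?g ?w)) + ?h * (e / 4)"
          by (intro add_mono mult_left_mono cross quad) simp
        also have "\<dots> = ?h * (2 * (a - b) + \<alpha>\<^sup>2 * (2 * M * nrm ?g ?w) + 3 * e / 4)"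
          by (simp add: field_simps)
        also have "\<dots> \<le> ?h * ((6 * ?L + 1) * E s + \<alpha>\<^sup>2 * M\<^sup>2 + e)"
        proof (rule mult_left_mono)
          have V: "vip (\<lambda>_. 1) ?w ?w \<le> E s" "0 \<le> vip (\<lambda>_. 1) ?w ?w"
            using E_split[OF s(2)] by (auto simp: L.vip_nonneg)
          have "2 * (a - b) \<le> 6 * ?L * vip (\<lambda>_. 1) ?w ?w"
            using ab by simp
          also have "\<dots> \<le> 6 * ?L * E s"
            by (intro mult_left_mono V(1)) (simp add: CW_nonneg R_nonneg)
          finally have 1: "2 * (a - b) \<le> 6 * ?L * E s" .
          \<comment> \<open>Young's inequality separates the fixed source from the gradient, whose
            square with the factor \<open>\<alpha>^2\<close> is part of \<open>E s\<close>.\<close>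
          have "\<alpha>\<^sup>2 * (2 * M * nrm ?g ?w) \<le> \<alpha>\<^sup>2 * (M\<^sup>2 + (nrm ?g ?w)\<^sup>2)"
            by (intro mult_left_mono sum_squares_bound) auto
          also have "\<dots> \<le> \<alpha>\<^sup>2 * M\<^sup>2 + E s"
            using E_split[OF s(2)] V by (simp add: ring_distribs)
          finally have 2: "\<alpha>\<^sup>2 * (2 * M * nrm ?g ?w) \<le> \<alpha>\<^sup>2 * M\<^sup>2 + E s" .
          show "2 * (a - b) + \<alpha>\<^sup>2 * (2 * M * nrm ?g ?w) + 3 * e / 4 \<le> (6 * ?L + 1) * E s + \<alpha>\<^sup>2 * M\<^sup>2 + e"
            using 1 2 e by (simp add: ring_distribs)
        qed (use h in simp)
        finally show ?thesis by simp
      qed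
      finally show ?case by simp
    qed
  qed
  have tS: "t \<in> {0..<S}"
    by (rule sub[OF t])
  have L0: "?L \<ge> 0"
    by (simp add: CW_nonneg R_nonneg)
  \<comment> \<open>The barrier constant exceeds the source strictly and is still proportional to
    \<open>\<alpha>^2\<close>.\<close>
  have "E t \<le> \<alpha>\<^sup>2 * (M\<^sup>2 + 1) * exp ((6 * ?L + 1 + 1) * t)"
  proof (rule dini_gronwall[OF contE _ _ _ _ dini])
    show "E 0 \<le> \<alpha>\<^sup>2 * (M\<^sup>2 + 1)" "0 \<le> 6 * ?L + 1" "0 \<le> t" "t \<le> T"
      using E0 L0 t by auto
    show "\<alpha>\<^sup>2 * M\<^sup>2 < \<alpha>\<^sup>2 * (M\<^sup>2 + 1)" "0 < \<alpha>\<^sup>2 * (M\<^sup>2 + 1)"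
      using \<alpha> by (auto intro!: mult_strict_left_mono mult_pos_pos add_nonneg_pos)
  qed
  also have "\<dots> \<le> \<alpha>\<^sup>2 * growth"
  proof -
    have "(6 * ?L + 1 + 1) * t \<le> (6 * ?L + 1 + 1) * T"
      using t L0 by (intro mult_left_mono) auto
    then have "exp ((6 * ?L + 1 + 1) * t) \<le> exp ((6 * ?L + 1 + 1) * T)"
      by (rule exp_le_cancel_iff[THEN iffD2])
    then show ?thesis
      unfolding growth_def mult.assoc by (intro mult_left_mono) auto
  qed
  finally have "\<alpha>\<^sup>2 * (nrm ?g (w t))\<^sup>2 \<le> \<alpha>\<^sup>2 * growth"
    using E_split[OF tS] L.vip_nonneg[of "w t"] by linarith
  \<comment> \<open>The factor \<open>\<alpha>^2\<close> cancels here, which makes the gradient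
    bound uniform.\<close>
  then have "(nrm ?g (w t))\<^sup>2 \<le> growth"
    using \<alpha> by simp
  then have 1: "nrm ?g (w t) \<le> sqrt growth"
    by (rule real_le_rsqrt)
  have "nrm ?g (v t) \<le> 1 * nrm (sobolev_weight 3) (v t)"
  proof (rule nrm_mono_Hv[OF v3[OF tS]])
    show "W k - 1 \<le> 1\<^sup>2 * sobolev_weight 3 k" for k
      using power_increasing[of 1 3 "W k"] W_ge_1[of k] by (simp add: sobolev_weight_3)
  qed (use W_ge_1 in auto)
  also have "\<dots> \<le> sqrt R"
    using R[OF t] by (simp add: nrm_def)
  finally have 2: "nrm ?g (v t) \<le> sqrt R" .
  have "nrm ?g (u t) \<le> nrm ?g (w t) + nrm ?g (v t)"
    unfolding w_def by (rule G.nrm_le_diff_add[OF XG[OF u1] XG[OF v1[OF tS]]])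
  then show ?thesis
    using 1 2 grad_norm_eq_nrm[OF u1] by simp
qed

end

section \<open>Uniformity in the regularization parameter and conclusion\<close>

lemma cont_curve_bounded:
  assumes cont: "cont_curve (Hv_norm s) {0..<S} v" and v: "\<And>t. t \<in> {0..<S} \<Longrightarrow> v t \<in> Hv s" and TS: "T < S"
  shows "\<exists>R. \<forall>t\<in>{0..T}. vip (sobolev_weight s) (v t) (v t) \<le> R"
proof -
  interpret A: fourier_weight "sobolev_weight s" by (rule fourier_weight_sobolev)
  have "continuous_on {0..T} (\<lambda>t. nrm (sobolev_weight s) (v t))"
    unfolding continuous_on_def
  proof
    fix t assume t: "t \<in> {0..T}"
    let ?F = "at t within {0..T}"
    have "((\<lambda>r. nrm (sobolev_weight s) (\<lambda>x. v r x - v t x)) \<longlongrightarrow> 0) (at t within {0..<S})"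
      using cont t TS by (simp add: cont_curve_def Hv_norm_eq_nrm)
    then have lim: "((\<lambda>r. nrm (sobolev_weight s) (\<lambda>x. v r x - v t x)) \<longlongrightarrow> 0) ?F"
      by (rule tendsto_within_subset) (use TS in auto)
    have "\<forall>\<^sub>F r in ?F. r \<in> {0..T}"
      by (simp add: eventually_at_filter)
    then have "\<forall>\<^sub>F r in ?F. \<bar>nrm (sobolev_weight s) (v r) - nrm (sobolev_weight s) (v t)\<bar>
        \<le> nrm (sobolev_weight s) (\<lambda>x. v r x - v t x)"
    proof eventually_elim
      case (elim r)
      then show ?case
        using v t TS unfolding Hv_eq_Xv by (intro A.nrm_abs_diff) auto
    qed
    then show "((\<lambda>r. nrm (sobolev_weight s) (v r)) \<longlongrightarrow> nrm (sobolev_weight s) (v t)) ?F"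
      by (rule abs_bound_tendsto[OF _ lim])
  qed
  then have "continuous_on {0..T} (\<lambda>t. (nrm (sobolev_weight s) (v t))\<^sup>2)"
    by (intro continuous_intros)
  then have "bounded ((\<lambda>t. vip (sobolev_weight s) (v t) (v t)) ` {0..T})"
    unfolding A.nrm_power2 by (intro compact_imp_bounded compact_continuous_image) auto
  then obtain R where "\<forall>y\<in>(\<lambda>t. vip (sobolev_weight s) (v t) (v t)) ` {0..T}. norm y \<le> R"
    by (auto simp: bounded_iff)
  then show ?thesis
    by (intro exI[of _ R]) (auto dest: abs_le_D1)
qed

text \<open>The bound is \<open>sqrt growth + sqrt R\<close>, built from \<open>T\<close>,
  \<open>R\<close> and absolute constants, so one number serves every
  \<open>\<alpha>\<close>.\<close>

theorem uniform_grad_bound: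
  assumes T: "0 < T" "T < S" and strong: "euler_strong_solution u0 S v"
    and voigt: "\<And>\<alpha>. \<alpha> > 0 \<Longrightarrow> euler_voigt_solution \<alpha> u0 (u \<alpha>)"
  shows "\<exists>Q. \<forall>\<alpha>>0. \<forall>t\<in>{0..T}. grad_norm (u \<alpha> t) \<le> Q"
proof -
  have v3: "v t \<in> Hv 3" and div: "divergence_free (v t)" if "t \<in> {0..<S}" for t
    using strong that by (simp_all add: euler_strong_solution_def)
  have cont: "cont_curve (Hv_norm 3) {0..<S} v" and init: "AE x in Omega. v 0 x = u0 x"
    using strong by (simp_all add: euler_strong_solution_def)
  obtain v' p where deriv: "deriv_curve L2v_norm {0..<S} v v'"
    and v'p: "\<forall>t\<in>{0..<S}. v' t \<in> L2v \<and> p t \<in> H 1"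
    and eq: "\<forall>t\<in>{0..<S}. AE x in Omega. v' t x + advect (v t) (v t) x + grad (p t) x = 0"
    using strong unfolding euler_strong_solution_def by (elim conjE exE) (rule that, assumption+)
  obtain R where R: "\<forall>t\<in>{0..T}. vip (sobolev_weight 3) (v t) (v t) \<le> R"
    using cont_curve_bounded[OF cont v3 T(2)] by blast
  have sol: "solenoidal (v t)" if "t \<in> {0..<S}" for t
    using solenoidal_iff[OF Hv_mono[OF _ v3[OF that]]] div[OF that] by simp
  interpret euler_flow v v' p S T R
  proof
    show "0 < T" "T < S" by (rule T)+
    show "v t \<in> Hv 3" "solenoidal (v t)" if "t \<in> {0..<S}" for t
      using that by (rule v3, rule sol)
    show "v' t \<in> L2v" "p t \<in> H 1" if "t \<in> {0..<S}" for t
      using v'p that by simp_all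
    show "cont_curve (Hv_norm 3) {0..<S} v" "deriv_curve L2v_norm {0..<S} v v'"
      by (rule cont, rule deriv)
    show "AE x in Omega. v' t x + advect (v t) (v t) x + grad (p t) x = 0" if "t \<in> {0..<S}" for t
      by (rule bspec[OF eq that])
    show "vip (sobolev_weight 3) (v t) (v t) \<le> R" if "t \<in> {0..T}" for t
      by (rule bspec[OF R that])
  qed
  show ?thesis
    by (intro exI[of _ "sqrt growth + sqrt R"] allI impI ballI voigt_grad_bound[OF _ voigt init])
qed

theorem theorem2p2:
  fixes s T :: real
    and u0 :: vector_field
    and u :: "real \<Rightarrow> real \<Rightarrow> vector_field"
  assumes "s \<ge> 3"
    and "u0 \<in> Hv s"
    and "divergence_free u0"
    and "mean_zero u0"
    and "\<And>\<alpha>. \<alpha> > 0 \<Longrightarrow> euler_voigt_solution \<alpha> u0 (u \<alpha>)"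
    and "T > 0"
    and "Limsup (at_right 0)
           (\<lambda>\<alpha>. ereal \<alpha> * (SUP t\<in>{0..T}. ereal (grad_norm (u \<alpha> t)))) > 0"
  shows "euler_singularity_within u0 T"
proof (rule ccontr)
  assume "\<not> euler_singularity_within u0 T"
  then have "ereal T < euler_T_max u0"
    by (simp add: euler_singularity_within_def)
  \<comment> \<open>The supremum of existence times need not be attained, but being strictly above
    \<open>T\<close> it leaves room for a solution on an interval reaching past
    \<open>T\<close>.\<close>
  then obtain S v where S: "T < S" and v: "euler_strong_solution u0 S v"
    unfolding euler_T_max_def by (auto simp: less_SUP_iff)
  obtain Q where Q: "\<And>\<alpha> t. \<alpha> > 0 \<Longrightarrow> t \<in> {0..T} \<Longrightarrow> grad_norm (u \<alpha> t) \<le> Q"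
    using uniform_grad_bound[OF \<open>T > 0\<close> S v assms(5)] by blast
  \<comment> \<open>\<open>Q\<close> bounds the supremum over time for every positive
    \<open>\<alpha>\<close>, so the scaled supremum is at most \<open>\<alpha> * Q\<close>, which
    tends to zero.\<close>
  have "\<forall>\<^sub>F \<alpha> in at_right 0. ereal \<alpha> * (SUP t\<in>{0..T}. ereal (grad_norm (u \<alpha> t))) \<le> ereal (\<alpha> * Q)"
    using eventually_at_right_less[of "0::real"]
  proof eventually_elim
    case (elim \<alpha>)
    then have "(SUP t\<in>{0..T}. ereal (grad_norm (u \<alpha> t))) \<le> ereal Q"
      by (intro SUP_least) (simp add: Q)
    then have "ereal \<alpha> * (SUP t\<in>{0..T}. ereal (grad_norm (u \<alpha> t))) \<le> ereal \<alpha> * ereal Q"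
      using elim by (intro ereal_mult_left_mono) auto
    then show ?case by simp
  qed
  then have "Limsup (at_right 0) (\<lambda>\<alpha>. ereal \<alpha> * (SUP t\<in>{0..T}. ereal (grad_norm (u \<alpha> t))))
    \<le> Limsup (at_right 0) (\<lambda>\<alpha>. ereal (\<alpha> * Q))"
    by (rule Limsup_mono)
  also have "\<dots> = 0"
  proof (rule lim_imp_Limsup)
    have "((\<lambda>\<alpha>. \<alpha> * Q) \<longlongrightarrow> 0 * Q) (at_right 0)"
      by (intro tendsto_intros)
    then show "((\<lambda>\<alpha>. ereal (\<alpha> * Q)) \<longlongrightarrow> 0) (at_right 0)"
      by (simp add: zero_ereal_def)
  qed simp
  finally show False
    using assms(7) by simp
qed

end
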